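(* Let $\Omega\subset\mathbb{H}^2$ be a domain and let $u\in C^2(\Omega)$ satisfy $$\Delta_{\mathbb{H}^2}u-2u=0 .$$ Then the map $X_u:\Omega\to\mathbb{L}^3$, $X_u(p)=-u(p)\,p+\nabla u(p)$, is either constant or a branched spacelike maximal immersion with isolated branch points. On its regular set, its Gauss map is the inclusion into $\mathbb{H}^2$. Conversely, every spacelike maximal surface in $\mathbb{L}^3$ whose Gauss map is locally invertible admits locally such an inverse Gauss parametrization, that is, when parametrized locally by its Gauss map $p$ it has the form $X(p)=-u(p)\,p+\nabla u(p)$ with support function $u(p)=\langle X(p),p\rangle$, and this support function satisfies $\Delta_{\mathbb{H}^2}u-2u=0$.
   Context: $\mathbb{L}^3=(\mathbb{R}^3,\langle\,,\,\rangle)$ is Lorentz--Minkowski space of signature $(+,+,-)$. The hyperbolic plane $\mathbb{H}^2$ is the upper sheet (third coordinate positive) of $\{p\in\mathbb{L}^3:\langle p,p\rangle=-1\}$ with the induced Riemannian metric; $\nabla u$ is the intrinsic gradient, regarded as a vector of $T_p\mathbb{H}^2=p^\perp\subset\mathbb{L}^3$, and $\Delta_{\mathbb{H}^2}$ is the metric trace of the Hessian. A domain is a connected open set. The regular set of $X_u$ is $\{p\in\Omega:\det(\operatorname{Hess}u-u\operatorname{Id})(p)\neq0\}$, where $\operatorname{Hess}u(Y)=\nabla_Y\nabla u$; it is the set where $dX_u$ is injective. The branch points of $X_u$ are the points of $\Omega$ outside the regular set. A spacelike immersion is one whose induced metric is positive definite; it is maximal if its mean curvature vanishes. A branched spacelike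 maximal immersion with isolated branch points is a map that is a spacelike maximal immersion away from a discrete set of branch points. The Gauss map of a spacelike surface is its timelike unit normal, taken in $\mathbb{H}^2$ (choice of time orientation). Locally invertible means local diffeomorphism. *)

theory Defs
  imports "HOL-Analysis.Analysis"
begin

subsection \<open>Calculus on embedded surfaces\<close>

text \<open>Maps of class \<open>C\<^sup>k\<close> on an open subset of a Euclidean space.\<close>

primrec Ck_on :: "nat \<Rightarrow> 'a::euclidean_space set \<Rightarrow> ('a \<Rightarrow> 'b::real_normed_vector) \<Rightarrow> bool" where
  "Ck_on 0 S f \<longleftrightarrow> continuous_on S f"
| "Ck_on (Suc k) S f \<longleftrightarrow>
     (\<forall>x\<in>S. f differentiable (at x)) \<and> (\<forall>v. Ck_on k S (\<lambda>x. frechet_derivative f (at x) v))"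

text \<open>
  A surface is a two-dimensional embedded \<open>C\<^sup>2\<close> submanifold \<open>M\<close> of some Euclidean space
  (by Whitney's theorem every abstract surface is of this form).  Open subsets of
  the hyperbolic plane and of the Euclidean plane are instances.
\<close>

definition local_param :: "'m::euclidean_space set \<Rightarrow> (real^2) set \<Rightarrow> (real^2 \<Rightarrow> 'm) \<Rightarrow> bool" where
  "local_param M U \<phi> \<longleftrightarrow>
     open U \<and> openin (top_of_set M) (\<phi> ` U) \<and> (\<exists>\<psi>. homeomorphism U (\<phi> ` U) \<phi> \<psi>) \<and>
     Ck_on 2 U \<phi> \<and> (\<forall>x\<in>U. inj (frechet_derivative \<phi> (at x)))"

definition is_surface :: "'m::euclidean_space set \<Rightarrow> bool" where
  "is_surface M \<longleftrightarrow> (\<forall>p\<in>M. \<exists>U \<phi>. local_param M U \<phi> \<and> p \<in> \<phi> ` U)"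

text \<open>Meaningful for \<open>k \<le> 2\<close>, since the surfaces are of class \<open>C\<^sup>2\<close>.\<close>

definition surf_Ck :: "nat \<Rightarrow> 'm::euclidean_space set \<Rightarrow> ('m \<Rightarrow> 'b::real_normed_vector) \<Rightarrow> bool" where
  "surf_Ck k M f \<longleftrightarrow> (\<forall>U \<phi>. local_param M U \<phi> \<longrightarrow> Ck_on k U (f \<circ> \<phi>))"

definition tangent_space :: "'m::euclidean_space set \<Rightarrow> 'm \<Rightarrow> 'm set" where
  "tangent_space M p =
     {v. \<exists>\<gamma>::real \<Rightarrow> 'm. \<gamma> 0 = p \<and> (\<forall>t. \<gamma> t \<in> M) \<and> (\<gamma> has_vector_derivative v) (at 0)}"

text \<open>
  The derivative within \<open>M\<close> is determined only on the tangent space; below it is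
  only ever applied to tangent vectors, where it is the differential of \<open>f\<close>.
\<close>

definition surf_diff ::
  "'m::euclidean_space set \<Rightarrow> ('m \<Rightarrow> 'b::real_normed_vector) \<Rightarrow> 'm \<Rightarrow> 'm \<Rightarrow> 'b" where
  "surf_diff M f p = frechet_derivative f (at p within M)"

definition C1_diffeo ::
  "'m::euclidean_space set \<Rightarrow> 'n::euclidean_space set \<Rightarrow> ('m \<Rightarrow> 'n) \<Rightarrow> ('n \<Rightarrow> 'm) \<Rightarrow> bool" where
  "C1_diffeo V W f g \<longleftrightarrow> homeomorphism V W f g \<and> surf_Ck 1 V f \<and> surf_Ck 1 W g"

definition local_diffeo ::
  "'m::euclidean_space set \<Rightarrow> 'n::euclidean_space set \<Rightarrow> ('m \<Rightarrow> 'n) \<Rightarrow> bool" where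
  "local_diffeo M M' f \<longleftrightarrow>
     (\<forall>q\<in>M. \<exists>V W g. openin (top_of_set M) V \<and> q \<in> V \<and> openin (top_of_set M') W \<and>
        C1_diffeo V W f g)"

text \<open>
  Orthonormal frames of a two-dimensional space \<open>T\<close> carrying a positive definite
  form \<open>g\<close>; the trace of a bilinear form and the determinant of an endomorphism do
  not depend on the frame.
\<close>

definition orthonormal_frame ::
  "('v \<Rightarrow> 'v \<Rightarrow> real) \<Rightarrow> 'v set \<Rightarrow> (2 \<Rightarrow> 'v) \<Rightarrow> bool" where
  "orthonormal_frame g T e \<longleftrightarrow>
     (\<forall>i. e i \<in> T) \<and> (\<forall>i j. g (e i) (e j) = (if i = j then 1 else 0))"

definition metric_trace ::
  "('v \<Rightarrow> 'v \<Rightarrow> real) \<Rightarrow> 'v set \<Rightarrow> ('v \<Rightarrow> 'v \<Rightarrow> real) \<Rightarrow> real" where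
  "metric_trace g T b =
     (THE t. \<forall>e. orthonormal_frame g T e \<longrightarrow> t = (\<Sum>i\<in>UNIV. b (e i) (e i)))"

definition endo_det ::
  "('v \<Rightarrow> 'v \<Rightarrow> real) \<Rightarrow> 'v set \<Rightarrow> ('v \<Rightarrow> 'v) \<Rightarrow> real" where
  "endo_det g T A =
     (THE d. \<forall>e. orthonormal_frame g T e \<longrightarrow>
        d = det ((\<chi> i j. g (A (e j)) (e i)) :: real^2^2))"

subsection \<open>Lorentz--Minkowski space and the hyperbolic plane\<close>

definition lprod :: "real^3 \<Rightarrow> real^3 \<Rightarrow> real" where
  "lprod x y = x$1 * y$1 + x$2 * y$2 - x$3 * y$3"

definition H2 :: "(real^3) set" where
  "H2 = {p. lprod p p = -1 \<and> p$3 > 0}"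

definition H2_tangent :: "real^3 \<Rightarrow> (real^3) set" where
  "H2_tangent p = {v. lprod v p = 0}"

definition H2_domain :: "(real^3) set \<Rightarrow> bool" where
  "H2_domain \<Omega> \<longleftrightarrow> openin (top_of_set H2) \<Omega> \<and> connected \<Omega>"

definition H2_grad :: "(real^3 \<Rightarrow> real) \<Rightarrow> real^3 \<Rightarrow> real^3" where
  "H2_grad u p =
     (THE w. w \<in> H2_tangent p \<and> (\<forall>v\<in>H2_tangent p. lprod w v = surf_diff H2 u p v))"

text \<open>
  The Levi-Civita connection is the ambient derivative followed by the Lorentz
  orthogonal projection to \<open>T\<^sub>p\<close>, which is \<open>w \<mapsto> w + \<langle>w, p\<rangle> p\<close> because \<open>\<langle>p, p\<rangle> = -1\<close>.
\<close>

definition H2_cov :: "(real^3 \<Rightarrow> real^3) \<Rightarrow> real^3 \<Rightarrow> real^3 \<Rightarrow> real^3" where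
  "H2_cov V p Y = surf_diff H2 V p Y + lprod (surf_diff H2 V p Y) p *\<^sub>R p"

definition H2_hess :: "(real^3 \<Rightarrow> real) \<Rightarrow> real^3 \<Rightarrow> real^3 \<Rightarrow> real^3" where
  "H2_hess u p Y = H2_cov (H2_grad u) p Y"

definition H2_laplacian :: "(real^3 \<Rightarrow> real) \<Rightarrow> real^3 \<Rightarrow> real" where
  "H2_laplacian u p = metric_trace lprod (H2_tangent p) (\<lambda>v w. lprod (H2_hess u p v) w)"

subsection \<open>Spacelike surfaces\<close>

text \<open>A map with positive definite induced metric is automatically an immersion.\<close>

definition spacelike_immersion :: "'m::euclidean_space set \<Rightarrow> ('m \<Rightarrow> real^3) \<Rightarrow> bool" where
  "spacelike_immersion M X \<longleftrightarrow>
     is_surface M \<and> surf_Ck 2 M X \<and>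
     (\<forall>q\<in>M. \<forall>v\<in>tangent_space M q. v \<noteq> 0 \<longrightarrow> lprod (surf_diff M X q v) (surf_diff M X q v) > 0)"

definition gauss_map :: "'m::euclidean_space set \<Rightarrow> ('m \<Rightarrow> real^3) \<Rightarrow> 'm \<Rightarrow> real^3" where
  "gauss_map M X q =
     (THE n. n \<in> H2 \<and> (\<forall>v\<in>tangent_space M q. lprod (surf_diff M X q v) n = 0))"

text \<open>
  Half the trace, with respect to the induced metric, of the second fundamental
  form \<open>(v, w) \<mapsto> -\<langle>dN v, dX w\<rangle>\<close>, where \<open>N\<close> is the Gauss map.
\<close>

definition mean_curvature :: "'m::euclidean_space set \<Rightarrow> ('m \<Rightarrow> real^3) \<Rightarrow> 'm \<Rightarrow> real" where
  "mean_curvature M X q =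
     metric_trace (\<lambda>v w. lprod (surf_diff M X q v) (surf_diff M X q w)) (tangent_space M q)
       (\<lambda>v w. - lprod (surf_diff M (gauss_map M X) q v) (surf_diff M X q w)) / 2"

definition maximal_immersion :: "'m::euclidean_space set \<Rightarrow> ('m \<Rightarrow> real^3) \<Rightarrow> bool" where
  "maximal_immersion M X \<longleftrightarrow>
     spacelike_immersion M X \<and> (\<forall>q\<in>M. mean_curvature M X q = 0)"

definition branched_maximal_immersion ::
  "'m::euclidean_space set \<Rightarrow> 'm set \<Rightarrow> ('m \<Rightarrow> real^3) \<Rightarrow> bool" where
  "branched_maximal_immersion M B X \<longleftrightarrow>
     surf_Ck 2 M X \<and> closedin (top_of_set M) B \<and> discrete B \<and> maximal_immersion (M - B) X"

subsection \<open>The inverse Gauss parametrization\<close>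

definition X_of :: "(real^3 \<Rightarrow> real) \<Rightarrow> real^3 \<Rightarrow> real^3" where
  "X_of u p = - u p *\<^sub>R p + H2_grad u p"

definition regular_set :: "(real^3) set \<Rightarrow> (real^3 \<Rightarrow> real) \<Rightarrow> (real^3) set" where
  "regular_set \<Omega> u =
     {p\<in>\<Omega>. endo_det lprod (H2_tangent p) (\<lambda>Y. H2_hess u p Y - u p *\<^sub>R Y) \<noteq> 0}"

definition branch_points :: "(real^3) set \<Rightarrow> (real^3 \<Rightarrow> real) \<Rightarrow> (real^3) set" where
  "branch_points \<Omega> u = \<Omega> - regular_set \<Omega> u"

text \<open>\<open>g\<close> parametrizes an open piece of \<open>M\<close> by the values of the Gauss map of \<open>X\<close>.\<close>

definition local_gauss_inverse ::
  "'m::euclidean_space set \<Rightarrow> ('m \<Rightarrow> real^3) \<Rightarrow> (real^3) set \<Rightarrow> (real^3 \<Rightarrow> 'm) \<Rightarrow> bool" where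
  "local_gauss_inverse M X W g \<longleftrightarrow>
     H2_domain W \<and> openin (top_of_set M) (g ` W) \<and> C1_diffeo (g ` W) W (gauss_map M X) g"

definition support_fun :: "('m \<Rightarrow> real^3) \<Rightarrow> (real^3 \<Rightarrow> 'm) \<Rightarrow> real^3 \<Rightarrow> real" where
  "support_fun X g p = lprod (X (g p)) p"

end

theory Submission
  imports Defs "HOL-Complex_Analysis.Complex_Analysis"
begin

text \<open>
  On \<open>p\<^sup>\<bottom>\<close> the differential of \<open>X\<^sub>u\<close> is the symmetric endomorphism \<open>Hess u - u Id\<close>, and
  \<open>\<Delta>u = 2u\<close> says that its trace vanishes.  In the Poincare disc, with chart \<open>z \<mapsto> p(z)\<close> and conformal
  factor \<open>\<lambda>\<close>, a trace-free symmetric endomorphism is given by a single complex number: \<open>dX\<^sub>u\<close> is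
  \<open>h \<mapsto> dp(cnj (q h) / \<lambda>)\<close>, where \<open>q\<close> is the coefficient of the Hopf differential.  The point is that
  \<open>q\<close> is holomorphic, although for \<open>u\<close> of class \<open>C\<^sup>2\<close> it is at first only continuous.  Put
  \<open>U = u \<circ> p\<close> and \<open>P = U\<^sub>x - \<i> U\<^sub>y\<close>.  Then \<open>dP = q dz + \<beta>\<close> with a one-form \<open>\<beta>\<close> whose coefficients
  involve only \<open>U\<close> and \<open>P\<close>, hence of class \<open>C\<^sup>1\<close>, and the equation makes \<open>\<beta>\<close> closed.  Locally
  \<open>\<beta> = dG\<close>, so \<open>P - G\<close> is complex differentiable with derivative \<open>q\<close>
  (\<open>closed_form_has_primitive\<close>, \<open>hopf_holomorphic\<close>, \<open>X_of_weierstrass\<close>).  This takes the place of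
  elliptic regularity.

  Everything about \<open>X\<^sub>u\<close> can be read off from \<open>q\<close>.  It is smooth, because the components of its
  derivative are real parts of holomorphic functions.  The determinant of \<open>Hess u - u Id\<close> is
  \<open>-|q|\<^sup>2 / \<lambda>\<^sup>2\<close>, so the branch points are the zeros of \<open>q\<close>: on a connected domain they are isolated,
  or \<open>q\<close> vanishes identically and \<open>X\<^sub>u\<close> is constant.  Elsewhere the induced metric is \<open>|q|\<^sup>2 / \<lambda>\<close>
  times the Euclidean metric of the disc, the image of \<open>dX\<^sub>u\<close> is all of \<open>p\<^sup>\<bottom>\<close>, the Gauss map is
  therefore \<open>p\<close> itself, and the mean curvature is a multiple of the trace of \<open>dX\<^sub>u\<close>
  (\<open>weierstrass_maximal\<close>).

  Conversely let \<open>g\<close> invert the Gauss map locally and let \<open>Y = X \<circ> g\<close>, a map of class \<open>C\<^sup>1\<close>.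
  As \<open>dY\<close> is orthogonal to the normal \<open>p\<close>, the support function \<open>u = \<langle>Y, p\<rangle>\<close> satisfies
  \<open>du = \<langle>Y, dp\<rangle>\<close>.  So \<open>u\<close> has one derivative more than \<open>Y\<close>, its gradient is \<open>Y + u p\<close>, and
  \<open>Y = X\<^sub>u\<close>.  Up to sign \<open>dY\<close> is the inverse of the shape operator on \<open>p\<^sup>\<bottom>\<close>; the inverse of an
  invertible trace-free endomorphism of a plane is trace-free, which gives \<open>\<Delta>u = 2u\<close>
  (\<open>gauss_parametrization\<close>).  For an abstract surface in some Euclidean space, the chain rule for
  \<open>X \<circ> g\<close> rests on extending \<open>C\<^sup>1\<close> maps from the surface to the ambient space, by the inverse
  function theorem (\<open>surf_C1_extension\<close>).
\<close>

unbundle no fps_syntax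

section \<open>Maps of class \<open>C\<^sup>k\<close>\<close>

lemma Ck_on_cong:
  assumes "open S" "\<And>x. x \<in> S \<Longrightarrow> f x = g x" "Ck_on k S f"
  shows "Ck_on k S g"
  using assms(2,3)
proof (induction k arbitrary: f g)
  case 0
  then show ?case by (simp cong: continuous_on_cong)
next
  case (Suc k)
  have d: "g differentiable (at x)" "frechet_derivative f (at x) = frechet_derivative g (at x)" if "x \<in> S" for x
  proof -
    have fd: "f differentiable (at x)" using Suc.prems that by simp
    from fd obtain D where "(f has_derivative D) (at x)" unfolding differentiable_def by blast
    from has_derivative_transform_within_open[OF this \<open>open S\<close> that Suc.prems(1)]
    show "g differentiable (at x)" unfolding differentiable_def by blast
    show "frechet_derivative f (at x) = frechet_derivative g (at x)"
      using frechet_derivative_transform_within_open[OF fd \<open>open S\<close> that Suc.prems(1)] by simp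
  qed
  have "Ck_on k S (\<lambda>x. frechet_derivative g (at x) v)" for v
    by (rule Suc.IH[of "\<lambda>x. frechet_derivative f (at x) v"]) (use Suc.prems d in auto)
  then show ?case using d by simp
qed

text \<open>
  \<^const>\<open>Ck_on\<close> speaks of a chosen derivative; on an open set any pointwise formula for the
  derivative may be used instead.
\<close>

lemma Ck_on_SucI:
  assumes "open S" "\<And>x. x \<in> S \<Longrightarrow> (f has_derivative D x) (at x)"
    and "\<And>v. Ck_on k S (\<lambda>x. D x v)"
  shows "Ck_on (Suc k) S f"
proof -
  have "frechet_derivative f (at x) = D x" if "x \<in> S" for x
    using frechet_derivative_at[OF assms(2)[OF that]] by simp
  then have "Ck_on k S (\<lambda>x. frechet_derivative f (at x) v)" for v
    using Ck_on_cong[OF assms(1) _ assms(3)[of v]] by simp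
  then show ?thesis using assms(2) by (auto simp: differentiable_def)
qed

lemma Ck_on_SucD:
  assumes "Ck_on (Suc k) S f" "x \<in> S"
  shows "(f has_derivative frechet_derivative f (at x)) (at x)"
  using assms frechet_derivative_works by auto

lemma Ck_on_SucD':
  assumes "Ck_on (Suc k) S f"
  shows "Ck_on k S (\<lambda>x. frechet_derivative f (at x) v)"
  using assms by auto

lemma Ck_on_Suc_imp: "Ck_on (Suc k) S f \<Longrightarrow> Ck_on k S f"
proof (induction k arbitrary: f)
  case 0
  then show ?case
    by (auto intro!: continuous_at_imp_continuous_on differentiable_imp_continuous_within)
next
  case (Suc k)
  then show ?case by (metis Ck_on.simps(2))
qed

lemma Ck_on_mono:
  assumes "Ck_on m S f" "k \<le> m"
  shows "Ck_on k S f"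
  using assms(2,1) by (induction rule: dec_induct) (use Ck_on_Suc_imp in blast)+

lemma Ck_on_continuous: "Ck_on k S f \<Longrightarrow> continuous_on S f"
  by (induction k) (use Ck_on_Suc_imp in auto)

lemma Ck_on_subset: "Ck_on k S f \<Longrightarrow> T \<subseteq> S \<Longrightarrow> Ck_on k T f"
  by (induction k arbitrary: f) (auto intro: continuous_on_subset)

lemma Ck_on_local:
  assumes "open S" "\<And>x. x \<in> S \<Longrightarrow> \<exists>V. open V \<and> x \<in> V \<and> Ck_on k (S \<inter> V) f"
  shows "Ck_on k S f"
  using assms(2)
proof (induction k arbitrary: f)
  case 0
  have "isCont f x" if "x \<in> S" for x
    using 0[OF that] that \<open>open S\<close> by (auto simp: continuous_on_eq_continuous_at open_Int)
  then show ?case by (simp add: continuous_at_imp_continuous_on)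
next
  case (Suc k)
  have "Ck_on k S (\<lambda>x. frechet_derivative f (at x) v)" for v
  proof (rule Suc.IH)
    fix x assume "x \<in> S"
    then show "\<exists>V. open V \<and> x \<in> V \<and> Ck_on k (S \<inter> V) (\<lambda>x. frechet_derivative f (at x) v)"
      using Suc.prems by (metis Ck_on.simps(2))
  qed
  moreover have "f differentiable (at x)" if "x \<in> S" for x
    using Suc.prems[OF that] that by auto
  ultimately show ?case by simp
qed

lemma Ck_on_const [simp]: "Ck_on k S (\<lambda>x. c)"
  by (induction k arbitrary: c) auto

lemma Ck_on_bounded_linear:
  assumes "bounded_linear f" "open S"
  shows "Ck_on k S f"
proof (cases k)
  case 0
  then show ?thesis using assms by (simp add: linear_continuous_on)
next
  case (Suc k)
  have "Ck_on (Suc m) S f" for m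
    using assms by (intro Ck_on_SucI[where D = "\<lambda>x. f"] bounded_linear_imp_has_derivative) auto
  then show ?thesis using Suc by simp
qed

lemma Ck_on_add:
  assumes "open S"
  shows "Ck_on k S f \<Longrightarrow> Ck_on k S g \<Longrightarrow> Ck_on k S (\<lambda>x. f x + g x)"
proof (induction k arbitrary: f g)
  case (Suc k)
  show ?case
  proof (rule Ck_on_SucI[OF assms])
    show "((\<lambda>x. f x + g x) has_derivative
        (\<lambda>v. frechet_derivative f (at x) v + frechet_derivative g (at x) v)) (at x)" if "x \<in> S" for x
      by (intro has_derivative_add Ck_on_SucD[OF Suc.prems(1) that] Ck_on_SucD[OF Suc.prems(2) that])
  qed (use Suc in auto)
qed (simp add: continuous_on_add)

lemma Ck_on_sum:
  assumes "open S" "finite I" "\<And>i. i \<in> I \<Longrightarrow> Ck_on k S (f i)"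
  shows "Ck_on k S (\<lambda>x. \<Sum>i\<in>I. f i x)"
  using assms(2,3) by (induction I rule: finite_induct) (auto intro: Ck_on_add[OF assms(1)])

lemma Ck_on_bilinear:
  assumes "bounded_bilinear B" "open S"
  shows "Ck_on k S f \<Longrightarrow> Ck_on k S g \<Longrightarrow> Ck_on k S (\<lambda>x. B (f x) (g x))"
proof (induction k arbitrary: f g)
  case 0
  then show ?case using bounded_bilinear.continuous_on[OF assms(1)] by simp
next
  case (Suc k)
  show ?case
  proof (rule Ck_on_SucI[OF assms(2)])
    show "((\<lambda>x. B (f x) (g x)) has_derivative
        (\<lambda>v. B (f x) (frechet_derivative g (at x) v) + B (frechet_derivative f (at x) v) (g x))) (at x)"
      if "x \<in> S" for x
      by (intro bounded_bilinear.FDERIV[OF assms(1)] Ck_on_SucD[OF Suc.prems(1) that]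
          Ck_on_SucD[OF Suc.prems(2) that])
    show "Ck_on k S (\<lambda>x. B (f x) (frechet_derivative g (at x) v) + B (frechet_derivative f (at x) v) (g x))" for v
      by (intro Ck_on_add[OF assms(2)] Suc.IH Ck_on_Suc_imp[OF Suc.prems(1)]
          Ck_on_Suc_imp[OF Suc.prems(2)] Ck_on_SucD'[OF Suc.prems(1)] Ck_on_SucD'[OF Suc.prems(2)])
  qed
qed

text \<open>
  Expanding \<open>D g x v\<close> in the standard basis turns \<open>D f (g x) (D g x v)\<close> into a sum of products of
  functions to which the induction hypothesis applies.
\<close>

lemma Ck_on_compose:
  fixes f :: "'b::euclidean_space \<Rightarrow> 'c::real_normed_vector" and g :: "'a::euclidean_space \<Rightarrow> 'b"
  assumes "open S" "g ` S \<subseteq> T"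
  shows "Ck_on k T f \<Longrightarrow> Ck_on k S g \<Longrightarrow> Ck_on k S (\<lambda>x. f (g x))"
proof (induction k arbitrary: f)
  case 0
  then show ?case using assms continuous_on_compose2 by (metis Ck_on.simps(1))
next
  case (Suc k)
  let ?g = "\<lambda>x. frechet_derivative g (at x)" and ?f = "\<lambda>x. frechet_derivative f (at x)"
  show ?case
  proof (rule Ck_on_SucI[OF assms(1)])
    show "((\<lambda>x. f (g x)) has_derivative (\<lambda>v. \<Sum>b\<in>Basis. (?g x v \<bullet> b) *\<^sub>R ?f (g x) b)) (at x)"
      if "x \<in> S" for x
    proof -
      have f: "(f has_derivative ?f (g x)) (at (g x))"
        using Suc.prems(1) assms(2) that by (intro Ck_on_SucD[of k T]) auto
      then interpret bounded_linear "?f (g x)" by (rule has_derivative_bounded_linear)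
      have "?f (g x) (?g x v) = (\<Sum>b\<in>Basis. (?g x v \<bullet> b) *\<^sub>R ?f (g x) b)" for v
        by (subst euclidean_representation[of "?g x v", symmetric]) (simp add: sum scaleR)
      then show ?thesis
        using has_derivative_compose[OF Ck_on_SucD[OF Suc.prems(2) that] f] by simp
    qed
    show "Ck_on k S (\<lambda>x. \<Sum>b\<in>Basis. (?g x v \<bullet> b) *\<^sub>R ?f (g x) b)" for v
    proof (intro Ck_on_sum[OF assms(1)] Ck_on_bilinear[OF bounded_bilinear_scaleR assms(1)])
      fix b :: 'b
      show "Ck_on k S (\<lambda>x. ?g x v \<bullet> b)"
        by (intro Ck_on_bilinear[OF bounded_bilinear_inner assms(1)] Ck_on_SucD'[OF Suc.prems(2)] Ck_on_const)
      show "Ck_on k S (\<lambda>x. ?f (g x) b)"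
        by (intro Suc.IH Ck_on_SucD'[OF Suc.prems(1)] Ck_on_Suc_imp[OF Suc.prems(2)])
    qed simp
  qed
qed

lemma Ck_on_linear_compose:
  fixes L :: "'b::euclidean_space \<Rightarrow> 'c::real_normed_vector" and f :: "'a::euclidean_space \<Rightarrow> 'b"
  assumes "bounded_linear L" "open S" "Ck_on k S f"
  shows "Ck_on k S (\<lambda>x. L (f x))"
  by (rule Ck_on_compose[OF assms(2) subset_UNIV Ck_on_bounded_linear[OF assms(1) open_UNIV] assms(3)])

lemma Ck_on_inverse:
  fixes f :: "'a::euclidean_space \<Rightarrow> real"
  assumes "open S" "\<And>x. x \<in> S \<Longrightarrow> f x \<noteq> 0"
  shows "Ck_on k S f \<Longrightarrow> Ck_on k S (\<lambda>x. inverse (f x))"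
proof (induction k)
  case 0
  then show ?case using assms by (auto intro: continuous_on_inverse)
next
  case (Suc k)
  note mult = Ck_on_bilinear[OF bounded_bilinear_mult assms(1)]
  show ?case
  proof (rule Ck_on_SucI[OF assms(1)])
    show "((\<lambda>x. inverse (f x)) has_derivative
       (\<lambda>v. (- 1) * (inverse (f x) * frechet_derivative f (at x) v * inverse (f x)))) (at x)" if "x \<in> S" for x
      using Deriv.has_derivative_inverse[OF assms(2)[OF that] Ck_on_SucD[OF Suc.prems that]] by simp
    show "Ck_on k S (\<lambda>x. (- 1) * (inverse (f x) * frechet_derivative f (at x) v * inverse (f x)))" for v
      by (intro mult Ck_on_const Suc.IH Ck_on_Suc_imp[OF Suc.prems] Ck_on_SucD'[OF Suc.prems])
  qed
qed

lemma Ck_on_vec: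
  fixes f :: "'a::euclidean_space \<Rightarrow> real^'n"
  assumes "open S" "\<And>i. Ck_on k S (\<lambda>x. f x $ i)"
  shows "Ck_on k S f"
proof -
  have "f x = (\<Sum>i\<in>UNIV. (f x $ i) *\<^sub>R axis i 1)" for x
    using basis_expansion[of "f x"] by (simp add: scalar_mult_eq_scaleR)
  moreover have "Ck_on k S (\<lambda>x. \<Sum>i\<in>UNIV. (f x $ i) *\<^sub>R axis i (1::real))"
    by (intro Ck_on_sum[OF assms(1)] Ck_on_bilinear[OF bounded_bilinear_scaleR assms(1)] assms(2)
        Ck_on_const) simp
  ultimately show ?thesis by simp
qed

lemma holomorphic_imp_Ck_on:
  assumes "open S"
  shows "f holomorphic_on S \<Longrightarrow> Ck_on k S f"
proof (induction k arbitrary: f)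
  case 0
  then show ?case by (simp add: holomorphic_on_imp_continuous_on)
next
  case (Suc k)
  show ?case
  proof (rule Ck_on_SucI[OF assms])
    show "(f has_derivative (\<lambda>v. deriv f z * v)) (at z)" if "z \<in> S" for z
      using holomorphic_derivI[OF Suc.prems assms that] by (simp add: has_field_derivative_def)
    show "Ck_on k S (\<lambda>z. deriv f z * v)" for v
      by (intro Suc.IH holomorphic_intros holomorphic_deriv Suc.prems assms)
  qed
qed

section \<open>Symmetry of second derivatives and closed one-forms\<close>

text \<open>
  The mean value theorem, once along \<open>h\<close> and once along \<open>k\<close>.  The left-hand side of the identity is
  symmetric in \<open>h\<close> and \<open>k\<close>, which is what forces mixed second derivatives to agree.
\<close>

lemma second_difference_mvt:
  fixes f :: "'a::euclidean_space \<Rightarrow> real"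
  assumes f: "\<And>y. y \<in> S \<Longrightarrow> (f has_derivative D y) (at y)"
    and D: "\<And>y. y \<in> S \<Longrightarrow> ((\<lambda>y. D y h) has_derivative D2 y) (at y)"
    and S: "\<And>a b. 0 \<le> a \<Longrightarrow> a \<le> s \<Longrightarrow> 0 \<le> b \<Longrightarrow> b \<le> s \<Longrightarrow> x + a *\<^sub>R h + b *\<^sub>R k \<in> S"
    and s: "0 < s"
  obtains a b where "0 < a" "a < s" "0 < b" "b < s"
    "f (x + s *\<^sub>R h + s *\<^sub>R k) - f (x + s *\<^sub>R h) - f (x + s *\<^sub>R k) + f x
       = s * s * D2 (x + a *\<^sub>R h + b *\<^sub>R k) k"
proof -
  have line: "((\<lambda>\<tau>. f (y + \<tau> *\<^sub>R h)) has_real_derivative D (y + t *\<^sub>R h) h) (at t)"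
    if "y + t *\<^sub>R h \<in> S" for y t
  proof -
    interpret bounded_linear "D (y + t *\<^sub>R h)"
      using f[OF that] by (rule has_derivative_bounded_linear)
    have "((\<lambda>\<tau>. y + \<tau> *\<^sub>R h) has_derivative (\<lambda>\<tau>. \<tau> *\<^sub>R h)) (at t)"
      by (auto intro!: derivative_eq_intros)
    from has_derivative_compose[OF this f[OF that]] show ?thesis
      by (simp add: has_field_derivative_def scaleR mult_commute_abs)
  qed
  define \<phi> where "\<phi> = (\<lambda>\<tau>. f (x + s *\<^sub>R k + \<tau> *\<^sub>R h) - f (x + \<tau> *\<^sub>R h))"
  have "\<exists>a>0. a < s \<and> \<phi> s - \<phi> 0 = (s - 0) * (D (x + s *\<^sub>R k + a *\<^sub>R h) h - D (x + a *\<^sub>R h) h)"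
  proof (rule MVT2[OF s])
    fix t assume t: "0 \<le> t" "t \<le> s"
    have "x + s *\<^sub>R k + t *\<^sub>R h \<in> S" "x + t *\<^sub>R h \<in> S"
      using S[of t s] S[of t 0] t s by (auto simp: algebra_simps)
    then show "DERIV \<phi> t :> D (x + s *\<^sub>R k + t *\<^sub>R h) h - D (x + t *\<^sub>R h) h"
      unfolding \<phi>_def by (intro DERIV_diff line)
  qed
  then obtain a where a: "0 < a" "a < s"
    "\<phi> s - \<phi> 0 = s * (D (x + s *\<^sub>R k + a *\<^sub>R h) h - D (x + a *\<^sub>R h) h)" by auto
  define \<psi> where "\<psi> = (\<lambda>\<tau>. D (x + a *\<^sub>R h + \<tau> *\<^sub>R k) h)"
  have "\<exists>b>0. b < s \<and> \<psi> s - \<psi> 0 = (s - 0) * D2 (x + a *\<^sub>R h + b *\<^sub>R k) k"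
  proof (rule MVT2[OF s])
    fix t assume t: "0 \<le> t" "t \<le> s"
    have *: "x + a *\<^sub>R h + t *\<^sub>R k \<in> S" using S[of a t] a t by auto
    interpret bounded_linear "D2 (x + a *\<^sub>R h + t *\<^sub>R k)"
      using D[OF *] by (rule has_derivative_bounded_linear)
    have "((\<lambda>\<tau>. x + a *\<^sub>R h + \<tau> *\<^sub>R k) has_derivative (\<lambda>\<tau>. \<tau> *\<^sub>R k)) (at t)"
      by (auto intro!: derivative_eq_intros)
    from has_derivative_compose[OF this D[OF *]]
    show "DERIV \<psi> t :> D2 (x + a *\<^sub>R h + t *\<^sub>R k) k"
      by (simp add: has_field_derivative_def scaleR mult_commute_abs \<psi>_def)
  qed
  then obtain b where b: "0 < b" "b < s" "\<psi> s - \<psi> 0 = s * D2 (x + a *\<^sub>R h + b *\<^sub>R k) k" by auto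
  have "f (x + s *\<^sub>R h + s *\<^sub>R k) - f (x + s *\<^sub>R h) - f (x + s *\<^sub>R k) + f x = \<phi> s - \<phi> 0"
    by (simp add: \<phi>_def algebra_simps)
  also have "\<dots> = s * (\<psi> s - \<psi> 0)" unfolding a(3) \<psi>_def by (simp add: algebra_simps)
  finally show thesis using that[of a b] a b by (simp add: mult.assoc)
qed

lemma second_derivative_symmetric:
  fixes f :: "'a::euclidean_space \<Rightarrow> real"
  assumes S: "open S" "x \<in> S"
    and f: "\<And>y. y \<in> S \<Longrightarrow> (f has_derivative D y) (at y)"
    and D: "\<And>h y. y \<in> S \<Longrightarrow> ((\<lambda>y. D y h) has_derivative D2 h y) (at y)"
    and cont: "\<And>h k. continuous_on S (\<lambda>y. D2 h y k)"
  shows "D2 h x k = D2 k x h"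
proof (rule ccontr)
  assume "D2 h x k \<noteq> D2 k x h"
  define e where "e = \<bar>D2 h x k - D2 k x h\<bar> / 2"
  have e: "e > 0" using \<open>D2 h x k \<noteq> D2 k x h\<close> by (simp add: e_def)
  have "\<forall>\<^sub>F y in nhds x. y \<in> S \<and> dist (D2 h y k) (D2 h x k) < e \<and> dist (D2 k y h) (D2 k x h) < e"
  proof (intro eventually_conj)
    show "\<forall>\<^sub>F y in nhds x. y \<in> S" using S eventually_nhds_in_open by blast
    have "((\<lambda>y. D2 i y j) \<longlongrightarrow> D2 i x j) (nhds x)" for i j
      using cont[of i j] S tendsto_at_iff_tendsto_nhds[of "\<lambda>y. D2 i y j" x]
      by (simp add: continuous_on_eq_continuous_at isCont_def)
    then show "\<forall>\<^sub>F y in nhds x. dist (D2 h y k) (D2 h x k) < e"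
      "\<forall>\<^sub>F y in nhds x. dist (D2 k y h) (D2 k x h) < e"
      using tendstoD[OF _ e] by blast+
  qed
  then obtain \<delta> where \<delta>: "\<delta> > 0" "\<And>y. dist y x < \<delta> \<Longrightarrow>
      y \<in> S \<and> dist (D2 h y k) (D2 h x k) < e \<and> dist (D2 k y h) (D2 k x h) < e"
    unfolding eventually_nhds_metric by blast
  \<comment> \<open>small enough that the whole parallelogram spanned by \<open>s h\<close> and \<open>s k\<close> at \<open>x\<close> stays within \<open>\<delta>\<close> of \<open>x\<close>\<close>
  define s where "s = \<delta> / (2 * (norm h + norm k + 1))"
  have n: "norm h + norm k + 1 > 0" by (smt (verit) norm_ge_zero)
  then have s: "s > 0" using \<delta> by (simp add: s_def)
  have near: "dist (x + a *\<^sub>R h + b *\<^sub>R k) x < \<delta>" if "0 \<le> a" "a \<le> s" "0 \<le> b" "b \<le> s" for a b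
  proof -
    have "dist (x + a *\<^sub>R h + b *\<^sub>R k) x = norm (a *\<^sub>R h + b *\<^sub>R k)" by (simp add: dist_norm)
    also have "\<dots> \<le> a * norm h + b * norm k"
      using norm_triangle_ineq[of "a *\<^sub>R h" "b *\<^sub>R k"] that by simp
    also have "\<dots> \<le> s * norm h + s * norm k"
      using that by (intro add_mono mult_right_mono) auto
    also have "\<dots> < s * (2 * (norm h + norm k + 1))" using s by (simp add: algebra_simps) (smt (verit) norm_ge_zero mult_nonneg_nonneg)
    also have "\<dots> = \<delta>" using n by (simp add: s_def)
    finally show ?thesis .
  qed
  obtain a b where ab: "0 < a" "a < s" "0 < b" "b < s"
    "f (x + s *\<^sub>R h + s *\<^sub>R k) - f (x + s *\<^sub>R h) - f (x + s *\<^sub>R k) + f x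
       = s * s * D2 h (x + a *\<^sub>R h + b *\<^sub>R k) k"
    using second_difference_mvt[OF f D _ s, where x = x and h = h and k = k] near \<delta>(2) by metis
  have near': "dist (x + a *\<^sub>R k + b *\<^sub>R h) x < \<delta>" if "0 \<le> a" "a \<le> s" "0 \<le> b" "b \<le> s" for a b
    using near[of b a] that by (simp add: add.commute add.left_commute add.assoc)
  obtain a' b' where ab': "0 < a'" "a' < s" "0 < b'" "b' < s"
    "f (x + s *\<^sub>R k + s *\<^sub>R h) - f (x + s *\<^sub>R k) - f (x + s *\<^sub>R h) + f x
       = s * s * D2 k (x + a' *\<^sub>R k + b' *\<^sub>R h) h"
    using second_difference_mvt[OF f D _ s, where x = x and h = k and k = h] near' \<delta>(2) by metis
  have "s * s * D2 h (x + a *\<^sub>R h + b *\<^sub>R k) k = s * s * D2 k (x + a' *\<^sub>R k + b' *\<^sub>R h) h"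
    using ab(5) ab'(5) by (simp add: algebra_simps)
  then have "D2 h (x + a *\<^sub>R h + b *\<^sub>R k) k = D2 k (x + a' *\<^sub>R k + b' *\<^sub>R h) h" using s by simp
  moreover have "dist (D2 h (x + a *\<^sub>R h + b *\<^sub>R k) k) (D2 h x k) < e"
    using \<delta>(2)[OF near[of a b]] ab by auto
  moreover have "dist (D2 k (x + a' *\<^sub>R k + b' *\<^sub>R h) h) (D2 k x h) < e"
    using \<delta>(2)[OF near'[of a' b']] ab' by auto
  ultimately show False unfolding e_def dist_real_def by argo
qed

text \<open>
  The Poincare lemma.  The primitive integrates the form along the segment from a base point \<open>a\<close>.
  Closedness turns the derivative of the integrand in direction \<open>k\<close> into the derivative in \<open>t\<close> of
  \<open>t b (a + t (x - a)) k\<close>, so that the integral telescopes to \<open>b x k\<close>.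
\<close>

lemma closed_form_has_primitive:
  fixes b :: "'a::euclidean_space \<Rightarrow> 'a \<Rightarrow> 'c::euclidean_space"
  assumes S: "open S" "convex S"
    and lin: "\<And>x. x \<in> S \<Longrightarrow> linear (b x)"
    and der: "\<And>x h. x \<in> S \<Longrightarrow> ((\<lambda>y. b y h) has_derivative db x h) (at x)"
    and closed: "\<And>x h k. x \<in> S \<Longrightarrow> db x h k = db x k h"
    and cont: "\<And>h k. continuous_on S (\<lambda>x. db x h k)"
  shows "\<exists>G. \<forall>x\<in>S. (G has_derivative b x) (at x)"
proof (cases "S = {}")
  case False
  then obtain a where a: "a \<in> S" by blast
  have seg: "a + t *\<^sub>R (x - a) \<in> S" if "x \<in> S" "t \<in> {0..1}" for x t
    using convexD_alt[OF S(2) a that(1), of t] that(2) by (simp add: algebra_simps)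
  have dblin: "bounded_linear (db x h)" if "x \<in> S" for x h
    using der[OF that] by (rule has_derivative_bounded_linear)
  define F where "F x t = b (a + t *\<^sub>R (x - a)) (x - a)" for x and t :: real
  define F' where "F' x t k = t *\<^sub>R db (a + t *\<^sub>R (x - a)) k (x - a) + b (a + t *\<^sub>R (x - a)) k" for x t k
  have Fder: "((\<lambda>x. F x t) has_derivative F' x t) (at x)" if x: "x \<in> S" "t \<in> {0..1}" for x t
  proof -
    let ?y = "a + t *\<^sub>R (x - a)"
    have y: "?y \<in> S" using seg[OF x] .
    have expand: "b z v = (\<Sum>i\<in>Basis. (v \<bullet> i) *\<^sub>R b z i)" if "z \<in> S" for z v
    proof -
      interpret linear "b z" by (rule lin[OF that])
      show ?thesis by (subst euclidean_representation[of v, symmetric]) (simp add: sum scaleR)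
    qed
    have "((\<lambda>x. a + t *\<^sub>R (x - a)) has_derivative (\<lambda>k. t *\<^sub>R k)) (at x)"
      by (auto intro!: derivative_eq_intros)
    then have di: "((\<lambda>x. b (a + t *\<^sub>R (x - a)) i) has_derivative (\<lambda>k. db ?y i (t *\<^sub>R k))) (at x)" for i
      by (rule has_derivative_compose) (rule der[OF y])
    have "((\<lambda>x. \<Sum>i\<in>Basis. ((x - a) \<bullet> i) *\<^sub>R b (a + t *\<^sub>R (x - a)) i) has_derivative
        (\<lambda>k. \<Sum>i\<in>Basis. ((x - a) \<bullet> i) *\<^sub>R db ?y i (t *\<^sub>R k) + (k \<bullet> i) *\<^sub>R b ?y i)) (at x)"
      by (intro has_derivative_sum has_derivative_scaleR di) (auto intro!: derivative_eq_intros)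
    moreover have eq: "(\<Sum>i\<in>Basis. ((x - a) \<bullet> i) *\<^sub>R db ?y i (t *\<^sub>R k) + (k \<bullet> i) *\<^sub>R b ?y i) = F' x t k" for k
    proof -
      interpret bounded_linear "db ?y (t *\<^sub>R k)" by (rule dblin[OF y])
      \<comment> \<open>closedness exchanges the two arguments of \<open>db\<close>, and \<open>db\<close> is linear in the second one\<close>
      have "(\<Sum>i\<in>Basis. ((x - a) \<bullet> i) *\<^sub>R db ?y i (t *\<^sub>R k)) = db ?y (t *\<^sub>R k) (x - a)"
        by (subst (2) euclidean_representation[of "x - a", symmetric]) (simp add: sum scaleR closed[OF y])
      also have "\<dots> = t *\<^sub>R db ?y k (x - a)"
        using linear_scale[OF bounded_linear.linear[OF dblin[OF y, of "x - a"]], of t k] closed[OF y] by simp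
      finally show ?thesis unfolding F'_def sum.distrib using expand[OF y, of k] by simp
    qed
    ultimately have 1: "((\<lambda>x. \<Sum>i\<in>Basis. ((x - a) \<bullet> i) *\<^sub>R b (a + t *\<^sub>R (x - a)) i) has_derivative F' x t) (at x)"
      by (simp only: eq)
    show ?thesis
      by (rule has_derivative_transform_within_open[OF 1 S(1) x(1)])
        (use expand seg x(2) in \<open>simp add: F_def\<close>)
  qed
  have bcont: "continuous_on S (\<lambda>x. b x h)" for h
    by (rule differentiable_imp_continuous_on)
      (auto simp: differentiable_on_def differentiable_def intro: der has_derivative_at_withinI)
  have segcont: "continuous_on (S \<times> {0..1}) (\<lambda>(x, t). a + t *\<^sub>R (x - a))"
    by (auto simp: split_beta intro!: continuous_intros)
  have F'cont: "continuous_on (S \<times> {0..1}) (\<lambda>(x, t). F' x t k)" for k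
  proof -
    have e: "db y k v = (\<Sum>i\<in>Basis. (v \<bullet> i) *\<^sub>R db y k i)" if "y \<in> S" for y v
    proof -
      interpret bounded_linear "db y k" by (rule dblin[OF that])
      show ?thesis by (subst euclidean_representation[of v, symmetric]) (simp add: sum scaleR)
    qed
    have sub: "(\<lambda>p. a + snd p *\<^sub>R (fst p - a)) ` (S \<times> {0..1}) \<subseteq> S" using seg by auto
    have c: "continuous_on (S \<times> {0..1}) (\<lambda>p. db (a + snd p *\<^sub>R (fst p - a)) k i)"
      "continuous_on (S \<times> {0..1}) (\<lambda>p. b (a + snd p *\<^sub>R (fst p - a)) k)" for i
      using continuous_on_compose2[OF cont[of k i] segcont]
        continuous_on_compose2[OF bcont[of k] segcont] sub by (auto simp: split_beta)
    have "continuous_on (S \<times> {0..1}) (\<lambda>p. snd p *\<^sub>R (\<Sum>i\<in>Basis. ((fst p - a) \<bullet> i) *\<^sub>R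
        db (a + snd p *\<^sub>R (fst p - a)) k i) + b (a + snd p *\<^sub>R (fst p - a)) k)"
      by (intro continuous_intros c)
    then show ?thesis
    proof (rule continuous_on_eq)
      fix p assume "p \<in> S \<times> {0..1::real}"
      then have "a + snd p *\<^sub>R (fst p - a) \<in> S" using seg by auto
      from e[OF this, of "fst p - a"]
      show "snd p *\<^sub>R (\<Sum>i\<in>Basis. ((fst p - a) \<bullet> i) *\<^sub>R
        db (a + snd p *\<^sub>R (fst p - a)) k i) + b (a + snd p *\<^sub>R (fst p - a)) k = (case p of (x, t) \<Rightarrow> F' x t k)"
        by (simp add: split_beta F'_def)
    qed
  qed
  have "((\<lambda>x. integral {0..1} (F x)) has_derivative b x) (at x)" if x: "x \<in> S" for x
  proof -
    define fx where "fx x t = Blinfun (F' x t)" for x t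
    have fx: "blinfun_apply (fx x t) = F' x t" if "x \<in> S" "t \<in> {0..1}" for x t
      unfolding fx_def
      by (rule bounded_linear_Blinfun_apply[OF has_derivative_bounded_linear[OF Fder[OF that]]])
    have fxc: "continuous_on (S \<times> {0..1}) (\<lambda>(x, t). fx x t)"
    proof (rule continuous_on_blinfun_componentwise)
      fix i :: 'a
      show "continuous_on (S \<times> {0..1}) (\<lambda>p. blinfun_apply (case p of (x, t) \<Rightarrow> fx x t) i)"
        by (rule continuous_on_eq[OF F'cont[of i]]) (auto simp: fx)
    qed
    have Fint: "F y integrable_on {0..1}" if "y \<in> S" for y
    proof (rule integrable_continuous_interval)
      have "continuous_on {0..1} (\<lambda>t. b (a + t *\<^sub>R (y - a)) (y - a))"
        by (rule continuous_on_compose2[OF bcont[of "y - a"]])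
          (use seg[OF that] in \<open>auto intro!: continuous_intros\<close>)
      then show "continuous_on {0..1} (F y)" by (simp add: F_def[abs_def])
    qed
    have "((\<lambda>x. integral (cbox 0 1) (F x)) has_derivative integral (cbox 0 1) (fx x)) (at x within S)"
    proof (rule leibniz_rule)
      show "((\<lambda>x. F x t) has_derivative blinfun_apply (fx y t)) (at y within S)"
        if "y \<in> S" "t \<in> cbox 0 1" for y t
        using Fder[of y t] fx[of y t] that by (simp add: has_derivative_at_withinI)
    qed (use Fint fxc x S in auto)
    moreover have eq: "blinfun_apply (integral (cbox 0 1) (fx x)) = b x"
    proof (rule ext)
      fix k
      have c: "continuous_on {0..1} (fx x)"
        using continuous_on_compose2[OF fxc continuous_on_Pair[OF continuous_on_const continuous_on_id],
            of x "{0..1}"] x by (simp add: image_subset_iff)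
      have "blinfun_apply (integral {0..1} (fx x)) k = integral {0..1} (\<lambda>t. blinfun_apply (fx x t) k)"
        using integral_linear[OF integrable_continuous_interval[OF c] blinfun.bounded_linear_left[of k]]
        by (simp add: o_def)
      also have "\<dots> = integral {0..1} (\<lambda>t. F' x t k)"
        by (rule integral_cong) (simp add: fx[OF x])
      also have "\<dots> = b x k"
      proof -
        have "((\<lambda>t. F' x t k) has_integral (1 *\<^sub>R b (a + 1 *\<^sub>R (x - a)) k - 0 *\<^sub>R b (a + 0 *\<^sub>R (x - a)) k)) {0..1}"
        proof (rule fundamental_theorem_of_calculus)
          fix t :: real assume t: "t \<in> {0..1}"
          let ?y = "a + t *\<^sub>R (x - a)"
          have y: "?y \<in> S" using seg[OF x t] .
          interpret bounded_linear "db ?y k" by (rule dblin[OF y])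
          have "((\<lambda>t. a + t *\<^sub>R (x - a)) has_derivative (\<lambda>s. s *\<^sub>R (x - a))) (at t)"
            by (auto intro!: derivative_eq_intros)
          from has_derivative_scaleR[OF has_derivative_ident has_derivative_compose[OF this der[OF y, of k]]]
          have "((\<lambda>t. t *\<^sub>R b (a + t *\<^sub>R (x - a)) k) has_derivative
              (\<lambda>s. t *\<^sub>R db ?y k (s *\<^sub>R (x - a)) + s *\<^sub>R b ?y k)) (at t)" .
          moreover have eq: "t *\<^sub>R db ?y k (s *\<^sub>R (x - a)) + s *\<^sub>R b ?y k = s *\<^sub>R F' x t k" for s
            unfolding F'_def scaleR scaleR_add_right by simp
          ultimately have "((\<lambda>t. t *\<^sub>R b (a + t *\<^sub>R (x - a)) k) has_vector_derivative F' x t k) (at t)"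
            unfolding has_vector_derivative_def by (simp only: eq)
          then show "((\<lambda>t. t *\<^sub>R b (a + t *\<^sub>R (x - a)) k) has_vector_derivative F' x t k) (at t within {0..1})"
            by (rule has_vector_derivative_at_within)
        qed simp
        then show ?thesis by (simp add: integral_unique)
      qed
      finally show "blinfun_apply (integral (cbox 0 1) (fx x)) k = b x k" by simp
    qed
    ultimately show ?thesis unfolding eq using at_within_open[OF x S(1)] by simp
  qed
  then show ?thesis by blast
qed simp

section \<open>The Poincare disc\<close>

text \<open>
  Stereographic projection from \<open>(0, 0, -1)\<close> identifies the hyperbolic plane with the unit disc.
  All formulas are polynomial in the coordinates of \<open>z\<close> and the weight \<open>w = 1 / (1 - |z|\<^sup>2)\<close>, and follow from the single
  relation \<open>w (1 - |z|\<^sup>2) = 1\<close>.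
\<close>

definition disc_weight :: "complex \<Rightarrow> real" where
  "disc_weight z = 1 / (1 - (Re z ^ 2 + Im z ^ 2))"

definition poincare :: "complex \<Rightarrow> real^3" where
  "poincare z = vector [2 * Re z * disc_weight z, 2 * Im z * disc_weight z, 2 * disc_weight z - 1]"

definition poincare_inv :: "real^3 \<Rightarrow> complex" where
  "poincare_inv p = Complex (p$1 / (1 + p$3)) (p$2 / (1 + p$3))"

text \<open>
  The holomorphic null curve of the Weierstrass representation: the sum of squares of its components,
  the third one counted negatively, vanishes, and up to the conformal factor \<open>p\<^sub>x - \<i> p\<^sub>y\<close> is its
  conjugate.
\<close>

definition null_vec :: "complex \<Rightarrow> complex^3" where
  "null_vec z = vector [(1 + z\<^sup>2) / 2, \<i> * (1 - z\<^sup>2) / 2, z]"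

definition conf_factor :: "complex \<Rightarrow> real" where
  "conf_factor z = 4 * (disc_weight z)\<^sup>2"

definition poincare_deriv :: "complex \<Rightarrow> complex \<Rightarrow> real^3" where
  "poincare_deriv z h = (\<chi> i. conf_factor z * Re (cnj (null_vec z $ i) * h))"

lemma has_derivative_vecI:
  fixes f :: "'a::real_normed_vector \<Rightarrow> real^'n"
  assumes "\<And>i. ((\<lambda>x. f x $ i) has_derivative (\<lambda>h. D h $ i)) (at x within S)"
  shows "(f has_derivative D) (at x within S)"
  unfolding has_derivative_componentwise_within[of f]
  using assms by (auto simp: Basis_vec_def inner_axis)

lemma disc_weight_pos:
  assumes "cmod z < 1"
  shows "disc_weight z > 0" and disc_weight_eq: "disc_weight z * (1 - (Re z ^ 2 + Im z ^ 2)) = 1"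
proof -
  have "1 - (Re z ^ 2 + Im z ^ 2) > 0"
    using assms by (simp add: cmod_def real_sqrt_lt_1_iff)
  then show "disc_weight z > 0" "disc_weight z * (1 - (Re z ^ 2 + Im z ^ 2)) = 1"
    by (simp_all add: disc_weight_def)
qed

lemma disc_weight_complex:
  assumes "cmod z < 1"
  shows "of_real (disc_weight z) * (1 - z * cnj z) = 1"
proof -
  have "z * cnj z = of_real (Re z ^ 2 + Im z ^ 2)" by (simp add: complex_eq_iff power2_eq_square)
  then have "of_real (disc_weight z) * (1 - z * cnj z) =
      complex_of_real (disc_weight z * (1 - (Re z ^ 2 + Im z ^ 2)))"
    by simp
  then show ?thesis using disc_weight_eq[OF assms] by simp
qed

lemma poincare_nth:
  "poincare z $ 1 = 2 * Re z * disc_weight z"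
  "poincare z $ 2 = 2 * Im z * disc_weight z"
  "poincare z $ 3 = 2 * disc_weight z - 1"
  by (simp_all add: poincare_def)

lemma null_vec_nth:
  "null_vec z $ 1 = (1 + z\<^sup>2) / 2" "null_vec z $ 2 = \<i> * (1 - z\<^sup>2) / 2" "null_vec z $ 3 = z"
  by (simp_all add: null_vec_def)

lemma Re_null_vec:
  "Re (null_vec z $ 1) = (1 + Re z ^ 2 - Im z ^ 2) / 2" "Im (null_vec z $ 1) = Re z * Im z"
  "Re (null_vec z $ 2) = Re z * Im z" "Im (null_vec z $ 2) = (1 - Re z ^ 2 + Im z ^ 2) / 2"
  "Re (null_vec z $ 3) = Re z" "Im (null_vec z $ 3) = Im z"
  by (simp_all add: null_vec_nth Re_power2 Im_power2 add_divide_distrib diff_divide_distrib)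

lemma poincare_deriv_nth:
  "poincare_deriv z h $ i = conf_factor z * (Re (null_vec z $ i) * Re h + Im (null_vec z $ i) * Im h)"
  by (simp add: poincare_deriv_def)

lemma poincare_in_H2:
  assumes "cmod z < 1"
  shows "poincare z \<in> H2"
proof -
  have "(2 * Re z * disc_weight z)^2 + (2 * Im z * disc_weight z)^2 = (2 * disc_weight z - 1)^2 - 1"
    using disc_weight_eq[OF assms] by algebra
  moreover have "Re z ^ 2 + Im z ^ 2 \<ge> 0" by simp
  then have "disc_weight z * (Re z ^ 2 + Im z ^ 2) \<ge> 0"
    using disc_weight_pos[OF assms] by simp
  then have "disc_weight z \<ge> 1" using disc_weight_eq[OF assms] by (simp add: algebra_simps)
  ultimately show ?thesis
    by (simp add: H2_def lprod_def poincare_nth power2_eq_square)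
qed

lemma poincare_inv_poincare:
  assumes "cmod z < 1"
  shows "poincare_inv (poincare z) = z"
  using disc_weight_pos[OF assms] by (simp add: poincare_inv_def poincare_nth complex_eq_iff)

lemma
  assumes "p \<in> H2"
  shows cmod_poincare_inv: "cmod (poincare_inv p) < 1"
    and poincare_poincare_inv: "poincare (poincare_inv p) = p"
proof -
  have p: "p$1 ^ 2 + p$2 ^ 2 = p$3 ^ 2 - 1" "p$3 > 0"
    using assms by (auto simp: H2_def lprod_def power2_eq_square)
  let ?r = "Re (poincare_inv p) ^ 2 + Im (poincare_inv p) ^ 2"
  have "?r = (p$1 ^ 2 + p$2 ^ 2) / (1 + p$3) ^ 2"
    by (simp add: poincare_inv_def power_divide add_divide_distrib)
  also have "\<dots> = (p$3 - 1) / (1 + p$3)"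
  proof -
    have "p$3 ^ 2 - 1 = (p$3 - 1) * (1 + p$3)" by (simp add: power2_eq_square algebra_simps)
    then show ?thesis unfolding p(1) by (simp add: power2_eq_square)
  qed
  finally have r: "1 - ?r = 2 / (1 + p$3)"
    using p(2) by (simp add: field_simps)
  then have "1 - ?r > 0" using p(2) by simp
  then show "cmod (poincare_inv p) < 1" by (simp add: cmod_def real_sqrt_lt_1_iff)
  have dw: "disc_weight (poincare_inv p) = (1 + p$3) / 2"
    unfolding disc_weight_def r by simp
  show "poincare (poincare_inv p) = p"
    unfolding vec_eq_iff forall_3 poincare_nth dw using p(2) by (simp add: poincare_inv_def field_simps)
qed

lemma conf_factor_pos: "cmod z < 1 \<Longrightarrow> conf_factor z > 0"
  using disc_weight_pos[of z] by (simp add: conf_factor_def)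

lemma has_derivative_disc_weight:
  assumes "cmod z < 1"
  shows "(disc_weight has_derivative
    (\<lambda>h. (disc_weight z)\<^sup>2 * (2 * Re z * Re h + 2 * Im z * Im h))) (at z)"
proof -
  have "1 - (Re z ^ 2 + Im z ^ 2) \<noteq> 0" using disc_weight_eq[OF assms] by auto
  moreover have "((\<lambda>z. 1 - (Re z ^ 2 + Im z ^ 2)) has_derivative
      (\<lambda>h. - (2 * Re z * Re h + 2 * Im z * Im h))) (at z)"
    by (auto intro!: derivative_eq_intros)
  ultimately have "((\<lambda>z. inverse (1 - (Re z ^ 2 + Im z ^ 2))) has_derivative
      (\<lambda>h. - (inverse (1 - (Re z ^ 2 + Im z ^ 2)) * - (2 * Re z * Re h + 2 * Im z * Im h) *
         inverse (1 - (Re z ^ 2 + Im z ^ 2))))) (at z)"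
    by (rule Deriv.has_derivative_inverse)
  then have "(disc_weight has_derivative
      (\<lambda>h. - (disc_weight z * - (2 * Re z * Re h + 2 * Im z * Im h) * disc_weight z))) (at z)"
    unfolding inverse_eq_divide disc_weight_def[symmetric] .
  then show ?thesis
    by (rule has_derivative_eq_rhs) (simp add: power2_eq_square algebra_simps)
qed

lemma has_derivative_poincare:
  assumes "cmod z < 1"
  shows "(poincare has_derivative poincare_deriv z) (at z)"
proof (rule has_derivative_vecI)
  note d = has_derivative_disc_weight[OF assms] and e = disc_weight_eq[OF assms]
  have 1: "((\<lambda>z. 2 * Re z * disc_weight z) has_derivative (\<lambda>h. poincare_deriv z h $ 1)) (at z)"
    by (rule has_derivative_eq_rhs, (rule derivative_intros d)+)
      (rule ext, unfold poincare_deriv_nth conf_factor_def Re_null_vec, use e in algebra)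
  have 2: "((\<lambda>z. 2 * Im z * disc_weight z) has_derivative (\<lambda>h. poincare_deriv z h $ 2)) (at z)"
    by (rule has_derivative_eq_rhs, (rule derivative_intros d)+)
      (rule ext, unfold poincare_deriv_nth conf_factor_def Re_null_vec, use e in algebra)
  have 3: "((\<lambda>z. 2 * disc_weight z - 1) has_derivative (\<lambda>h. poincare_deriv z h $ 3)) (at z)"
    by (rule has_derivative_eq_rhs, (rule derivative_intros d)+)
      (simp add: poincare_deriv_nth conf_factor_def Re_null_vec algebra_simps)
  have "\<forall>i. ((\<lambda>x. poincare x $ i) has_derivative (\<lambda>h. poincare_deriv z h $ i)) (at z)"
    unfolding forall_3 poincare_nth using 1 2 3 by blast
  then show "((\<lambda>x. poincare x $ i) has_derivative (\<lambda>h. poincare_deriv z h $ i)) (at z)" for i by blast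
qed

text \<open>
  The identities behind conformality of the chart, orthogonality of its derivative to the position
  vector, and the coordinates of a tangent vector, with \<open>z = x + \<i> y\<close>.
\<close>

lemma disc_metric_identity:
  fixes w :: real
  assumes "w * (1 - (x^2 + y^2)) = 1"
  shows "(4*w^2*((1 + x^2 - y^2) / 2*h + x*y*k)) * (4*w^2*((1 + x^2 - y^2) / 2*h' + x*y*k')) +
    (4*w^2*(x*y*h + (1 - x^2 + y^2) / 2*k)) * (4*w^2*(x*y*h' + (1 - x^2 + y^2) / 2*k'))
    - (4*w^2*(x*h+y*k)) * (4*w^2*(x*h'+y*k')) = 4*w^2*(h*h'+k*k')"
proof -
  have "4 * ((1 + x^2 - y^2) / 2*h + x*y*k) * ((1 + x^2 - y^2) / 2*h' + x*y*k') +
    4 * (x*y*h + (1 - x^2 + y^2) / 2*k) * (x*y*h' + (1 - x^2 + y^2) / 2*k') -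
    4 * (x*h+y*k)*(x*h'+y*k') = (1-(x^2+y^2))^2*(h*h'+k*k')"
    by (simp add: field_simps power2_eq_square)
  then show ?thesis using assms by algebra
qed

lemma disc_tangency_identity:
  fixes w :: real
  assumes "w * (1 - (x^2 + y^2)) = (1::real)" shows 
 "4 * w^2*((1 + x^2 - y^2) / 2*h + x*y*k) * (2*x*w) +
  4*w^2*(x*y*h + (1 - x^2 + y^2) / 2*k) * (2*y*w) - 4*w^2*(x*h+y*k) * (2*w-1) = 0"
proof -
  have "w*(((1 + x^2 - y^2) / 2*h + x*y*k) * (2*x) +
  (x*y*h + (1 - x^2 + y^2) / 2*k) * (2*y)) = w * (x*h+y*k) * (1 + (x^2+y^2))"
    by (simp add: field_simps power2_eq_square)
  then show ?thesis using assms by algebra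
qed
lemma disc_tangent_coordinates:
  fixes w :: real
  assumes w: "w * (1 - (x^2 + y^2)) = (1::real)" 
  and v: "v1 * (2 * x * w) + v2 * (2 * y * w) = v3 * (2 * w - 1)"
  and h: "h = v1 * ((1 + x^2 - y^2) / 2) + v2 * (x * y) - v3 * x"
  and k: "k = v1 * (x * y) + v2 * ((1 - x^2 + y^2) / 2) - v3 * y"
shows 
 "4 * w^2*((1 + x^2 - y^2) / 2*h + x*y*k) = v1" (is ?a)
 "4*w^2*(x*y*h + (1 - x^2 + y^2) / 2*k) = v2" (is ?b)
 "4*w^2*(x*h+y*k) = v3" (is ?c)
proof -
  have w0: "w \<noteq> 0" using w by auto
  have "w * (v3 * (1 + x^2 + y^2)) = w * (2 * x * v1 + 2 * y * v2)"
    using v w by algebra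
  then have v3: "v3 * (1 + x^2 + y^2) = 2 * x * v1 + 2 * y * v2" using w0 by simp
  have "4 * ((1 + x^2 - y^2) / 2*h + x*y*k) = v1 * ((1 + x^2 - y^2)^2 + 4 * (x*y)^2) + 4 * v2 * x * y - 2 * x * (v3 * (1 + x^2 + y^2))"
    unfolding h k by (simp add: field_simps power2_eq_square)
  also have "\<dots> = (1 - (x^2 + y^2))^2 * v1" unfolding v3 by algebra
  finally show ?a using w by algebra
  have "4 * (x*y*h + (1 - x^2 + y^2) / 2*k) = v2 * ((1 - x^2 + y^2)^2 + 4 * (x*y)^2) + 4 * v1 * x * y - 2 * y * (v3 * (1 + x^2 + y^2))"
    unfolding h k by (simp add: field_simps power2_eq_square)
  also have "\<dots> = (1 - (x^2 + y^2))^2 * v2" unfolding v3 by algebra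
  finally show ?b using w by algebra
  have "4 * (x * h + y * k) = (1 + x^2 + y^2) * (2 * x * v1 + 2 * y * v2) - 4 * (x^2 + y^2) * v3"
    unfolding h k by (simp add: field_simps power2_eq_square)
  also have "\<dots> = (1 - (x^2 + y^2))^2 * v3" unfolding v3[symmetric] by algebra
  finally show ?c using w by algebra
qed

lemma lprod_poincare_deriv:
  assumes "cmod z < 1"
  shows "lprod (poincare_deriv z h) (poincare_deriv z k) = conf_factor z * Re (h * cnj k)"
  unfolding lprod_def poincare_deriv_nth Re_null_vec conf_factor_def
  using disc_metric_identity[OF disc_weight_eq[OF assms]] by simp

lemma lprod_poincare_deriv_poincare:
  assumes "cmod z < 1"
  shows "lprod (poincare_deriv z h) (poincare z) = 0"
  unfolding lprod_def poincare_deriv_nth Re_null_vec conf_factor_def poincare_nth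
  by (rule disc_tangency_identity[OF disc_weight_eq[OF assms]])

lemma range_poincare_deriv:
  assumes "cmod z < 1"
  shows "range (poincare_deriv z) = H2_tangent (poincare z)"
proof (intro equalityI subsetI)
  fix v assume "v \<in> H2_tangent (poincare z)"
  then have v: "v$1 * (2 * Re z * disc_weight z) + v$2 * (2 * Im z * disc_weight z) =
      v$3 * (2 * disc_weight z - 1)"
    by (simp add: H2_tangent_def lprod_def poincare_nth)
  define h where "h = of_real (v$1) * null_vec z $ 1 + of_real (v$2) * null_vec z $ 2
    - of_real (v$3) * null_vec z $ 3"
  have h: "Re h = v$1 * ((1 + Re z ^ 2 - Im z ^ 2) / 2) + v$2 * (Re z * Im z) - v$3 * Re z"
    "Im h = v$1 * (Re z * Im z) + v$2 * ((1 - Re z ^ 2 + Im z ^ 2) / 2) - v$3 * Im z"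
    by (simp_all add: h_def Re_null_vec)
  have "\<forall>i. v $ i = poincare_deriv z h $ i"
    unfolding forall_3 poincare_deriv_nth Re_null_vec conf_factor_def
    using disc_tangent_coordinates[OF disc_weight_eq[OF assms] v h] by auto
  then show "v \<in> range (poincare_deriv z)" by (auto simp: vec_eq_iff)
qed (use lprod_poincare_deriv_poincare[OF assms] in \<open>auto simp: H2_tangent_def\<close>)

section \<open>Tangent spaces and differentials in a parametrization\<close>

lemma at_within_openin:
  assumes "openin (top_of_set M) W" "p \<in> W"
  shows "at p within W = at p within M"
proof -
  obtain T where T: "open T" "W = M \<inter> T" using assms(1) by (auto simp: openin_open)
  show ?thesis
    unfolding T(2) by (rule at_within_nhd[of p T]) (use T assms(2) in blast)+
qed

text \<open>
  The derivative within \<open>M\<close> need not be unique on the ambient space, but its values along maps into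
  \<open>M\<close> are.
\<close>

lemma surf_diff_chain:
  assumes f: "f differentiable (at (g z) within M)"
    and g: "(g has_derivative g') (at z)"
    and N: "open N" "z \<in> N" "g ` N \<subseteq> M"
  shows "((\<lambda>y. f (g y)) has_derivative (\<lambda>h. surf_diff M f (g z) (g' h))) (at z)"
proof -
  have "(f has_derivative surf_diff M f (g z)) (at (g z) within g ` N)"
    using f N(3) unfolding surf_diff_def frechet_derivative_works
    by (rule has_derivative_subset)
  from diff_chain_within[OF has_derivative_at_withinI[OF g, of N] this]
  show ?thesis unfolding at_within_open[OF N(2,1)] by (simp only: o_def)
qed

lemma tangent_space_param:
  assumes g: "(g has_derivative g') (at z)"
    and N: "open N" "z \<in> N" "g ` N \<subseteq> M"
  shows "g' h \<in> tangent_space M (g z)"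
proof -
  \<comment> \<open>a curve in \<open>M\<close> must be defined for all times, so it is kept constant where the parameter leaves \<open>N\<close>\<close>
  define \<gamma> where "\<gamma> t = (if z + t *\<^sub>R h \<in> N then g (z + t *\<^sub>R h) else g z)" for t :: real
  have c: "((\<lambda>t. z + t *\<^sub>R h) has_derivative (\<lambda>t. t *\<^sub>R h)) (at 0)"
    by (auto intro!: derivative_eq_intros)
  have "((\<lambda>t. g (z + t *\<^sub>R h)) has_derivative (\<lambda>t. g' (t *\<^sub>R h))) (at 0)"
    using has_derivative_compose[OF c, of g g'] g by simp
  moreover have "g' (t *\<^sub>R h) = t *\<^sub>R g' h" for t
    using linear_scale[OF has_derivative_linear[OF g]] .
  ultimately have d: "((\<lambda>t. g (z + t *\<^sub>R h)) has_vector_derivative g' h) (at 0)"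
    by (simp add: has_vector_derivative_def)
  have "open ((\<lambda>t. z + t *\<^sub>R h) -` N)"
    by (rule open_vimage[OF N(1)]) (intro continuous_intros)
  then have "(\<gamma> has_vector_derivative g' h) (at 0)"
    unfolding has_vector_derivative_def
    by (rule has_derivative_transform_within_open[OF d[unfolded has_vector_derivative_def]])
      (simp_all add: \<gamma>_def N)
  moreover have "\<gamma> 0 = g z" "\<forall>t. \<gamma> t \<in> M"
    using N by (auto simp: \<gamma>_def image_subset_iff)
  ultimately show ?thesis unfolding tangent_space_def by blast
qed

text \<open>
  A parametrization \<open>g\<close> of a relatively open piece of \<open>M\<close>, with a left inverse \<open>\<pi>\<close> that is only
  required to be differentiable within \<open>M\<close>.  This is enough to compute tangent spaces and differentials
  of maps on \<open>M\<close> in the parameter, and it covers both the disc chart of the hyperbolic plane and the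
  parametrization of a surface by its Gauss map.
\<close>

locale param_chart =
  fixes M :: "'m::euclidean_space set" and D :: "'a::euclidean_space set"
    and g :: "'a \<Rightarrow> 'm" and g' :: "'a \<Rightarrow> 'a \<Rightarrow> 'm" and \<pi> :: "'m \<Rightarrow> 'a"
  assumes open_D: "open D"
    and open_image: "openin (top_of_set M) (g ` D)"
    and deriv: "z \<in> D \<Longrightarrow> (g has_derivative g' z) (at z)"
    and left_inverse: "z \<in> D \<Longrightarrow> \<pi> (g z) = z"
    and inverse_diff: "z \<in> D \<Longrightarrow> \<pi> differentiable (at (g z) within M)"
begin

lemma image_subset: "g ` D \<subseteq> M"
  using open_image openin_imp_subset by blast

lemma differentiable_within:
  assumes z: "z \<in> D" and f: "(\<lambda>y. f (g y)) differentiable (at z)"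
  shows "f differentiable (at (g z) within M)"
proof -
  have eq: "at (g z) within g ` D = at (g z) within M"
    by (rule at_within_openin[OF open_image]) (use z in blast)
  obtain \<pi>' where pi: "(\<pi> has_derivative \<pi>') (at (g z) within g ` D)"
    using inverse_diff[OF z] unfolding eq differentiable_def by blast
  obtain F where "((\<lambda>y. f (g y)) has_derivative F) (at (\<pi> (g z)))"
    using f left_inverse[OF z] unfolding differentiable_def by auto
  from has_derivative_compose[OF pi this]
  have "(f has_derivative (\<lambda>x. F (\<pi>' x))) (at (g z) within g ` D)"
    by (rule has_derivative_transform[rotated 2]) (use z left_inverse in auto)
  then show ?thesis unfolding eq differentiable_def by blast
qed

lemma surf_diff_eq:
  assumes z: "z \<in> D" and F: "((\<lambda>y. f (g y)) has_derivative F) (at z)"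
  shows "surf_diff M f (g z) (g' z h) = F h"
proof -
  have "f differentiable (at (g z) within M)"
    by (rule differentiable_within[OF z differentiableI[OF F]])
  note chain = surf_diff_chain[OF this deriv[OF z] open_D z image_subset]
  from fun_cong[OF has_derivative_unique[OF F chain], of h] show ?thesis by simp
qed

lemma surf_diff_inverse:
  assumes z: "z \<in> D"
  shows "surf_diff M \<pi> (g z) (g' z h) = h"
proof -
  have "((\<lambda>y. \<pi> (g y)) has_derivative (\<lambda>h. h)) (at z)"
    by (rule has_derivative_transform_within_open[OF has_derivative_ident open_D z])
      (simp add: left_inverse)
  from surf_diff_eq[OF z this] show ?thesis .
qed

lemma tangent_space_eq:
  assumes z: "z \<in> D"
  shows "tangent_space M (g z) = range (g' z)"
proof (intro equalityI subsetI)
  fix v assume "v \<in> tangent_space M (g z)"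
  then obtain \<gamma> :: "real \<Rightarrow> 'm" where \<gamma>: "\<gamma> 0 = g z" "\<And>t. \<gamma> t \<in> M" "(\<gamma> has_vector_derivative v) (at 0)"
    unfolding tangent_space_def by blast
  obtain T where T: "open T" "g ` D = M \<inter> T" using open_image by (auto simp: openin_open)
  have "isCont \<gamma> 0" using \<gamma>(3) by (rule has_vector_derivative_continuous)
  moreover have "\<gamma> 0 \<in> T" using \<gamma>(1) T z by auto
  ultimately have "\<forall>\<^sub>F t in nhds 0. \<gamma> t \<in> T"
    using T(1) topological_tendstoD tendsto_at_iff_tendsto_nhds[of \<gamma> 0] unfolding isCont_def by blast
  then obtain N where N: "open N" "0 \<in> N" "\<And>t. t \<in> N \<Longrightarrow> \<gamma> t \<in> T"
    unfolding eventually_nhds by blast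
  have 1: "((\<lambda>t. \<pi> (\<gamma> t)) has_derivative (\<lambda>t. surf_diff M \<pi> (\<gamma> 0) (t *\<^sub>R v))) (at 0)"
    by (rule surf_diff_chain[OF _ \<gamma>(3)[unfolded has_vector_derivative_def] open_UNIV])
      (use \<gamma> inverse_diff[OF z] in auto)
  have 2: "(g has_derivative g' z) (at (\<pi> (\<gamma> 0)))"
    using deriv[OF z] \<gamma>(1) left_inverse[OF z] by simp
  have "(\<gamma> has_derivative (\<lambda>t. g' z (surf_diff M \<pi> (\<gamma> 0) (t *\<^sub>R v)))) (at 0)"
  proof (rule has_derivative_transform_within_open[OF has_derivative_compose[OF 1 2] N(1,2)])
    fix t assume "t \<in> N"
    then have "\<gamma> t \<in> g ` D" using N(3) \<gamma>(2) T(2) by auto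
    then show "g (\<pi> (\<gamma> t)) = \<gamma> t" using left_inverse by auto
  qed
  from fun_cong[OF has_derivative_unique[OF this \<gamma>(3)[unfolded has_vector_derivative_def]], of 1]
  have "v = g' z (surf_diff M \<pi> (\<gamma> 0) v)" by simp
  then show "v \<in> range (g' z)" by (rule range_eqI)
next
  fix v assume "v \<in> range (g' z)"
  then show "v \<in> tangent_space M (g z)"
    using tangent_space_param[OF deriv[OF z] open_D z image_subset] by blast
qed

lemma deriv_inj: "z \<in> D \<Longrightarrow> inj (g' z)"
  by (rule inj_on_inverseI[of _ "surf_diff M \<pi> (g z)"]) (rule surf_diff_inverse)

end

section \<open>Disc charts of the hyperbolic plane\<close>

definition disc_region :: "(real^3) set \<Rightarrow> complex set" where
  "disc_region W = {z. cmod z < 1 \<and> poincare z \<in> W}"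

lemma continuous_on_poincare: "continuous_on (ball 0 1) poincare"
  by (rule continuous_at_imp_continuous_on)
    (auto intro!: has_derivative_continuous[OF has_derivative_poincare])

lemma open_disc_region:
  assumes "openin (top_of_set H2) W"
  shows "open (disc_region W)"
proof -
  obtain T where T: "open T" "W = H2 \<inter> T" using assms by (auto simp: openin_open)
  have "disc_region W = ball 0 1 \<inter> poincare -` T"
    using poincare_in_H2 T(2) by (auto simp: disc_region_def)
  then show ?thesis
    using continuous_open_preimage[OF continuous_on_poincare open_ball T(1)] by simp
qed

lemma poincare_image_disc_region:
  assumes "W \<subseteq> H2"
  shows "poincare ` disc_region W = W"
proof (intro equalityI subsetI)
  fix p assume "p \<in> W"
  then have "p \<in> H2" using assms by blast
  then have "p = poincare (poincare_inv p)" "poincare_inv p \<in> disc_region W"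
    using \<open>p \<in> W\<close> by (simp_all add: disc_region_def cmod_poincare_inv poincare_poincare_inv)
  then show "p \<in> poincare ` disc_region W" by (rule image_eqI)
qed (auto simp: disc_region_def)

lemma poincare_inv_image:
  assumes "W \<subseteq> H2"
  shows "poincare_inv ` W = disc_region W"
proof -
  have "poincare_inv ` poincare ` disc_region W = disc_region W"
    unfolding image_image by (simp add: disc_region_def poincare_inv_poincare)
  then show ?thesis unfolding poincare_image_disc_region[OF assms] .
qed

text \<open>
  An open neighbourhood of the hyperbolic plane on which the inverse chart is smooth.  Functions on the
  hyperbolic plane can thus be pulled back through arbitrary local parametrizations by composing
  smooth maps of open sets.
\<close>

definition upper_region :: "(real^3) set" where
  "upper_region = {p. p $ 3 > 0}"

lemma open_upper_region: "open upper_region"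
  unfolding upper_region_def by (intro open_Collect_less continuous_intros)

lemma H2_subset_upper: "H2 \<subseteq> upper_region"
  by (auto simp: H2_def upper_region_def)

lemma Ck_on_Complex:
  fixes a b :: "'a::euclidean_space \<Rightarrow> real"
  assumes "open S" "Ck_on k S a" "Ck_on k S b"
  shows "Ck_on k S (\<lambda>x. Complex (a x) (b x))"
proof -
  have "Ck_on k S (\<lambda>x. a x *\<^sub>R (1::complex) + b x *\<^sub>R \<i>)"
    by (intro Ck_on_add Ck_on_bilinear[OF bounded_bilinear_scaleR] assms Ck_on_const)
  moreover have "a x *\<^sub>R (1::complex) + b x *\<^sub>R \<i> = Complex (a x) (b x)" for x
    by (simp add: complex_eq_iff)
  ultimately show ?thesis by simp
qed

lemma Ck_on_poincare_inv: "Ck_on k upper_region poincare_inv"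
proof -
  note o = open_upper_region
  have c: "Ck_on k upper_region (\<lambda>p::real^3. p $ i)" for i
    by (rule Ck_on_bounded_linear[OF bounded_linear_vec_nth o])
  have q: "Ck_on k upper_region (\<lambda>p::real^3. inverse (1 + p $ 3))"
    by (intro Ck_on_inverse[OF o] Ck_on_add[OF o] Ck_on_const c) (auto simp: upper_region_def)
  show ?thesis
    unfolding poincare_inv_def[abs_def] divide_inverse
    by (intro Ck_on_Complex[OF o] Ck_on_bilinear[OF bounded_bilinear_mult o] c q)
qed

lemma Ck_on_poincare: "Ck_on k (ball 0 1) poincare"
proof -
  note o = open_ball[of "0::complex" 1]
  have c: "Ck_on k (ball 0 1) Re" "Ck_on k (ball 0 1) Im"
    by (intro Ck_on_bounded_linear[OF bounded_linear_Re o] Ck_on_bounded_linear[OF bounded_linear_Im o])+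
  note mult = Ck_on_bilinear[OF bounded_bilinear_mult o]
  have "Ck_on k (ball 0 1) (\<lambda>z. inverse (1 + (- 1) * (Re z * Re z + Im z * Im z)))"
  proof (intro Ck_on_inverse[OF o] Ck_on_add[OF o] mult Ck_on_const c)
    fix z :: complex assume "z \<in> ball 0 1"
    then have "disc_weight z * (1 + (- 1) * (Re z * Re z + Im z * Im z)) = 1"
      using disc_weight_eq[of z] by (simp add: power2_eq_square algebra_simps)
    then show "1 + (- 1) * (Re z * Re z + Im z * Im z) \<noteq> 0" by auto
  qed
  then have q: "Ck_on k (ball 0 1) disc_weight"
    by (simp add: disc_weight_def[abs_def] power2_eq_square inverse_eq_divide algebra_simps)
  have 3: "Ck_on k (ball 0 1) (\<lambda>z. 2 * disc_weight z + (- 1))"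
    by (intro mult Ck_on_add[OF o] Ck_on_const c q)
  have "\<forall>i. Ck_on k (ball 0 1) (\<lambda>z. poincare z $ i)"
    unfolding forall_3 poincare_nth using 3 by (auto intro!: mult Ck_on_const c q)
  then show ?thesis by (intro Ck_on_vec[OF o]) auto
qed

interpretation poincare_chart: param_chart H2 "ball 0 1" poincare poincare_deriv poincare_inv
proof
  show "openin (top_of_set H2) (poincare ` ball 0 1)"
  proof -
    have "disc_region H2 = ball 0 1" using poincare_in_H2 by (auto simp: disc_region_def)
    then show ?thesis using poincare_image_disc_region[of H2] by simp
  qed
  show "poincare_inv differentiable (at (poincare z) within H2)" if "z \<in> ball 0 1" for z
  proof (rule differentiable_at_withinI)
    have "poincare z \<in> upper_region" using that poincare_in_H2 H2_subset_upper by auto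
    then show "poincare_inv differentiable (at (poincare z))"
      using Ck_on_poincare_inv[of 1] by simp
  qed
qed (auto simp: has_derivative_poincare poincare_inv_poincare)

text \<open>
  Local parametrizations are defined on \<^typ>\<open>real^2\<close>, the disc chart on \<^typ>\<open>complex\<close>.
\<close>

definition plane_complex :: "real^2 \<Rightarrow> complex" where
  "plane_complex x = Complex (x $ 1) (x $ 2)"

definition complex_plane :: "complex \<Rightarrow> real^2" where
  "complex_plane z = vector [Re z, Im z]"

lemma complex_plane_inverse [simp]:
  "complex_plane (plane_complex x) = x" "plane_complex (complex_plane z) = z"
  by (simp_all add: complex_plane_def plane_complex_def vec_eq_iff forall_2)

lemma bounded_linear_plane_complex: "bounded_linear plane_complex"
  by (rule linear_conv_bounded_linear[THEN iffD1])
    (simp add: linear_iff plane_complex_def complex_eq_iff)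

lemma bounded_linear_complex_plane: "bounded_linear complex_plane"
  by (rule linear_conv_bounded_linear[THEN iffD1])
    (simp add: linear_iff complex_plane_def vec_eq_iff forall_2)

lemma local_param_poincare:
  assumes W: "openin (top_of_set H2) W"
  shows "local_param W (plane_complex -` disc_region W) (\<lambda>x. poincare (plane_complex x))"
    and "(\<lambda>x. poincare (plane_complex x)) ` (plane_complex -` disc_region W) = W"
proof -
  let ?U = "plane_complex -` disc_region W" and ?\<phi> = "\<lambda>x. poincare (plane_complex x)"
  have WH: "W \<subseteq> H2" using W openin_imp_subset by blast
  have oU: "open ?U"
    by (intro open_vimage open_disc_region[OF W] linear_continuous_on bounded_linear_plane_complex)
  have sub: "plane_complex ` ?U \<subseteq> ball 0 1" by (auto simp: disc_region_def)
  have "plane_complex ` ?U = disc_region W"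
    by (rule surj_image_vimage_eq[OF surjI]) (rule complex_plane_inverse(2))
  then show im: "?\<phi> ` ?U = W"
    using poincare_image_disc_region[OF WH] image_image[of poincare plane_complex ?U] by simp
  have Ck: "Ck_on k ?U ?\<phi>" for k
    by (rule Ck_on_compose[OF oU sub Ck_on_poincare Ck_on_bounded_linear[OF bounded_linear_plane_complex oU]])
  have left: "complex_plane (poincare_inv (?\<phi> x)) = x" if "x \<in> ?U" for x
    using that by (simp add: disc_region_def poincare_inv_poincare)
  have "continuous_on upper_region poincare_inv"
    using Ck_on_poincare_inv[of 0] by simp
  then have "continuous_on W (\<lambda>p. complex_plane (poincare_inv p))"
    by (intro continuous_on_compose2[OF linear_continuous_on[OF bounded_linear_complex_plane, of UNIV]])
      (use WH H2_subset_upper in \<open>auto intro: continuous_on_subset\<close>)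
  then have "homeomorphism ?U (?\<phi> ` ?U) ?\<phi> (\<lambda>p. complex_plane (poincare_inv p))"
    unfolding im
  proof (intro homeomorphismI)
    show "(\<lambda>p. complex_plane (poincare_inv p)) ` W \<subseteq> ?U"
      using poincare_inv_image[OF WH] by auto
    show "?\<phi> (complex_plane (poincare_inv p)) = p" if "p \<in> W" for p
      using that WH poincare_poincare_inv by auto
  qed (use left im Ck_on_continuous[OF Ck] in auto)
  moreover have "inj (frechet_derivative ?\<phi> (at x))" if "x \<in> ?U" for x
  proof -
    let ?z = "plane_complex x"
    have z: "?z \<in> ball 0 1" using that by (auto simp: disc_region_def)
    have "(?\<phi> has_derivative (\<lambda>h. poincare_deriv ?z (plane_complex h))) (at x)"
      by (rule has_derivative_compose[OF bounded_linear_imp_has_derivative[OF bounded_linear_plane_complex]])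
        (use z has_derivative_poincare in auto)
    from frechet_derivative_at[OF this]
    have "frechet_derivative ?\<phi> (at x) = (\<lambda>h. poincare_deriv ?z (plane_complex h))" by simp
    then show ?thesis
      using inj_compose[OF poincare_chart.deriv_inj[OF z]
          inj_on_inverseI[of UNIV complex_plane plane_complex]] by (simp add: o_def)
  qed
  ultimately show "local_param W ?U ?\<phi>"
    unfolding local_param_def im using oU Ck by (auto simp: numeral_2_eq_2 simp del: Ck_on.simps)
qed

lemma is_surface_H2_open: "openin (top_of_set H2) W \<Longrightarrow> is_surface W"
  unfolding is_surface_def using local_param_poincare(1)[of W] local_param_poincare(2)[of W] by blast

lemma surf_Ck_imp_Ck_on_disc:
  assumes W: "openin (top_of_set H2) W" and f: "surf_Ck k W f"
  shows "Ck_on k (disc_region W) (\<lambda>z. f (poincare z))"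
proof -
  have "Ck_on k (plane_complex -` disc_region W) (f \<circ> (\<lambda>x. poincare (plane_complex x)))"
    using f local_param_poincare(1)[OF W] unfolding surf_Ck_def by blast
  from Ck_on_compose[OF open_disc_region[OF W] _ this
      Ck_on_bounded_linear[OF bounded_linear_complex_plane open_disc_region[OF W]]]
  show ?thesis by (simp add: image_subset_iff)
qed

text \<open>
  The disc chart alone decides the class of a function: any other parametrization \<open>\<phi>\<close> factors as
  the chart after \<open>poincare_inv \<circ> \<phi>\<close>, which is of class \<open>C\<^sup>2\<close>, but in general not better; hence
  \<open>k \<le> 2\<close>.
\<close>

lemma Ck_on_disc_imp_surf_Ck:
  assumes W: "openin (top_of_set H2) W" and k: "k \<le> 2"
    and f: "Ck_on k (disc_region W) (\<lambda>z. f (poincare z))"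
  shows "surf_Ck k W f"
  unfolding surf_Ck_def
proof (intro allI impI)
  fix U \<phi> assume "local_param W U \<phi>"
  then have U: "open U" and "openin (top_of_set W) (\<phi> ` U)" and "Ck_on 2 U \<phi>"
    unfolding local_param_def by auto
  then have sub: "\<phi> ` U \<subseteq> W" and \<phi>: "Ck_on k U \<phi>"
    using openin_imp_subset Ck_on_mono[OF _ k] by blast+
  have WH: "W \<subseteq> H2" using W openin_imp_subset by blast
  have "\<phi> ` U \<subseteq> upper_region" using sub WH H2_subset_upper by blast
  from Ck_on_compose[OF U this Ck_on_poincare_inv \<phi>]
  have "Ck_on k U (\<lambda>x. poincare_inv (\<phi> x))" .
  note \<pi>\<phi> = this
  have sub': "(\<lambda>x. poincare_inv (\<phi> x)) ` U \<subseteq> disc_region W"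
    using sub poincare_inv_image[OF WH] by auto
  have eq: "f (poincare (poincare_inv (\<phi> x))) = (f \<circ> \<phi>) x" if "x \<in> U" for x
  proof -
    have "\<phi> x \<in> H2" using that sub WH by blast
    then show ?thesis by (simp add: poincare_poincare_inv)
  qed
  show "Ck_on k U (f \<circ> \<phi>)"
    by (rule Ck_on_cong[OF U eq Ck_on_compose[OF U sub' f \<pi>\<phi>]])
qed

lemma openin_poincare_image:
  assumes "open V" "V \<subseteq> ball 0 1"
  shows "openin (top_of_set H2) (poincare ` V)"
proof -
  have "continuous_on H2 poincare_inv"
    using Ck_on_continuous[OF Ck_on_poincare_inv] H2_subset_upper by (rule continuous_on_subset)
  moreover have "poincare ` V = H2 \<inter> poincare_inv -` V"
  proof (intro equalityI subsetI)
    fix p assume "p \<in> H2 \<inter> poincare_inv -` V"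
    then show "p \<in> poincare ` V" using poincare_poincare_inv[of p] by (metis IntE imageI vimageE)
  next
    fix p assume "p \<in> poincare ` V"
    then obtain z where "z \<in> V" "p = poincare z" by blast
    moreover from this have "cmod z < 1" using assms(2) by auto
    ultimately show "p \<in> H2 \<inter> poincare_inv -` V"
      using poincare_in_H2 poincare_inv_poincare by auto
  qed
  ultimately show ?thesis
    using continuous_openin_preimage_gen[OF _ assms(1)] by simp
qed

lemma param_chart_H2:
  assumes W: "openin (top_of_set H2) W"
  shows "param_chart W (disc_region W) poincare poincare_deriv poincare_inv"
proof
  have WH: "W \<subseteq> H2" using W openin_imp_subset by blast
  show "open (disc_region W)" by (rule open_disc_region[OF W])
  show "openin (top_of_set W) (poincare ` disc_region W)"
    unfolding poincare_image_disc_region[OF WH] by simp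
  fix z assume "z \<in> disc_region W"
  then have z: "z \<in> ball 0 1" "poincare z \<in> W" by (auto simp: disc_region_def)
  show "(poincare has_derivative poincare_deriv z) (at z)" "poincare_inv (poincare z) = z"
    using z poincare_chart.deriv poincare_chart.left_inverse by auto
  show "poincare_inv differentiable at (poincare z) within W"
    using poincare_chart.inverse_diff[OF z(1)] at_within_openin[OF W z(2)] by simp
qed

section \<open>Traces and determinants in conformal frames\<close>

lemma linear_complex_expand:
  fixes f :: "complex \<Rightarrow> 'a::real_vector"
  assumes "linear f"
  shows "f h = Re h *\<^sub>R f 1 + Im h *\<^sub>R f \<i>"
proof -
  have "h = Re h *\<^sub>R 1 + Im h *\<^sub>R \<i>" by (simp add: complex_eq_iff)
  moreover have "f (Re h *\<^sub>R 1 + Im h *\<^sub>R \<i>) = Re h *\<^sub>R f 1 + Im h *\<^sub>R f \<i>"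
    by (simp only: linear_add[OF assms] linear_scale[OF assms])
  ultimately show ?thesis by simp
qed

lemma orthonormal_frame_2:
  "orthonormal_frame g T e \<longleftrightarrow> e 1 \<in> T \<and> e 2 \<in> T \<and>
    g (e 1) (e 1) = 1 \<and> g (e 2) (e 2) = 1 \<and> g (e 1) (e 2) = 0 \<and> g (e 2) (e 1) = 0"
  unfolding orthonormal_frame_def forall_2 by auto

lemma conformal_frame_exists:
  assumes g: "\<And>h k. g (L h) (L k) = c * Re (h * cnj k)" and c: "c > 0"
  obtains e where "orthonormal_frame g (range L) e"
proof
  let ?r = "complex_of_real (1 / sqrt c)"
  have "?r * cnj ?r = complex_of_real (1 / c)"
    using c by (simp flip: of_real_mult)
  then show "orthonormal_frame g (range L) (\<lambda>i. if i = 1 then L ?r else L (\<i> * ?r))"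
    unfolding orthonormal_frame_2 using c by (simp add: g flip: of_real_mult)
qed

text \<open>
  If \<open>L\<close> pulls \<open>g\<close> back to a multiple of the Euclidean form, an orthonormal frame corresponds to the
  rows of a multiple of an orthogonal matrix.  Its columns are then orthogonal too, and this makes
  traces and determinants independent of the frame.
\<close>

lemma conformal_frame_coordinates:
  assumes g: "\<And>h k. g (L h) (L k) = c * Re (h * cnj k)" and c: "c > 0"
    and e: "orthonormal_frame g (range L) e"
  obtains h k where "e 1 = L h" "e 2 = L k"
    "c * (Re h ^ 2 + Re k ^ 2) = 1" "c * (Im h ^ 2 + Im k ^ 2) = 1" "Re h * Im h + Re k * Im k = 0"
    "c * (Re h * Im k - Im h * Re k) ^ 2 * c = 1"
proof -
  obtain h k where hk: "e 1 = L h" "e 2 = L k"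
    using e unfolding orthonormal_frame_2 by auto
  have 1: "c * (Re h ^ 2 + Im h ^ 2) = 1" "c * (Re k ^ 2 + Im k ^ 2) = 1" "c * (Re h * Re k + Im h * Im k) = 0"
    using e unfolding orthonormal_frame_2 hk g by (simp_all add: power2_eq_square)
  have "c * (Re h * Im k - Im h * Re k) ^ 2 * c + (c * (Re h * Re k + Im h * Im k)) ^ 2 =
      (c * (Re h ^ 2 + Im h ^ 2)) * (c * (Re k ^ 2 + Im k ^ 2))"
    by (simp add: power2_eq_square algebra_simps)
  then have d: "c * (Re h * Im k - Im h * Re k) ^ 2 * c = 1"
    unfolding 1 by simp
  define \<Delta> where "\<Delta> = Re h * Im k - Im h * Re k"
  have dd: "c * \<Delta> ^ 2 * c = 1" using d by (simp add: \<Delta>_def)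
  \<comment> \<open>an orthogonal matrix is, up to scale and sign, its own cofactor matrix\<close>
  have cof: "Re h = c * \<Delta> * Im k" "Re k = - (c * \<Delta> * Im h)"
  proof -
    have "c * \<Delta> * Im k = Re h * (c * (Re k ^ 2 + Im k ^ 2)) - Re k * (c * (Re h * Re k + Im h * Im k))"
      "- (c * \<Delta> * Im h) = Re k * (c * (Re h ^ 2 + Im h ^ 2)) - Re h * (c * (Re h * Re k + Im h * Im k))"
      by (simp_all add: \<Delta>_def power2_eq_square algebra_simps)
    then show "Re h = c * \<Delta> * Im k" "Re k = - (c * \<Delta> * Im h)" unfolding 1 by simp_all
  qed
  have "Re h ^ 2 + Re k ^ 2 = (c * \<Delta> ^ 2 * c) * (Im h ^ 2 + Im k ^ 2)"
    unfolding cof by (simp add: power2_eq_square algebra_simps)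
  then have "Re h ^ 2 + Re k ^ 2 = Im h ^ 2 + Im k ^ 2" using dd by simp
  moreover have "c * (Re h ^ 2 + Re k ^ 2) + c * (Im h ^ 2 + Im k ^ 2) = 2"
    using 1(1,2) by (simp add: algebra_simps)
  ultimately have "c * (Re h ^ 2 + Re k ^ 2) = 1" "c * (Im h ^ 2 + Im k ^ 2) = 1" by simp_all
  moreover have "Re h * Im h + Re k * Im k = 0"
    unfolding cof by simp
  ultimately show thesis using that hk d by blast
qed

text \<open>
  Stated for an abstract \<open>L\<close>, so that it serves both for the hyperbolic metric and for the first
  fundamental form of an immersion.
\<close>

lemma metric_trace_conformal:
  assumes g: "\<And>h k. g (L h) (L k) = c * Re (h * cnj k)" and c: "c > 0"
    and b: "\<And>h. b (L h) (L h) = a11 * (Re h)\<^sup>2 + a12 * (Re h * Im h) + a22 * (Im h)\<^sup>2"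
  shows "metric_trace g (range L) b = (a11 + a22) / c"
proof -
  have *: "(\<Sum>i\<in>UNIV. b (e i) (e i)) = (a11 + a22) / c" if e: "orthonormal_frame g (range L) e" for e
  proof -
    obtain h k where hk: "e 1 = L h" "e 2 = L k" "c * (Re h ^ 2 + Re k ^ 2) = 1"
      "c * (Im h ^ 2 + Im k ^ 2) = 1" "Re h * Im h + Re k * Im k = 0"
      by (rule conformal_frame_coordinates[where g = g and L = L, OF g c e])
    have "c * (\<Sum>i\<in>UNIV. b (e i) (e i)) = a11 * (c * (Re h ^ 2 + Re k ^ 2)) +
        c * a12 * (Re h * Im h + Re k * Im k) + a22 * (c * (Im h ^ 2 + Im k ^ 2))"
      by (simp add: sum_2 hk(1,2) b algebra_simps)
    then show ?thesis unfolding hk(3-5) using c by (simp add: field_simps)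
  qed
  obtain e where e: "orthonormal_frame g (range L) e"
    by (rule conformal_frame_exists[where g = g and L = L, OF g c])
  show ?thesis
    unfolding metric_trace_def
    by (rule the_equality) (use * e in auto)
qed

lemma endo_det_conformal:
  assumes g: "\<And>h k. g (L h) (L k) = c * Re (h * cnj k)" and c: "c > 0"
    and A: "\<And>h. A (L h) = L (of_real (Re h) * a + of_real (Im h) * b)"
  shows "endo_det g (range L) A = Re a * Im b - Im a * Re b"
proof -
  have *: "det ((\<chi> i j. g (A (e j)) (e i)) :: real^2^2) = Re a * Im b - Im a * Re b"
    if e: "orthonormal_frame g (range L) e" for e
  proof -
    obtain h k where hk: "e 1 = L h" "e 2 = L k" "c * (Re h * Im k - Im h * Re k) ^ 2 * c = 1"
      by (rule conformal_frame_coordinates[where g = g and L = L, OF g c e])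
    have "det ((\<chi> i j. g (A (e j)) (e i)) :: real^2^2) =
       (c * (Re h * Im k - Im h * Re k) ^ 2 * c) * (Re a * Im b - Im a * Re b)"
      unfolding det_2 by (simp add: hk(1,2) A g) algebra
    then show ?thesis using hk(3) by simp
  qed
  obtain e where e: "orthonormal_frame g (range L) e"
    by (rule conformal_frame_exists[where g = g and L = L, OF g c])
  show ?thesis
    unfolding endo_det_def
    by (rule the_equality) (use * e in auto)
qed

section \<open>Gradient, Hessian and Laplacian in the disc\<close>

lemma linear_poincare_deriv: "linear (poincare_deriv z)"
  by (auto simp: linear_iff vec_eq_iff poincare_deriv_nth algebra_simps)

lemma lprod_bilinear:
  "lprod (x + y) z = lprod x z + lprod y z" "lprod z (x + y) = lprod z x + lprod z y"
  "lprod (a *\<^sub>R x) y = a * lprod x y" "lprod x (a *\<^sub>R y) = a * lprod x y"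
  "lprod (- x) y = - lprod x y" "lprod x (- y) = - lprod x y"
  "lprod 0 x = 0" "lprod x 0 = 0"
  by (simp_all add: lprod_def algebra_simps)

lemma lprod_diff: "lprod (x - y) z = lprod x z - lprod y z" "lprod z (x - y) = lprod z x - lprod z y"
  by (simp_all add: lprod_def algebra_simps)

lemma lprod_commute: "lprod x y = lprod y x"
  by (simp add: lprod_def mult.commute)

lemma bounded_bilinear_lprod: "bounded_bilinear lprod"
proof -
  have "bilinear lprod"
    by (auto simp: bilinear_def linear_iff lprod_bilinear)
  then show ?thesis by (simp add: bilinear_conv_bounded_bilinear)
qed

lemma H2_self: "p \<in> H2 \<Longrightarrow> lprod p p = -1"
  by (simp add: H2_def)

text \<open>
  The chart derivative is onto the tangent plane, where the Lorentz form is positive definite, so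
  testing against the chart derivative determines the gradient.
\<close>

lemma H2_grad_poincare:
  assumes z: "cmod z < 1" and F: "((\<lambda>y. u (poincare y)) has_derivative F) (at z)"
    and w: "lprod w (poincare z) = 0" "\<And>h. lprod w (poincare_deriv z h) = F h"
  shows "H2_grad u (poincare z) = w"
proof -
  have sd: "surf_diff H2 u (poincare z) (poincare_deriv z h) = F h" for h
    by (rule poincare_chart.surf_diff_eq[OF _ F]) (use z in simp)
  have tan: "\<exists>h. v = poincare_deriv z h" if "v \<in> H2_tangent (poincare z)" for v
    using that range_poincare_deriv[OF z] by blast
  show ?thesis
    unfolding H2_grad_def
  proof (rule the_equality)
    show "w \<in> H2_tangent (poincare z) \<and>
        (\<forall>v\<in>H2_tangent (poincare z). lprod w v = surf_diff H2 u (poincare z) v)"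
    proof (intro conjI ballI)
      show "w \<in> H2_tangent (poincare z)" using w(1) by (simp add: H2_tangent_def)
      fix v assume "v \<in> H2_tangent (poincare z)"
      from tan[OF this] show "lprod w v = surf_diff H2 u (poincare z) v" using w(2) sd by auto
    qed
    fix w' assume w': "w' \<in> H2_tangent (poincare z) \<and>
        (\<forall>v\<in>H2_tangent (poincare z). lprod w' v = surf_diff H2 u (poincare z) v)"
    then have "w' - w \<in> H2_tangent (poincare z)" using w by (simp add: H2_tangent_def lprod_def algebra_simps)
    then obtain h where h: "w' - w = poincare_deriv z h" using range_poincare_deriv[OF z] by blast
    have "lprod w' (poincare_deriv z h) = F h"
      using w' sd range_poincare_deriv[OF z] by (metis rangeI)
    then have "lprod (w' - w) (poincare_deriv z h) = 0"
      using w(2)[of h] by (simp add: lprod_def algebra_simps)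
    then have "conf_factor z * (Re h ^ 2 + Im h ^ 2) = 0"
      unfolding h lprod_poincare_deriv[OF z] by (simp add: power2_eq_square)
    then have "h = 0" using conf_factor_pos[OF z] by (simp add: complex_eq_iff sum_power2_eq_zero_iff)
    then show "w' = w" using h linear_0[OF linear_poincare_deriv[of z]] by simp
  qed
qed

text \<open>
  Differentiating \<open>\<langle>\<nabla>u, p\<rangle> = 0\<close> shows that the normal part of the ambient derivative of \<open>\<nabla>u = Y + u p\<close>
  along \<open>v\<close> is \<open>du(v) p\<close>; the tangential part is \<open>dY(v) + u v\<close>.  Thus \<open>dX\<^sub>u = Hess u - u Id\<close>.
\<close>

lemma X_of_hessian:
  assumes W: "open D" "D \<subseteq> ball 0 1" "z \<in> D"
    and U: "\<And>y. y \<in> D \<Longrightarrow> ((\<lambda>y. u (poincare y)) has_derivative F y) (at y)"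
    and Y: "\<And>y. y \<in> D \<Longrightarrow> X_of u (poincare y) = Y y"
    and tangent: "\<And>y. y \<in> D \<Longrightarrow> lprod (Y y) (poincare y) = u (poincare y)"
    and grad: "\<And>y h. y \<in> D \<Longrightarrow> lprod (Y y) (poincare_deriv y h) = F y h"
    and Y': "(Y has_derivative Y') (at z)"
  shows "lprod (Y' h) (poincare z) = 0"
    and "H2_hess u (poincare z) (poincare_deriv z h) = Y' h + u (poincare z) *\<^sub>R poincare_deriv z h"
proof -
  have z: "cmod z < 1" using W by auto
  note P' = has_derivative_poincare[OF z]
  have "((\<lambda>y. lprod (Y y) (poincare y)) has_derivative
      (\<lambda>h. lprod (Y z) (poincare_deriv z h) + lprod (Y' h) (poincare z))) (at z)"
    by (rule bounded_bilinear.FDERIV[OF bounded_bilinear_lprod Y' P'])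
  moreover have "((\<lambda>y. lprod (Y y) (poincare y)) has_derivative F z) (at z)"
    by (rule has_derivative_transform_within_open[OF U[OF W(3)] W(1,3)]) (simp add: tangent)
  ultimately have "(\<lambda>h. lprod (Y z) (poincare_deriv z h) + lprod (Y' h) (poincare z)) = F z"
    by (rule has_derivative_unique)
  from fun_cong[OF this, of h] show tan: "lprod (Y' h) (poincare z) = 0" using grad[OF W(3)] by simp
  have "((\<lambda>y. Y y + u (poincare y) *\<^sub>R poincare y) has_derivative
      (\<lambda>h. Y' h + (u (poincare z) *\<^sub>R poincare_deriv z h + F z h *\<^sub>R poincare z))) (at z)"
    by (intro has_derivative_add Y' has_derivative_scaleR U[OF W(3)] P')
  then have "((\<lambda>y. H2_grad u (poincare y)) has_derivative
      (\<lambda>h. Y' h + (u (poincare z) *\<^sub>R poincare_deriv z h + F z h *\<^sub>R poincare z))) (at z)"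
  proof (rule has_derivative_transform_within_open[OF _ W(1,3)])
    fix y assume "y \<in> D"
    from Y[OF this, symmetric] show "Y y + u (poincare y) *\<^sub>R poincare y = H2_grad u (poincare y)"
      by (simp add: X_of_def)
  qed
  from poincare_chart.surf_diff_eq[OF _ this, of h]
  have sd: "surf_diff H2 (H2_grad u) (poincare z) (poincare_deriv z h) =
     Y' h + (u (poincare z) *\<^sub>R poincare_deriv z h + F z h *\<^sub>R poincare z)" using z by simp
  show "H2_hess u (poincare z) (poincare_deriv z h) = Y' h + u (poincare z) *\<^sub>R poincare_deriv z h"
    unfolding H2_hess_def H2_cov_def sd lprod_bilinear tan lprod_poincare_deriv_poincare[OF z]
      H2_self[OF poincare_in_H2[OF z]]
    by simp
qed

lemma H2_laplacian_poincare:
  assumes z: "cmod z < 1"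
    and hess: "\<And>h. H2_hess u (poincare z) (poincare_deriv z h) = Y' h + u (poincare z) *\<^sub>R poincare_deriv z h"
    and Y': "linear Y'"
  shows "H2_laplacian u (poincare z) = (lprod (Y' 1) (poincare_deriv z 1) + lprod (Y' \<i>) (poincare_deriv z \<i>)) / conf_factor z
    + 2 * u (poincare z)"
proof -
  define c where "c = conf_factor z"
  have c: "c > 0" using conf_factor_pos[OF z] by (simp add: c_def)
  define L where "L = poincare_deriv z"
  have g: "lprod (L h) (L k) = c * Re (h * cnj k)" for h k
    unfolding L_def c_def by (rule lprod_poincare_deriv[OF z])
  have "metric_trace lprod (range L) (\<lambda>v w. lprod (H2_hess u (poincare z) v) w) =
     ((lprod (Y' 1) (L 1) + c * u (poincare z)) + (lprod (Y' \<i>) (L \<i>) + c * u (poincare z))) / c"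
  proof (rule metric_trace_conformal[where g = lprod and L = L, OF g c])
    fix h
    have "lprod (Y' h) (L h) = Re h ^ 2 * lprod (Y' 1) (L 1) +
        Re h * Im h * (lprod (Y' 1) (L \<i>) + lprod (Y' \<i>) (L 1)) + Im h ^ 2 * lprod (Y' \<i>) (L \<i>)"
      by (subst linear_complex_expand[OF Y'], subst linear_complex_expand[of L h])
        (simp_all add: L_def linear_poincare_deriv lprod_bilinear algebra_simps power2_eq_square)
    moreover have "lprod (L h) (L h) = c * (Re h ^ 2 + Im h ^ 2)"
      unfolding g by (simp add: power2_eq_square)
    ultimately show "lprod (H2_hess u (poincare z) (L h)) (L h) =
      (lprod (Y' 1) (L 1) + c * u (poincare z)) * (Re h)\<^sup>2 +
      (lprod (Y' 1) (L \<i>) + lprod (Y' \<i>) (L 1)) * (Re h * Im h) +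
      (lprod (Y' \<i>) (L \<i>) + c * u (poincare z)) * (Im h)\<^sup>2"
      using hess[of h] unfolding L_def[symmetric] by (simp add: lprod_bilinear algebra_simps)
  qed
  then show ?thesis
    unfolding H2_laplacian_def L_def[symmetric] range_poincare_deriv[OF z, symmetric, folded L_def] c_def[symmetric]
    using c by (simp add: field_simps)
qed

section \<open>The Hopf differential\<close>

text \<open>
  Here \<open>P = U\<^sub>x - \<i> U\<^sub>y\<close> is twice the Wirtinger derivative of \<open>U\<close>.  Its antiholomorphic derivative \<open>m\<close>
  is half the Laplacian of \<open>U\<close>; that it is real expresses the symmetry of second derivatives.
\<close>

lemma Ck2_wirtinger_derivatives:
  fixes U :: "complex \<Rightarrow> real"
  assumes D: "open D" and U: "Ck_on 2 D U"
  obtains P Q m where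
    "\<And>z. z \<in> D \<Longrightarrow> (U has_derivative (\<lambda>h. Re (P z * h))) (at z)"
    "\<And>z. z \<in> D \<Longrightarrow> (P has_derivative (\<lambda>h. Q z * h + of_real (m z) * cnj h)) (at z)"
    "continuous_on D Q"
proof -
  define dU where "dU z = frechet_derivative U (at z)" for z
  define d2 where "d2 v z = frechet_derivative (\<lambda>z. dU z v) (at z)" for v z
  have U2: "Ck_on (Suc (Suc 0)) D U" using U by (simp add: numeral_2_eq_2)
  have dU: "(U has_derivative dU z) (at z)" if "z \<in> D" for z
    unfolding dU_def by (rule Ck_on_SucD[OF U2 that])
  have U1: "Ck_on (Suc 0) D (\<lambda>z. dU z v)" for v
    unfolding dU_def by (rule Ck_on_SucD'[OF U2])
  have d2: "((\<lambda>z. dU z v) has_derivative d2 v z) (at z)" if "z \<in> D" for z v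
    unfolding d2_def by (rule Ck_on_SucD[OF U1 that])
  have cont: "continuous_on D (\<lambda>z. d2 v z w)" for v w
    using Ck_on_SucD'[OF U1, of v w] by (simp add: d2_def)
  have sym: "d2 v z w = d2 w z v" if "z \<in> D" for v w z
    by (rule second_derivative_symmetric[OF D that dU d2 cont])
  define P where "P z = Complex (dU z 1) (- dU z \<i>)" for z
  define Q where "Q z = Complex ((d2 1 z 1 - d2 \<i> z \<i>) / 2) (- d2 1 z \<i>)" for z
  define m where "m z = (d2 1 z 1 + d2 \<i> z \<i>) / 2" for z
  show thesis
  proof
    fix z assume z: "z \<in> D"
    have "dU z h = Re (P z * h)" for h
      using linear_complex_expand[OF has_derivative_linear[OF dU[OF z]], of h]
      by (simp add: P_def algebra_simps)
    then have "dU z = (\<lambda>h. Re (P z * h))" by (rule ext)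
    then show "(U has_derivative (\<lambda>h. Re (P z * h))) (at z)" using dU[OF z] by simp
    have "((\<lambda>z. dU z 1 *\<^sub>R 1 + (- dU z \<i>) *\<^sub>R \<i>) has_derivative
        (\<lambda>h. d2 1 z h *\<^sub>R 1 + (- d2 \<i> z h) *\<^sub>R \<i>)) (at z)"
      by (intro has_derivative_add has_derivative_scaleR_left has_derivative_minus d2 z)
    moreover have "d2 1 z h *\<^sub>R 1 + (- d2 \<i> z h) *\<^sub>R \<i> = Q z * h + of_real (m z) * cnj h" for h
      using linear_complex_expand[OF has_derivative_linear[OF d2[OF z, of 1]], of h]
        linear_complex_expand[OF has_derivative_linear[OF d2[OF z, of \<i>]], of h] sym[OF z, of \<i> 1]
      by (simp add: Q_def m_def complex_eq_iff field_simps)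
    moreover have "(\<lambda>z. dU z 1 *\<^sub>R 1 + (- dU z \<i>) *\<^sub>R \<i>) = P"
      by (simp add: P_def complex_eq_iff fun_eq_iff)
    ultimately show "(P has_derivative (\<lambda>h. Q z * h + of_real (m z) * cnj h)) (at z)" by simp
  next
    have "Q = (\<lambda>z. of_real ((d2 1 z 1 - d2 \<i> z \<i>) / 2) + of_real (- d2 1 z \<i>) * \<i>)"
      by (simp add: Q_def complex_eq_iff fun_eq_iff)
    moreover have "continuous_on D \<dots>"
      by (intro continuous_intros cont) simp
    ultimately show "continuous_on D Q" by simp
  qed
qed

text \<open>
  Up to a constant factor, the \<open>(2,0)\<close>-part of the hyperbolic Hessian: the second Wirtinger derivative corrected by the
  Christoffel symbol \<open>2 cnj z / (1 - |z|\<^sup>2)\<close> of the conformal metric.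
\<close>

definition hopf :: "(complex \<Rightarrow> complex) \<Rightarrow> (complex \<Rightarrow> complex) \<Rightarrow> complex \<Rightarrow> complex" where
  "hopf P Q z = Q z - 2 * cnj z * of_real (disc_weight z) * P z"

text \<open>
  The map \<open>- u p + \<nabla>u\<close> in the disc; the gradient has components \<open>Re (P s\<^sub>j)\<close> with \<open>s\<close> the null curve.
\<close>

definition X_disc :: "(complex \<Rightarrow> real) \<Rightarrow> (complex \<Rightarrow> complex) \<Rightarrow> complex \<Rightarrow> real^3" where
  "X_disc U P z = (\<chi> j. - (U z * poincare z $ j) + Re (P z * null_vec z $ j))"

lemma X_disc_eq:
  assumes z: "cmod z < 1"
  shows "X_disc U P z = - U z *\<^sub>R poincare z + poincare_deriv z (cnj (P z) / conf_factor z)"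
  using conf_factor_pos[OF z]
  by (simp add: X_disc_def vec_eq_iff poincare_deriv_nth field_simps)

lemma X_of_poincare:
  assumes z: "cmod z < 1" and U: "((\<lambda>z. u (poincare z)) has_derivative (\<lambda>h. Re (P z * h))) (at z)"
  shows "X_of u (poincare z) = X_disc (\<lambda>z. u (poincare z)) P z"
    and "lprod (X_of u (poincare z)) (poincare z) = u (poincare z)"
    and "lprod (X_of u (poincare z)) (poincare_deriv z h) = Re (P z * h)"
proof -
  let ?w = "poincare_deriv z (cnj (P z) / conf_factor z)"
  have *: "lprod ?w (poincare_deriv z h) = Re (P z * h)" for h
    unfolding lprod_poincare_deriv[OF z] using conf_factor_pos[OF z]
    by (simp add: field_simps)
  have grad: "H2_grad u (poincare z) = ?w"
    by (rule H2_grad_poincare[OF z U]) (simp_all add: lprod_poincare_deriv_poincare[OF z] *)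
  then show 1: "X_of u (poincare z) = X_disc (\<lambda>z. u (poincare z)) P z"
    by (simp add: X_of_def X_disc_eq[OF z])
  show "lprod (X_of u (poincare z)) (poincare z) = u (poincare z)"
    unfolding X_of_def grad lprod_bilinear lprod_poincare_deriv_poincare[OF z] H2_self[OF poincare_in_H2[OF z]]
    by simp
  show "lprod (X_of u (poincare z)) (poincare_deriv z h) = Re (P z * h)"
    unfolding X_of_def grad lprod_bilinear * using lprod_poincare_deriv_poincare[OF z, of h]
    by (simp add: lprod_commute)
qed

text \<open>
  The derivative of the null curve and the position vector differ by a multiple of the null curve.
  This is why differentiating \<open>- U p + Re (P s)\<close> leaves only multiples of \<open>s\<close>.
\<close>

lemma null_vec_deriv:
  assumes z: "cmod z < 1"
  shows "\<exists>n'. \<forall>j. ((\<lambda>z. null_vec z $ j) has_field_derivative n' j) (at z) \<and>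
    n' j - of_real (poincare z $ j) = - (2 * cnj z * of_real (disc_weight z) * null_vec z $ j)"
proof -
  define n' :: "3 \<Rightarrow> complex" where "n' j = (vector [z, - \<i> * z, 1] :: complex^3) $ j" for j
  define w where "w = complex_of_real (disc_weight z)"
  have w: "w * (1 - z * cnj z) = 1" unfolding w_def by (rule disc_weight_complex[OF z])
  have p: "of_real (poincare z $ 1) = (z + cnj z) * w" "of_real (poincare z $ 2) = - (\<i> * (z - cnj z)) * w"
    "of_real (poincare z $ 3) = 2 * w - 1"
    by (simp_all add: poincare_nth w_def complex_eq_iff)
  have "\<forall>j. ((\<lambda>z. null_vec z $ j) has_field_derivative n' j) (at z)"
    unfolding forall_3 null_vec_nth
    by (auto simp: n'_def intro!: derivative_eq_intros)
  moreover have "z - (z + cnj z) * w = - (2 * cnj z * w * ((1 + z\<^sup>2) / 2))"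
    "- \<i> * z - (- (\<i> * (z - cnj z)) * w) = - (2 * cnj z * w * (\<i> * (1 - z\<^sup>2) / 2))"
    "1 - (2 * w - 1) = - (2 * cnj z * w * z)"
    using w by algebra+
  then have "\<forall>j. n' j - of_real (poincare z $ j) = - (2 * cnj z * of_real (disc_weight z) * null_vec z $ j)"
    unfolding forall_3 p null_vec_nth w_def[symmetric] by (simp add: n'_def)
  ultimately show ?thesis by blast
qed

text \<open>
  The two coefficients are the trace-free part of \<open>Hess u - u Id\<close>, which is antilinear in \<open>h\<close>, and half
  its trace, which is linear in \<open>h\<close>.  The second vanishes precisely when \<open>\<Delta>u = 2u\<close>.
\<close>

lemma has_derivative_X_disc:
  assumes z: "cmod z < 1"
    and U: "(U has_derivative (\<lambda>h. Re (P z * h))) (at z)"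
    and P: "(P has_derivative (\<lambda>h. Q z * h + of_real m * cnj h)) (at z)"
  shows "(X_disc U P has_derivative (\<lambda>h. poincare_deriv z
    (cnj (hopf P Q z * h + of_real (m - conf_factor z * U z) * cnj h) / conf_factor z))) (at z)"
proof (rule has_derivative_vecI)
  fix j
  obtain n' where n': "\<And>j. ((\<lambda>z. null_vec z $ j) has_field_derivative n' j) (at z)"
    and n: "\<And>j. n' j - of_real (poincare z $ j) = - (2 * cnj z * of_real (disc_weight z) * null_vec z $ j)"
    using null_vec_deriv[OF z] by blast
  have p: "((\<lambda>z. poincare z $ j) has_derivative (\<lambda>h. poincare_deriv z h $ j)) (at z)"
    by (rule bounded_linear.has_derivative[OF bounded_linear_vec_nth has_derivative_poincare[OF z]])
  have "((\<lambda>z. - (U z * poincare z $ j) + Re (P z * null_vec z $ j)) has_derivative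
    (\<lambda>h. - (U z * poincare_deriv z h $ j + Re (P z * h) * poincare z $ j) +
       Re (P z * (n' j * h) + (Q z * h + of_real m * cnj h) * null_vec z $ j))) (at z)"
    by (intro has_derivative_add has_derivative_minus has_derivative_mult has_derivative_Re U P p
        n'[unfolded has_field_derivative_def])
  moreover have "- (U z * poincare_deriv z h $ j + Re (P z * h) * poincare z $ j) +
       Re (P z * (n' j * h) + (Q z * h + of_real m * cnj h) * null_vec z $ j) =
     poincare_deriv z (cnj (hopf P Q z * h + of_real (m - conf_factor z * U z) * cnj h) / conf_factor z) $ j" for h
  proof -
    define c where "c = conf_factor z"
    have c: "c > 0" using conf_factor_pos[OF z] by (simp add: c_def)
    have "poincare_deriv z (cnj (hopf P Q z * h + of_real (m - c * U z) * cnj h) / c) $ j =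
       Re (null_vec z $ j * (hopf P Q z * h + of_real (m - c * U z) * cnj h))"
      unfolding poincare_deriv_def c_def[symmetric] using c by (simp add: field_simps)
    also have "\<dots> = Re (null_vec z $ j * Q z * h + P z * (n' j - of_real (poincare z $ j)) * h
        + of_real (m - c * U z) * (cnj h * null_vec z $ j))"
      unfolding hopf_def n by (simp add: algebra_simps)
    also have "\<dots> = - (U z * poincare_deriv z h $ j + Re (P z * h) * poincare z $ j) +
       Re (P z * (n' j * h) + (Q z * h + of_real m * cnj h) * null_vec z $ j)"
      unfolding poincare_deriv_def c_def[symmetric] by (simp add: algebra_simps)
    finally show ?thesis by (simp add: c_def)
  qed
  ultimately show "((\<lambda>x. X_disc U P x $ j) has_derivative (\<lambda>h. poincare_deriv z
    (cnj (hopf P Q z * h + of_real (m - conf_factor z * U z) * cnj h) / conf_factor z) $ j)) (at z)"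
    by (simp add: X_disc_def)
qed

text \<open>
  \<open>Q\<close>, and with it the Hopf coefficient \<open>q\<close>, is merely continuous, so the Cauchy-Riemann equations for
  \<open>q\<close> cannot be checked directly.  Instead \<open>dP = q dz + b\<close>, where \<open>b\<close> is a one-form with coefficients
  of class \<open>C\<^sup>1\<close>.  It is closed, since the mixed terms in its derivative have the common coefficient
  \<open>E\<close>.  Subtracting a primitive of \<open>b\<close> from \<open>P\<close> leaves a complex differentiable function with
  derivative \<open>q\<close>.
\<close>

lemma hopf_holomorphic:
  assumes D: "open D" "D \<subseteq> ball 0 1"
    and U: "\<And>z. z \<in> D \<Longrightarrow> (U has_derivative (\<lambda>h. Re (P z * h))) (at z)"
    and P: "\<And>z. z \<in> D \<Longrightarrow> (P has_derivative (\<lambda>h. Q z * h + of_real (conf_factor z * U z) * cnj h)) (at z)"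
    and Q: "continuous_on D Q"
  shows "hopf P Q holomorphic_on D"
proof -
  define w where "w z = complex_of_real (disc_weight z)" for z
  define b where "b z h = 2 * cnj z * w z * P z * h + 4 * (w z)\<^sup>2 * of_real (U z) * cnj h" for z h
  define A where "A z = 2 * ((cnj z * w z)\<^sup>2 * P z + cnj z * w z * Q z)" for z
  define E where "E z = 2 * (w z)\<^sup>2 * P z + 8 * cnj z * (w z)^3 * of_real (U z)" for z
  define B where "B z = 2 * (w z)\<^sup>2 * cnj (P z) + 8 * z * (w z)^3 * of_real (U z)" for z
  define db where "db z h k = (A z * k + E z * cnj k) * h + (E z * k + B z * cnj k) * cnj h" for z h k
  have wd: "(w has_derivative (\<lambda>k. (w z)\<^sup>2 * (cnj z * k + z * cnj k))) (at z)" if "cmod z < 1" for z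
  proof -
    have "(w has_derivative (\<lambda>k. of_real ((disc_weight z)\<^sup>2 * (2 * Re z * Re k + 2 * Im z * Im k)))) (at z)"
      unfolding w_def by (rule has_derivative_of_real[OF has_derivative_disc_weight[OF that]])
    moreover have "of_real ((disc_weight z)\<^sup>2 * (2 * Re z * Re k + 2 * Im z * Im k)) =
        (w z)\<^sup>2 * (cnj z * k + z * cnj k)" for k
    proof -
      have "cnj z * k + z * cnj k = of_real (2 * Re z * Re k + 2 * Im z * Im k)"
        by (simp add: complex_eq_iff)
      then show ?thesis by (simp add: w_def)
    qed
    ultimately show ?thesis by simp
  qed
  have we: "w z * (1 - z * cnj z) = 1" if "cmod z < 1" for z
    unfolding w_def by (rule disc_weight_complex[OF that])
  have db: "((\<lambda>z. b z h) has_derivative db z h) (at z)" if "z \<in> D" for z h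
  proof -
    have z: "cmod z < 1" using that D(2) by auto
    note d = wd[OF z] U[OF that, THEN has_derivative_of_real[where 'a = complex]] P[OF that]
    have cf: "complex_of_real (conf_factor z) = 4 * (w z)\<^sup>2"
      by (simp add: conf_factor_def w_def)
    have re: "complex_of_real (Re (P z * k)) = (P z * k + cnj (P z) * cnj k) / 2" for k
      by (simp add: complex_eq_iff)
    show ?thesis
      unfolding b_def power2_eq_square
    proof (rule has_derivative_eq_rhs)
      show "((\<lambda>z. 2 * cnj z * w z * P z * h + 4 * (w z * w z) * of_real (U z) * cnj h) has_derivative
        (\<lambda>k. ((2 * cnj z * w z) * (Q z * k + of_real (conf_factor z * U z) * cnj k) +
             ((2 * cnj z) * ((w z)\<^sup>2 * (cnj z * k + z * cnj k)) + (2 * cnj k) * w z) * P z) * h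
          + ((4 * (w z * w z)) * of_real (Re (P z * k)) +
             (4 * (w z * ((w z)\<^sup>2 * (cnj z * k + z * cnj k)) + ((w z)\<^sup>2 * (cnj z * k + z * cnj k)) * w z)) * of_real (U z)) * cnj h)) (at z)"
        by (intro has_derivative_add has_derivative_mult_left has_derivative_mult has_derivative_mult_right
            has_derivative_cnj has_derivative_ident d)
    next
      show "(\<lambda>k. ((2 * cnj z * w z) * (Q z * k + of_real (conf_factor z * U z) * cnj k) +
             ((2 * cnj z) * ((w z)\<^sup>2 * (cnj z * k + z * cnj k)) + (2 * cnj k) * w z) * P z) * h
          + ((4 * (w z * w z)) * of_real (Re (P z * k)) +
             (4 * (w z * ((w z)\<^sup>2 * (cnj z * k + z * cnj k)) + ((w z)\<^sup>2 * (cnj z * k + z * cnj k)) * w z)) * of_real (U z)) * cnj h)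
           = db z h"
      proof
        fix k
        \<comment> \<open>the relation between weight and \<open>|z|\<^sup>2\<close> that makes the two mixed coefficients equal\<close>
        have w2: "w z + (w z)\<^sup>2 * (z * cnj z) = (w z)\<^sup>2" using we[OF z] by algebra
        have "(2 * cnj z) * ((w z)\<^sup>2 * (cnj z * k + z * cnj k)) + (2 * cnj k) * w z =
           2 * ((cnj z * w z)\<^sup>2 * k + (w z + (w z)\<^sup>2 * (z * cnj z)) * cnj k)"
          by (simp add: algebra_simps power2_eq_square)
        then have *: "(2 * cnj z) * ((w z)\<^sup>2 * (cnj z * k + z * cnj k)) + (2 * cnj k) * w z =
           2 * ((cnj z * w z)\<^sup>2 * k + (w z)\<^sup>2 * cnj k)"
          unfolding w2 .
        show "((2 * cnj z * w z) * (Q z * k + of_real (conf_factor z * U z) * cnj k) +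
             ((2 * cnj z) * ((w z)\<^sup>2 * (cnj z * k + z * cnj k)) + (2 * cnj k) * w z) * P z) * h
          + ((4 * (w z * w z)) * of_real (Re (P z * k)) +
             (4 * (w z * ((w z)\<^sup>2 * (cnj z * k + z * cnj k)) + ((w z)\<^sup>2 * (cnj z * k + z * cnj k)) * w z)) * of_real (U z)) * cnj h
           = db z h k"
          unfolding * of_real_mult cf re db_def A_def E_def B_def
          by (simp add: field_simps power2_eq_square power3_eq_cube)
      qed
    qed
  qed
  have "\<exists>f'. (hopf P Q has_field_derivative f') (at z)" if "z \<in> D" for z
  proof -
    obtain r where r: "r > 0" "ball z r \<subseteq> D" using D(1) \<open>z \<in> D\<close> open_contains_ball by blast
    have Uc: "continuous_on D U" "continuous_on D P"
      by (rule continuous_at_imp_continuous_on, blast intro: has_derivative_continuous U P)+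
    have wc: "continuous_on D w"
      by (rule continuous_at_imp_continuous_on) (use D(2) in \<open>auto intro!: has_derivative_continuous[OF wd]\<close>)
    have "\<exists>G. \<forall>x\<in>ball z r. (G has_derivative b x) (at x)"
    proof (rule closed_form_has_primitive[where db = db])
      show "linear (b x)" for x
        by (auto simp: b_def linear_iff algebra_simps scaleR_conv_of_real)
      show "((\<lambda>y. b y h) has_derivative db x h) (at x)" if "x \<in> ball z r" for x h
        by (rule db) (use r that in blast)
      show "db x h k = db x k h" for x h k by (simp add: db_def algebra_simps)
      show "continuous_on (ball z r) (\<lambda>x. db x h k)" for h k
      proof (rule continuous_on_subset[OF _ r(2)])
        show "continuous_on D (\<lambda>x. db x h k)"
          unfolding db_def A_def E_def B_def by (intro continuous_intros Q wc Uc)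
      qed
    qed auto
    then obtain G where G: "\<And>x. x \<in> ball z r \<Longrightarrow> (G has_derivative b x) (at x)" by blast
    have fd: "((\<lambda>x. P x - G x) has_field_derivative hopf P Q x) (at x)" if "x \<in> ball z r" for x
    proof -
      have "x \<in> D" using that r by blast
      have "((\<lambda>x. P x - G x) has_derivative
          (\<lambda>h. (Q x * h + of_real (conf_factor x * U x) * cnj h) - b x h)) (at x)"
        by (intro has_derivative_diff P G that \<open>x \<in> D\<close>)
      moreover have "(Q x * h + of_real (conf_factor x * U x) * cnj h) - b x h = hopf P Q x * h" for h
        by (simp add: b_def hopf_def w_def conf_factor_def algebra_simps)
      ultimately show ?thesis by (simp add: has_field_derivative_def)
    qed
    then have hol: "(\<lambda>x. P x - G x) holomorphic_on ball z r"
      unfolding holomorphic_on_open[OF open_ball] by blast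
    have "deriv (\<lambda>x. P x - G x) holomorphic_on ball z r"
      by (rule holomorphic_deriv[OF hol open_ball])
    then have "hopf P Q holomorphic_on ball z r"
      by (rule holomorphic_transform) (simp add: DERIV_imp_deriv[OF fd])
    then show ?thesis using r(1) by (auto simp: holomorphic_on_open)
  qed
  then show ?thesis using D(1) by (simp add: holomorphic_on_open)
qed

section \<open>Maximal surfaces with a prescribed Hopf differential\<close>

text \<open>
  The orthogonal complement of the tangent plane is spanned by \<open>p\<close>, and of its two unit vectors only
  \<open>p\<close> lies on the upper sheet.
\<close>

lemma H2_normal_unique:
  assumes z: "cmod z < 1" and n: "n \<in> H2" "\<And>k. lprod (poincare_deriv z k) n = 0"
  shows "n = poincare z"
proof -
  let ?p = "poincare z"
  define a where "a = - lprod n ?p"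
  have pp: "lprod ?p ?p = -1" "?p $ 3 > 0" "lprod n n = -1" "n $ 3 > 0"
    using poincare_in_H2[OF z] n(1) by (auto simp: H2_def)
  have diff: "lprod (n - a *\<^sub>R ?p) v = lprod n v - a * lprod ?p v" for v
    by (simp add: lprod_def algebra_simps)
  have "n - a *\<^sub>R ?p \<in> H2_tangent ?p"
    unfolding H2_tangent_def mem_Collect_eq diff pp(1) by (simp add: a_def)
  then obtain h where h: "n - a *\<^sub>R ?p = poincare_deriv z h"
    using range_poincare_deriv[OF z] by blast
  have "lprod (n - a *\<^sub>R ?p) (poincare_deriv z h) = 0"
    unfolding diff using n(2)[of h] lprod_poincare_deriv_poincare[OF z, of h]
    by (simp add: lprod_commute)
  then have "conf_factor z * (Re h ^ 2 + Im h ^ 2) = 0"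
    unfolding h lprod_poincare_deriv[OF z] by (simp add: power2_eq_square)
  then have "h = 0" using conf_factor_pos[OF z] by (simp add: complex_eq_iff sum_power2_eq_zero_iff)
  then have na: "n = a *\<^sub>R ?p" using h linear_0[OF linear_poincare_deriv[of z]] by simp
  have "a ^ 2 = 1" using pp(1,3) unfolding na lprod_bilinear by (simp add: power2_eq_square)
  moreover have "a > 0" using pp(2,4) unfolding na by (simp add: zero_less_mult_iff)
  ultimately have "a = 1" by (simp add: power2_eq_1_iff)
  then show ?thesis using na by simp
qed

text \<open>
  The equation enters twice: the trace term of the derivative drops out, and the Hopf coefficient
  becomes holomorphic.
\<close>

lemma X_of_weierstrass:
  assumes W: "openin (top_of_set H2) W" and u: "surf_Ck 2 W u"
    and pde: "\<And>p. p \<in> W \<Longrightarrow> H2_laplacian u p - 2 * u p = 0"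
  obtains q where "q holomorphic_on disc_region W"
    "\<And>z. z \<in> disc_region W \<Longrightarrow> ((\<lambda>z. X_of u (poincare z)) has_derivative
      (\<lambda>h. poincare_deriv z (cnj (q z * h) / conf_factor z))) (at z)"
    "\<And>z h. z \<in> disc_region W \<Longrightarrow> H2_hess u (poincare z) (poincare_deriv z h) -
      u (poincare z) *\<^sub>R poincare_deriv z h = poincare_deriv z (cnj (q z * h) / conf_factor z)"
proof -
  let ?D = "disc_region W" and ?U = "\<lambda>z. u (poincare z)"
  have D: "open ?D" "?D \<subseteq> ball 0 1"
    using open_disc_region[OF W] by (auto simp: disc_region_def)
  obtain P Q m where U: "\<And>z. z \<in> ?D \<Longrightarrow> (?U has_derivative (\<lambda>h. Re (P z * h))) (at z)"
    and P: "\<And>z. z \<in> ?D \<Longrightarrow> (P has_derivative (\<lambda>h. Q z * h + of_real (m z) * cnj h)) (at z)"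
    and Q: "continuous_on ?D Q"
    using Ck2_wirtinger_derivatives[OF D(1) surf_Ck_imp_Ck_on_disc[OF W u]] by blast
  define Y' where "Y' z h = poincare_deriv z (cnj (hopf P Q z * h +
    of_real (m z - conf_factor z * ?U z) * cnj h) / conf_factor z)" for z h
  have norm: "cmod z < 1" if "z \<in> ?D" for z using that D by auto
  have X: "X_of u (poincare z) = X_disc ?U P z" "lprod (X_disc ?U P z) (poincare z) = ?U z"
    "lprod (X_disc ?U P z) (poincare_deriv z h) = Re (P z * h)" if "z \<in> ?D" for z h
    using X_of_poincare[where u = u and P = P, OF norm[OF that] U[OF that]] by simp_all
  have Y: "(X_disc ?U P has_derivative Y' z) (at z)" if "z \<in> ?D" for z
    unfolding Y'_def
    by (rule has_derivative_X_disc[where U = ?U and P = P and Q = Q and m = "m z",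
          OF norm[OF that] U[OF that] P[OF that]])
  have hess: "H2_hess u (poincare z) (poincare_deriv z h) = Y' z h + ?U z *\<^sub>R poincare_deriv z h"
    if "z \<in> ?D" for z h
    by (rule X_of_hessian(2)[OF D that U X(1) X(2) X(3) Y[OF that]])
  have m: "m z = conf_factor z * ?U z" if z: "z \<in> ?D" for z
  proof -
    define c where "c = m z - conf_factor z * ?U z"
    have l: "conf_factor z > 0" by (rule conf_factor_pos[OF norm[OF z]])
    have "poincare z \<in> W" using z by (auto simp: disc_region_def)
    have "lprod (Y' z h) (poincare_deriv z h) = Re (hopf P Q z * h\<^sup>2) + c * (cmod h)\<^sup>2" for h
    proof -
      have eq: "conf_factor z * Re (a / of_real (conf_factor z) * b) = Re (a * b)" for a b
        using l by simp
      show ?thesis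
        unfolding Y'_def lprod_poincare_deriv[OF norm[OF z]] c_def[symmetric] cmod_power2 eq
        by (simp add: power2_eq_square algebra_simps)
    qed
    then have "H2_laplacian u (poincare z) = 2 * c / conf_factor z + 2 * ?U z"
      by (subst H2_laplacian_poincare[OF norm[OF z] hess[OF z] has_derivative_linear[OF Y[OF z]]])
        simp
    then have "2 * c / conf_factor z = 0" using pde[OF \<open>poincare z \<in> W\<close>] by simp
    then show ?thesis using l by (simp add: c_def)
  qed
  have Y'q: "Y' z h = poincare_deriv z (cnj (hopf P Q z * h) / conf_factor z)" if "z \<in> ?D" for z h
    unfolding Y'_def m[OF that] by simp
  show thesis
  proof
    show "hopf P Q holomorphic_on ?D"
      by (rule hopf_holomorphic[OF D U _ Q]) (use P m in auto)
    fix z assume z: "z \<in> ?D"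
    have "((\<lambda>z. X_of u (poincare z)) has_derivative Y' z) (at z)"
      by (rule has_derivative_transform_within_open[OF Y[OF z] D(1) z]) (simp add: X)
    then show "((\<lambda>z. X_of u (poincare z)) has_derivative
      (\<lambda>h. poincare_deriv z (cnj (hopf P Q z * h) / conf_factor z))) (at z)"
      by (rule has_derivative_eq_rhs) (simp add: Y'q[OF z] fun_eq_iff)
    show "H2_hess u (poincare z) (poincare_deriv z h) -
      u (poincare z) *\<^sub>R poincare_deriv z h = poincare_deriv z (cnj (hopf P Q z * h) / conf_factor z)" for h
      unfolding hess[OF z] Y'q[OF z] by simp
  qed
qed

text \<open>
  In components the derivative is \<open>Re (s\<^sub>j q h)\<close>, the real part of a holomorphic function of \<open>z\<close>.
\<close>

lemma Ck_on_weierstrass: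
  assumes D: "open D" "D \<subseteq> ball 0 1" and q: "q holomorphic_on D"
    and Y: "\<And>z. z \<in> D \<Longrightarrow> (Y has_derivative (\<lambda>h. poincare_deriv z (cnj (q z * h) / conf_factor z))) (at z)"
  shows "Ck_on k D Y"
proof -
  have nh: "(\<lambda>z. null_vec z $ j) holomorphic_on D" for j
  proof -
    have "\<forall>j. (\<lambda>z. null_vec z $ j) holomorphic_on D"
      unfolding forall_3 null_vec_nth by (auto intro!: holomorphic_intros)
    then show ?thesis by blast
  qed
  have "Ck_on k D (\<lambda>z. poincare_deriv z (cnj (q z * h) / conf_factor z))" for h k
  proof (rule Ck_on_vec[OF D(1)])
    fix j
    have "Ck_on k D (\<lambda>z. Re (null_vec z $ j * (q z * h)))"
      by (intro Ck_on_linear_compose[OF bounded_linear_Re D(1)] holomorphic_imp_Ck_on[OF D(1)]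
          holomorphic_intros nh q)
    then show "Ck_on k D (\<lambda>z. poincare_deriv z (cnj (q z * h) / conf_factor z) $ j)"
    proof (rule Ck_on_cong[OF D(1), rotated])
      fix z assume "z \<in> D"
      then have "conf_factor z > 0" using conf_factor_pos D by auto
      then show "Re (null_vec z $ j * (q z * h)) = poincare_deriv z (cnj (q z * h) / conf_factor z) $ j"
        by (simp add: poincare_deriv_def field_simps)
    qed
  qed
  then have "Ck_on (Suc k) D Y" by (intro Ck_on_SucI[OF D(1) Y]) auto
  then show ?thesis by (rule Ck_on_Suc_imp)
qed

text \<open>
  Since \<open>q\<close> has no zeros, \<open>dX\<close> maps onto the tangent plane of the hyperbolic plane.  So the normal at \<open>p\<close> is
  \<open>p\<close>, the Gauss map has the inclusion as differential, and the second fundamental form is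
  \<open>-Re (q h\<^sup>2)\<close>, which is trace-free for the conformal metric \<open>|q|\<^sup>2 |h|\<^sup>2 / \<lambda>\<close>.
\<close>

lemma weierstrass_maximal:
  assumes W: "openin (top_of_set H2) W" and q: "q holomorphic_on disc_region W"
    and q0: "\<And>z. z \<in> disc_region W \<Longrightarrow> q z \<noteq> 0"
    and X: "\<And>z. z \<in> disc_region W \<Longrightarrow> ((\<lambda>z. X (poincare z)) has_derivative
      (\<lambda>h. poincare_deriv z (cnj (q z * h) / conf_factor z))) (at z)"
  shows "maximal_immersion W X" and "p \<in> W \<Longrightarrow> gauss_map W X p = p"
proof -
  let ?D = "disc_region W"
  interpret param_chart W ?D poincare poincare_deriv poincare_inv
    by (rule param_chart_H2[OF W])
  have WH: "W \<subseteq> H2" using W openin_imp_subset by blast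
  have D: "open ?D" "?D \<subseteq> ball 0 1" by (rule open_D) (auto simp: disc_region_def)
  have norm: "cmod z < 1" if "z \<in> ?D" for z using that D by auto
  have dX: "surf_diff W X (poincare z) (poincare_deriv z h) = poincare_deriv z (cnj (q z * h) / conf_factor z)"
    if "z \<in> ?D" for z h
    by (rule surf_diff_eq[OF that X[OF that]])
  have ind: "lprod (surf_diff W X (poincare z) (poincare_deriv z h)) (surf_diff W X (poincare z) (poincare_deriv z k))
      = (cmod (q z))\<^sup>2 / conf_factor z * Re (h * cnj k)" if "z \<in> ?D" for z h k
    unfolding dX[OF that] lprod_poincare_deriv[OF norm[OF that]] cmod_power2
    using conf_factor_pos[OF norm[OF that]] by (simp add: field_simps power2_eq_square)
  have gauss: "gauss_map W X (poincare z) = poincare z" if z: "z \<in> ?D" for z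
    unfolding gauss_map_def tangent_space_eq[OF z]
  proof (rule the_equality)
    show "poincare z \<in> H2 \<and> (\<forall>v\<in>range (poincare_deriv z). lprod (surf_diff W X (poincare z) v) (poincare z) = 0)"
      using poincare_in_H2[OF norm[OF z]] by (auto simp: dX[OF z] lprod_poincare_deriv_poincare[OF norm[OF z]])
    fix n assume n: "n \<in> H2 \<and> (\<forall>v\<in>range (poincare_deriv z). lprod (surf_diff W X (poincare z) v) n = 0)"
    show "n = poincare z"
    proof (rule H2_normal_unique[OF norm[OF z]])
      show "n \<in> H2" using n by blast
      fix k :: complex
      \<comment> \<open>the direction whose image under \<open>dX\<close> is the tangent vector with coordinate \<open>k\<close>\<close>
      let ?h = "cnj (of_real (conf_factor z) * k) / q z"
      have "lprod (surf_diff W X (poincare z) (poincare_deriv z ?h)) n = 0" using n by blast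
      moreover have "cnj (q z * ?h) / conf_factor z = k"
        using q0[OF z] conf_factor_pos[OF norm[OF z]] by simp
      ultimately show "lprod (poincare_deriv z k) n = 0" unfolding dX[OF z] by simp
    qed
  qed
  have pW: "\<exists>z\<in>?D. p = poincare z" if "p \<in> W" for p
    using that poincare_image_disc_region[OF WH] by blast
  show "gauss_map W X p = p" if "p \<in> W"
    using pW[OF that] gauss by auto
  have dN: "surf_diff W (gauss_map W X) (poincare z) (poincare_deriv z h) = poincare_deriv z h"
    if z: "z \<in> ?D" for z h
    by (rule surf_diff_eq[OF z],
        rule has_derivative_transform_within_open[OF deriv[OF z] open_D z])
      (simp add: gauss)
  have "mean_curvature W X (poincare z) = 0" if z: "z \<in> ?D" for z
  proof -
    have l: "conf_factor z > 0" by (rule conf_factor_pos[OF norm[OF z]])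
    have "metric_trace (\<lambda>v w. lprod (surf_diff W X (poincare z) v) (surf_diff W X (poincare z) w))
        (range (poincare_deriv z))
       (\<lambda>v w. - lprod (surf_diff W (gauss_map W X) (poincare z) v) (surf_diff W X (poincare z) w))
      = (- Re (q z) + Re (q z)) / ((cmod (q z))\<^sup>2 / conf_factor z)"
    proof (rule metric_trace_conformal[where L = "poincare_deriv z" and c = "(cmod (q z))\<^sup>2 / conf_factor z"
          and ?a11.0 = "- Re (q z)" and ?a12.0 = "2 * Im (q z)" and ?a22.0 = "Re (q z)"])
      show "(cmod (q z))\<^sup>2 / conf_factor z > 0" using l q0[OF z] by simp
      show "- lprod (surf_diff W (gauss_map W X) (poincare z) (poincare_deriv z h)) (surf_diff W X (poincare z) (poincare_deriv z h))
        = - Re (q z) * (Re h)\<^sup>2 + 2 * Im (q z) * (Re h * Im h) + Re (q z) * (Im h)\<^sup>2" for h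
        unfolding dN[OF z] dX[OF z] lprod_poincare_deriv[OF norm[OF z]] using l
        by (simp add: field_simps power2_eq_square)
    qed (rule ind[OF z])
    then show ?thesis unfolding mean_curvature_def tangent_space_eq[OF z] by simp
  qed
  then have mean: "\<forall>p\<in>W. mean_curvature W X p = 0" using pW by auto
  have "surf_Ck 2 W X"
    by (rule Ck_on_disc_imp_surf_Ck[OF W order_refl Ck_on_weierstrass[OF D q X]])
  moreover have "lprod (surf_diff W X p v) (surf_diff W X p v) > 0"
    if p: "p \<in> W" and v: "v \<in> tangent_space W p" "v \<noteq> 0" for p v
  proof -
    obtain z where z: "z \<in> ?D" "p = poincare z" using pW[OF p] by blast
    then obtain h where h: "v = poincare_deriv z h" using v tangent_space_eq by auto
    have "h \<noteq> 0" using v(2) h linear_0[OF linear_poincare_deriv[of z]] by auto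
    then have "(Re h)\<^sup>2 + (Im h)\<^sup>2 > 0" by (simp add: complex_eq_iff sum_power2_gt_zero_iff)
    then show ?thesis
      unfolding z(2) h ind[OF z(1)] using q0[OF z(1)] conf_factor_pos[OF norm[OF z(1)]]
      by (simp add: power2_eq_square)
  qed
  ultimately show "maximal_immersion W X"
    unfolding maximal_immersion_def spacelike_immersion_def
    using is_surface_H2_open[OF W] mean by blast
qed

text \<open>
  Zeros of the holomorphic Hopf coefficient on a connected region are isolated unless it vanishes
  identically, and then \<open>X\<^sub>u\<close> has derivative zero.
\<close>

theorem X_of_branched_maximal:
  assumes \<Omega>: "H2_domain \<Omega>" and u: "surf_Ck 2 \<Omega> u"
    and pde: "\<And>p. p \<in> \<Omega> \<Longrightarrow> H2_laplacian u p - 2 * u p = 0"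
  shows "X_of u constant_on \<Omega> \<or> branched_maximal_immersion \<Omega> (branch_points \<Omega> u) (X_of u)"
    and "p \<in> regular_set \<Omega> u \<Longrightarrow> gauss_map (regular_set \<Omega> u) (X_of u) p = p"
proof -
  let ?D = "disc_region \<Omega>" and ?R = "regular_set \<Omega> u"
  have W: "openin (top_of_set H2) \<Omega>" and con: "connected \<Omega>"
    using \<Omega> by (auto simp: H2_domain_def)
  have WH: "\<Omega> \<subseteq> H2" using W openin_imp_subset by blast
  have D: "open ?D" "?D \<subseteq> ball 0 1" using open_disc_region[OF W] by (auto simp: disc_region_def)
  have norm: "cmod z < 1" if "z \<in> ?D" for z using that D by auto
  have "connected (poincare_inv ` \<Omega>)"
    by (rule connected_continuous_image[OF _ con])
      (use WH H2_subset_upper Ck_on_continuous[OF Ck_on_poincare_inv] in \<open>blast intro: continuous_on_subset\<close>)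
  then have conD: "connected ?D" unfolding poincare_inv_image[OF WH] .
  obtain q where q: "q holomorphic_on ?D"
    and X: "\<And>z. z \<in> ?D \<Longrightarrow> ((\<lambda>z. X_of u (poincare z)) has_derivative
      (\<lambda>h. poincare_deriv z (cnj (q z * h) / conf_factor z))) (at z)"
    and A: "\<And>z h. z \<in> ?D \<Longrightarrow> H2_hess u (poincare z) (poincare_deriv z h) -
      u (poincare z) *\<^sub>R poincare_deriv z h = poincare_deriv z (cnj (q z * h) / conf_factor z)"
    using X_of_weierstrass[OF W u pde] by blast
  have pW: "\<exists>z\<in>?D. p = poincare z" if "p \<in> \<Omega>" for p
    using that poincare_image_disc_region[OF WH] by blast
  have reg: "poincare z \<in> ?R \<longleftrightarrow> q z \<noteq> 0" if z: "z \<in> ?D" for z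
  proof -
    have l: "conf_factor z > 0" by (rule conf_factor_pos[OF norm[OF z]])
    let ?a = "cnj (q z) / conf_factor z" and ?b = "cnj (q z * \<i>) / conf_factor z"
    have "endo_det lprod (H2_tangent (poincare z)) (\<lambda>Y. H2_hess u (poincare z) Y - u (poincare z) *\<^sub>R Y)
      = Re ?a * Im ?b - Im ?a * Re ?b"
      unfolding range_poincare_deriv[OF norm[OF z], symmetric]
    proof (rule endo_det_conformal[where L = "poincare_deriv z", OF lprod_poincare_deriv[OF norm[OF z]] l])
      fix h
      have "cnj (q z * h) / conf_factor z = of_real (Re h) * ?a + of_real (Im h) * ?b"
        using l by (simp add: complex_eq_iff field_simps)
      then show "H2_hess u (poincare z) (poincare_deriv z h) - u (poincare z) *\<^sub>R poincare_deriv z h =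
          poincare_deriv z (of_real (Re h) * ?a + of_real (Im h) * ?b)"
        unfolding A[OF z] by simp
    qed
    also have "\<dots> = - ((Re (q z))\<^sup>2 + (Im (q z))\<^sup>2) / (conf_factor z)\<^sup>2"
      using l by (simp add: field_simps power2_eq_square)
    finally have det: "endo_det lprod (H2_tangent (poincare z))
        (\<lambda>Y. H2_hess u (poincare z) Y - u (poincare z) *\<^sub>R Y) =
      - ((Re (q z))\<^sup>2 + (Im (q z))\<^sup>2) / (conf_factor z)\<^sup>2" .
    have "- s / c\<^sup>2 \<noteq> 0 \<longleftrightarrow> s \<noteq> 0" if "c > 0" for s c :: real
      using that by simp
    from this[OF l] have "endo_det lprod (H2_tangent (poincare z))
        (\<lambda>Y. H2_hess u (poincare z) Y - u (poincare z) *\<^sub>R Y) \<noteq> 0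
        \<longleftrightarrow> (Re (q z))\<^sup>2 + (Im (q z))\<^sup>2 \<noteq> 0"
      unfolding det .
    moreover have "poincare z \<in> \<Omega>" using z by (auto simp: disc_region_def)
    ultimately show ?thesis by (simp add: regular_set_def complex_eq_iff sum_power2_eq_zero_iff)
  qed
  have sub: "?R \<subseteq> \<Omega>" by (auto simp: regular_set_def)
  have DR: "disc_region ?R = {z \<in> ?D. q z \<noteq> 0}"
    using reg sub by (auto simp: disc_region_def)
  have "open (disc_region ?R)"
  proof -
    have "disc_region ?R = ?D \<inter> q -` (- {0})" unfolding DR by auto
    then show ?thesis
      using continuous_open_preimage[OF holomorphic_on_imp_continuous_on[OF q] D(1), of "- {0}"]
      by (simp add: open_Compl)
  qed
  moreover have "disc_region ?R \<subseteq> ball 0 1" by (auto simp: disc_region_def)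
  ultimately have "openin (top_of_set H2) (poincare ` disc_region ?R)" by (rule openin_poincare_image)
  then have R: "openin (top_of_set H2) ?R"
    unfolding poincare_image_disc_region[OF order_trans[OF sub WH]] .
  have qR: "q holomorphic_on disc_region ?R" "\<And>z. z \<in> disc_region ?R \<Longrightarrow> q z \<noteq> 0"
    using q DR by (auto intro: holomorphic_on_subset)
  have XR: "((\<lambda>z. X_of u (poincare z)) has_derivative
      (\<lambda>h. poincare_deriv z (cnj (q z * h) / conf_factor z))) (at z)" if "z \<in> disc_region ?R" for z
    using X that DR by auto
  show "gauss_map ?R (X_of u) p = p" if "p \<in> ?R"
    by (rule weierstrass_maximal(2)[OF R qR XR that])
  show "X_of u constant_on \<Omega> \<or> branched_maximal_immersion \<Omega> (branch_points \<Omega> u) (X_of u)"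
  proof (cases "\<forall>z\<in>?D. q z = 0")
    case True
    have "((\<lambda>z. X_of u (poincare z)) has_derivative (\<lambda>h. 0)) (at z)" if "z \<in> ?D" for z
      using X[OF that] True that linear_0[OF linear_poincare_deriv[of z]] by simp
    then obtain c where "\<And>z. z \<in> ?D \<Longrightarrow> X_of u (poincare z) = c"
      using has_derivative_zero_unique_connected[OF D(1) conD, of "\<lambda>z. X_of u (poincare z)"] by metis
    then have "X_of u constant_on \<Omega>" unfolding constant_on_def using pW by metis
    then show ?thesis by blast
  next
    case False
    then obtain \<beta> where \<beta>: "\<beta> \<in> ?D" "q \<beta> \<noteq> 0" by blast
    let ?B = "branch_points \<Omega> u"
    have B: "\<Omega> - ?B = ?R" using sub by (auto simp: branch_points_def)
    have "openin (top_of_set \<Omega>) ?R"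
      by (rule openin_subset_trans[OF R sub WH])
    then have "closedin (top_of_set \<Omega>) ?B"
      unfolding closedin_def using B by (auto simp: branch_points_def)
    moreover have "discrete ?B"
    proof (rule discreteI)
      fix p assume p: "p \<in> ?B"
      then obtain z where z: "z \<in> ?D" "p = poincare z" using pW by (auto simp: branch_points_def)
      then have "q z = 0" using p reg by (auto simp: branch_points_def)
      from isolated_zeros[OF q D(1) conD z(1) this \<beta>]
      obtain r where r: "0 < r" "ball z r \<subseteq> ?D" "\<And>w. w \<in> ball z r - {z} \<Longrightarrow> q w \<noteq> 0" by blast
      have "openin (top_of_set H2) (poincare ` ball z r)"
        by (rule openin_poincare_image) (use r D in auto)
      then obtain T where T: "open T" "poincare ` ball z r = H2 \<inter> T" by (auto simp: openin_open)
      have "T \<inter> ?B = {p}"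
      proof (intro equalityI subsetI)
        fix b assume b: "b \<in> T \<inter> ?B"
        then have "b \<in> H2 \<inter> T" using WH by (auto simp: branch_points_def)
        then obtain w where w: "w \<in> ball z r" "b = poincare w" using T(2) by blast
        then have "q w = 0" using b reg r(2) by (auto simp: branch_points_def)
        then have "w = z" using r(3) w(1) by blast
        then show "b \<in> {p}" using w z by simp
      next
        fix b assume "b \<in> {p}"
        moreover have "p \<in> poincare ` ball z r" using z r(1) by auto
        ultimately show "b \<in> T \<inter> ?B" using p T(2) by auto
      qed
      then show "p isolated_in ?B" by (rule isolated_inI[OF p T(1)])
    qed
    moreover have "surf_Ck 2 \<Omega> (X_of u)"
      by (rule Ck_on_disc_imp_surf_Ck[OF W order_refl Ck_on_weierstrass[OF D q X]])
    ultimately show ?thesis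
      unfolding branched_maximal_immersion_def B using weierstrass_maximal(1)[OF R qR XR] by blast
  qed
qed

section \<open>Extending \<open>C\<^sup>1\<close> maps from a surface\<close>

text \<open>
  Solutions of linear equations depend continuously on the operator: \<open>w - w\<^sub>0 = A\<^sub>0\<^sup>-\<^sup>1 (A\<^sub>0 - A) w\<close>, and
  for \<open>A\<close> near \<open>A\<^sub>0\<close> this bounds \<open>w\<close> and then \<open>w - w\<^sub>0\<close>.  It provides the continuity of the derivative
  of a local inverse.
\<close>

lemma tendsto_solution:
  fixes A :: "'b \<Rightarrow> 'a::euclidean_space \<Rightarrow>\<^sub>L 'a"
  assumes A: "(A \<longlongrightarrow> A0) F" and bij: "bij (blinfun_apply A0)"
    and w: "\<forall>\<^sub>F y in F. A y (w y) = v"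
  shows "(w \<longlongrightarrow> inv (blinfun_apply A0) v) F"
proof -
  let ?w = "inv (blinfun_apply A0) v"
  have w0: "A0 ?w = v" using bij by (simp add: bij_is_surj surj_f_inv_f)
  obtain B where B: "linear B" "B \<circ> blinfun_apply A0 = id"
    using linear_injective_left_inverse[OF bounded_linear.linear[OF blinfun.bounded_linear_right] bij_is_inj[OF bij]]
    by blast
  obtain K where K: "K > 0" "\<And>x. norm (B x) \<le> K * norm x" using linear_bounded_pos[OF B(1)] by blast
  have null: "((\<lambda>y. norm (A0 - A y)) \<longlongrightarrow> 0) F"
    using tendsto_norm[OF tendsto_diff[OF tendsto_const[of A0] A]] by simp
  then have ev: "\<forall>\<^sub>F y in F. norm (A0 - A y) < 1 / (2 * K)"
    using K(1) by (intro order_tendstoD) auto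
  have "\<forall>\<^sub>F y in F. norm (w y - ?w) \<le> 2 * K * norm ?w * norm (A0 - A y)"
    using ev w
  proof eventually_elim
    case (elim y)
    have "B (A0 x) = x" for x using fun_cong[OF B(2), of x] by simp
    then have "w y - ?w = B (A0 (w y - ?w))" by simp
    also have "A0 (w y - ?w) = (A0 - A y) (w y)"
      using elim(2) w0 by (simp add: blinfun.diff_right blinfun.diff_left)
    finally have "norm (w y - ?w) \<le> K * norm ((A0 - A y) (w y))" using K(2) by metis
    also have "\<dots> \<le> K * (norm (A0 - A y) * norm (w y))"
      using K(1) norm_blinfun by (intro mult_left_mono) auto
    finally have 1: "norm (w y - ?w) \<le> K * norm (A0 - A y) * norm (w y)" by (simp add: mult.assoc)
    have "K * norm (A0 - A y) \<le> 1 / 2" using elim(1) K(1) by (simp add: field_simps)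
    then have "norm (w y - ?w) \<le> 1 / 2 * norm (w y)"
      using 1 mult_right_mono[of "K * norm (A0 - A y)" "1 / 2" "norm (w y)"] by simp
    moreover have "norm (w y) \<le> norm ?w + norm (w y - ?w)" by (rule norm_triangle_sub)
    ultimately have "norm (w y) \<le> 2 * norm ?w" by simp
    then have "K * norm (A0 - A y) * norm (w y) \<le> K * norm (A0 - A y) * (2 * norm ?w)"
      using K(1) by (intro mult_left_mono) auto
    with 1 show ?case by (simp add: algebra_simps)
  qed
  moreover have "((\<lambda>y. 2 * K * norm ?w * norm (A0 - A y)) \<longlongrightarrow> 0) F"
    using tendsto_mult_right_zero[OF null] by simp
  ultimately have "((\<lambda>y. w y - ?w) \<longlongrightarrow> 0) F" by (rule Lim_null_comparison)
  then show ?thesis by (simp add: LIM_zero_iff)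
qed

text \<open>
  Composing \<open>\<psi>\<close> with a linear left inverse of its derivative at \<open>x0\<close> gives a map of the plane to which the
  inverse function theorem applies.  The local inverse, precomposed with that linear map, is defined on
  an open set of the ambient space.
\<close>

lemma local_param_left_inverse:
  assumes par: "local_param M U \<psi>" and x0: "x0 \<in> U"
  obtains N \<rho> where "open N" "\<psi> x0 \<in> N" "Ck_on 1 N \<rho>" "\<rho> ` N \<subseteq> U"
    "\<And>y. y \<in> M \<inter> N \<Longrightarrow> \<psi> (\<rho> y) = y"
proof -
  have U: "open U" and op: "openin (top_of_set M) (\<psi> ` U)"
    and hom: "\<exists>\<psi>'. homeomorphism U (\<psi> ` U) \<psi> \<psi>'" and Ck: "Ck_on (Suc 1) U \<psi>"
    and inj: "inj (frechet_derivative \<psi> (at x0))"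
    using par x0 by (auto simp: local_param_def numeral_2_eq_2 simp del: Ck_on.simps)
  let ?d = "\<lambda>x. frechet_derivative \<psi> (at x)"
  have d: "(\<psi> has_derivative ?d x) (at x)" if "x \<in> U" for x by (rule Ck_on_SucD[OF Ck that])
  obtain L where L: "linear L" "L \<circ> ?d x0 = id"
    using linear_injective_left_inverse[OF has_derivative_linear[OF d[OF x0]] inj] by blast
  have bl: "bounded_linear L" using L(1) by (simp add: linear_conv_bounded_linear)
  define F' where "F' x = Blinfun (\<lambda>h. L (?d x h))" for x
  have F': "blinfun_apply (F' x) = (\<lambda>h. L (?d x h))" if "x \<in> U" for x
    unfolding F'_def
    by (rule bounded_linear_Blinfun_apply[OF bounded_linear_compose[OF bl has_derivative_bounded_linear[OF d[OF that]]]])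
  have derF: "((\<lambda>x. L (\<psi> x)) has_derivative blinfun_apply (F' x)) (at x)" if "x \<in> U" for x
    unfolding F'[OF that] by (rule bounded_linear.has_derivative[OF bl d[OF that]])
  have contF: "continuous_on U F'"
  proof (rule continuous_on_blinfun_componentwise)
    fix i :: "real^2"
    have "continuous_on U (\<lambda>x. ?d x i)" using Ck_on_continuous[OF Ck_on_SucD'[OF Ck]] .
    then have "continuous_on U (\<lambda>x. L (?d x i))" by (rule bounded_linear.continuous_on[OF bl])
    then show "continuous_on U (\<lambda>x. blinfun_apply (F' x) i)"
      by (rule continuous_on_eq) (simp add: F')
  qed
  have inv0: "id_blinfun o\<^sub>L F' x0 = id_blinfun"
    using L(2) by (intro blinfun_eqI) (simp add: F'[OF x0] o_def fun_eq_iff)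
  obtain U' V G G' where G: "open U'" "U' \<subseteq> U" "x0 \<in> U'" "open V" "L (\<psi> x0) \<in> V"
    "homeomorphism U' V (\<lambda>x. L (\<psi> x)) G"
    "\<And>y. y \<in> V \<Longrightarrow> (G has_derivative G' y) (at y)"
    "\<And>y. y \<in> V \<Longrightarrow> G' y = inv (blinfun_apply (F' (G y)))"
    "\<And>y. y \<in> V \<Longrightarrow> bij (blinfun_apply (F' (G y)))"
    by (rule inverse_function_theorem[OF U derF contF x0 inv0], assumption) (rule that; (assumption | simp))
  have GV: "G y \<in> U'" if "y \<in> V" for y using G(6) that by (auto simp: homeomorphism_def)
  have "Ck_on 1 V G"
    unfolding One_nat_def
  proof (rule Ck_on_SucI[OF G(4) G(7)])
    fix v
    have "isCont (\<lambda>y. G' y v) y" if y: "y \<in> V" for y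
    proof -
      have "G y \<in> U" using GV[OF y] G(2) by blast
      then have "isCont F' (G y)"
        using contF U by (simp add: continuous_on_eq_continuous_at)
      then have "((\<lambda>y. F' (G y)) \<longlongrightarrow> F' (G y)) (at y)"
        using isCont_o2[OF has_derivative_continuous[OF G(7)[OF y]]] by (simp add: isCont_def)
      moreover have "\<forall>\<^sub>F y in at y. F' (G y) (G' y v) = v"
      proof -
        have "\<forall>\<^sub>F y in at y. y \<in> V" using y G(4) by (rule eventually_at_in_open'[rotated])
        then show ?thesis
          by eventually_elim (simp add: G(8,9) bij_is_surj surj_f_inv_f)
      qed
      ultimately have "((\<lambda>y. G' y v) \<longlongrightarrow> inv (blinfun_apply (F' (G y))) v) (at y)"
        by (rule tendsto_solution[OF _ G(9)[OF y]])
      then show ?thesis by (simp add: isCont_def G(8)[OF y])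
    qed
    then show "Ck_on 0 V (\<lambda>y. G' y v)" by (simp add: continuous_at_imp_continuous_on)
  qed
  obtain \<psi>' where "homeomorphism U (\<psi> ` U) \<psi> \<psi>'" using hom by blast
  moreover have "openin (top_of_set U) U'" using G(1,2) by (simp add: open_subset)
  ultimately have "openin (top_of_set (\<psi> ` U)) (\<psi> ` U')" by (rule homeomorphism_imp_open_map)
  then have "openin (top_of_set M) (\<psi> ` U')" using op openin_trans by blast
  then obtain T where T: "open T" "\<psi> ` U' = M \<inter> T" by (auto simp: openin_open)
  define N where "N = T \<inter> L -` V"
  have oN: "open N"
    unfolding N_def using T(1) G(4) linear_continuous_on[OF bl, of UNIV]
    by (intro open_Int open_vimage) auto
  show thesis
  proof (rule that[OF oN, of "\<lambda>y. G (L y)"])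
    show "\<psi> x0 \<in> N" using T(2) G(3,5) by (auto simp: N_def)
    show "Ck_on 1 N (\<lambda>y. G (L y))"
      by (rule Ck_on_compose[OF oN _ \<open>Ck_on 1 V G\<close> Ck_on_bounded_linear[OF bl oN]]) (auto simp: N_def)
    show "(\<lambda>y. G (L y)) ` N \<subseteq> U" using GV G(2) by (auto simp: N_def)
    fix y assume "y \<in> M \<inter> N"
    then obtain x where x: "x \<in> U'" "y = \<psi> x" using T(2) by (auto simp: N_def)
    then show "\<psi> (G (L y)) = y" using G(6) by (auto simp: homeomorphism_def)
  qed
qed

lemma surf_C1_extension:
  assumes "is_surface M" "surf_Ck 1 M f" "q \<in> M"
  obtains N f' where "open N" "q \<in> N" "Ck_on 1 N f'" "\<And>y. y \<in> M \<inter> N \<Longrightarrow> f' y = f y"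
proof -
  obtain U \<psi> x0 where par: "local_param M U \<psi>" and x0: "x0 \<in> U" "q = \<psi> x0"
    using assms(1,3) unfolding is_surface_def by blast
  obtain N \<rho> where N: "open N" "\<psi> x0 \<in> N" "Ck_on 1 N \<rho>" "\<rho> ` N \<subseteq> U"
    "\<And>y. y \<in> M \<inter> N \<Longrightarrow> \<psi> (\<rho> y) = y"
    by (rule local_param_left_inverse[OF par x0(1)]) (rule that; (assumption | simp))
  have "Ck_on 1 U (f \<circ> \<psi>)" using assms(2) par by (auto simp: surf_Ck_def)
  from Ck_on_compose[OF N(1,4) this N(3)] show thesis
    by (rule that[OF N(1), rotated]) (use N x0 in auto)
qed

lemma local_param_openin:
  assumes "openin (top_of_set M) N" "local_param N U \<phi>"
  shows "local_param M U \<phi>"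
  using assms openin_trans unfolding local_param_def by blast

lemma surf_Ck_openin: "openin (top_of_set M) N \<Longrightarrow> surf_Ck k M f \<Longrightarrow> surf_Ck k N f"
  unfolding surf_Ck_def using local_param_openin by blast

lemma surf_Ck_mono: "surf_Ck m M f \<Longrightarrow> k \<le> m \<Longrightarrow> surf_Ck k M f"
  unfolding surf_Ck_def using Ck_on_mono by blast

text \<open>
  Parametrizations of \<open>M\<close> only have to be restricted to the preimage of \<open>N\<close>.
\<close>

lemma is_surface_openin:
  assumes MN: "openin (top_of_set M) N" and M: "is_surface M"
  shows "is_surface N"
  unfolding is_surface_def
proof
  fix p assume p: "p \<in> N"
  then have "p \<in> M" using MN openin_imp_subset by blast
  then obtain U \<phi> where par: "local_param M U \<phi>" and pU: "p \<in> \<phi> ` U"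
    using M by (auto simp: is_surface_def)
  then have U: "open U" and op: "openin (top_of_set M) (\<phi> ` U)" and Ck: "Ck_on 2 U \<phi>"
    and inj: "\<forall>x\<in>U. inj (frechet_derivative \<phi> (at x))"
    by (auto simp: local_param_def simp del: Ck_on.simps)
  obtain \<psi> where hom: "homeomorphism U (\<phi> ` U) \<phi> \<psi>" using par by (auto simp: local_param_def)
  obtain T where T: "open T" "N = M \<inter> T" using MN by (auto simp: openin_open)
  define U' where "U' = U \<inter> \<phi> -` T"
  have U': "open U'" "U' \<subseteq> U"
    unfolding U'_def using continuous_open_preimage[OF Ck_on_continuous[OF Ck] U T(1)] by auto
  have im: "\<phi> ` U' = \<phi> ` U \<inter> N"
    using openin_imp_subset[OF op] T(2) by (auto simp: U'_def)
  have "openin (top_of_set M) (\<phi> ` U')" unfolding im using op MN by (rule openin_Int)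
  then have "openin (top_of_set N) (\<phi> ` U')"
    by (rule openin_subset_trans) (use im openin_imp_subset[OF MN] in auto)
  moreover have "homeomorphism U' (\<phi> ` U') \<phi> \<psi>"
    by (rule homeomorphism_of_subsets[OF hom U'(2) subset_refl]) (simp add: U'_def)
  ultimately have "local_param N U' \<phi>"
    unfolding local_param_def using U' Ck_on_subset[OF Ck U'(2)] inj by blast
  moreover have "p \<in> \<phi> ` U'" using im pU p by blast
  ultimately show "\<exists>U \<phi>. local_param N U \<phi> \<and> p \<in> \<phi> ` U" by blast
qed

section \<open>The inverse Gauss parametrization\<close>

text \<open>
  The normal is the normalized Lorentz cross product \<open>c\<close> of the images of \<open>1\<close> and \<open>\<i>\<close>.  It is timelike
  because \<open>\<langle>c, c\<rangle>\<close> is minus the Gram determinant \<open>\<Delta>\<close>.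
\<close>

lemma spacelike_plane_has_normal:
  assumes A: "linear A" and pos: "\<And>h. h \<noteq> 0 \<Longrightarrow> lprod (A h) (A h) > 0"
  shows "\<exists>n\<in>H2. \<forall>h::complex. lprod (A h) n = 0"
proof -
  let ?a = "A 1" and ?b = "A \<i>"
  note split = linear_complex_expand[OF A]
  define \<Delta> where "\<Delta> = lprod ?a ?a * lprod ?b ?b - (lprod ?a ?b)\<^sup>2"
  have aa: "lprod ?a ?a > 0" by (rule pos) simp
  have "\<Delta> > 0"
  proof -
    \<comment> \<open>a vector orthogonal to \<open>?a\<close> in the plane; its square is \<open>\<langle>a, a\<rangle> \<Delta>\<close>\<close>
    let ?h = "Complex (lprod ?a ?b) (- lprod ?a ?a)"
    have "?h \<noteq> 0" using aa by (simp add: complex_eq_iff)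
    from pos[OF this] have "lprod ?a ?a * \<Delta> > 0"
      unfolding split[of ?h] \<Delta>_def
      by (simp add: lprod_bilinear lprod_diff lprod_commute[of ?b ?a] algebra_simps power2_eq_square)
    then show ?thesis using aa by (simp add: zero_less_mult_iff)
  qed
  define c :: "real^3" where "c = vector [?a$2 * ?b$3 - ?a$3 * ?b$2, ?a$3 * ?b$1 - ?a$1 * ?b$3,
    - (?a$1 * ?b$2 - ?a$2 * ?b$1)]"
  have c: "lprod ?a c = 0" "lprod ?b c = 0" "lprod c c = - \<Delta>"
    unfolding lprod_def c_def \<Delta>_def by (simp_all add: algebra_simps power2_eq_square)
  have "(c $ 3)\<^sup>2 > 0"
  proof -
    have "(c $ 3)\<^sup>2 = (c $ 1)\<^sup>2 + (c $ 2)\<^sup>2 + \<Delta>" using c(3) by (simp add: lprod_def power2_eq_square)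
    then show ?thesis using \<open>\<Delta> > 0\<close> by (smt (verit) zero_le_power2)
  qed
  then have c3: "c $ 3 \<noteq> 0" by auto
  define t where "t = sgn (c $ 3) / sqrt \<Delta>"
  have t2: "t * t * \<Delta> = 1"
    using c3 \<open>\<Delta> > 0\<close> by (simp add: t_def sgn_if)
  have "t *\<^sub>R c \<in> H2"
  proof -
    have "lprod (t *\<^sub>R c) (t *\<^sub>R c) = - (t * t * \<Delta>)" by (simp add: lprod_bilinear c)
    moreover have "(t *\<^sub>R c) $ 3 > 0"
      using c3 \<open>\<Delta> > 0\<close> by (auto simp: t_def sgn_if zero_less_mult_iff zero_less_divide_iff divide_less_0_iff)
    ultimately show ?thesis by (simp add: H2_def t2)
  qed
  moreover have "lprod (A h) (t *\<^sub>R c) = 0" for h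
    unfolding split[of h] by (simp add: lprod_bilinear c)
  ultimately show ?thesis by blast
qed

lemma tangent_plane_coordinates:
  assumes z: "cmod z < 1" and A: "linear A" "\<And>h. lprod (A h) (poincare z) = 0"
  obtains \<alpha> where "linear \<alpha>" "\<And>h. A h = poincare_deriv z (\<alpha> h)"
proof -
  have "inj (poincare_deriv z)" by (rule poincare_chart.deriv_inj) (use z in simp)
  from linear_injective_left_inverse[OF linear_poincare_deriv this]
  obtain \<rho> where \<rho>: "linear \<rho>" "\<rho> \<circ> poincare_deriv z = id" by blast
  have "A h = poincare_deriv z ((\<rho> \<circ> A) h)" for h
  proof -
    have "A h \<in> range (poincare_deriv z)"
      using A(2) unfolding range_poincare_deriv[OF z] H2_tangent_def by blast
    then obtain k where "A h = poincare_deriv z k" by blast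
    then show ?thesis using fun_cong[OF \<rho>(2), of k] by simp
  qed
  then show thesis using that[OF linear_compose[OF A(1) \<rho>(1)]] by blast
qed

text \<open>
  By dimension, a spacelike plane orthogonal to \<open>n\<close> is the whole tangent plane of the hyperbolic plane at
  \<open>n\<close>, which determines \<open>n\<close>.
\<close>

lemma spacelike_plane_unique_normal:
  assumes A: "linear A" and pos: "\<And>h. h \<noteq> 0 \<Longrightarrow> lprod (A h) (A h) > 0"
  shows "\<exists>!n. n \<in> H2 \<and> (\<forall>h::complex. lprod (A h) n = 0)"
proof -
  obtain n where n: "n \<in> H2" "\<And>h. lprod (A h) n = 0"
    using spacelike_plane_has_normal[OF A pos] by blast
  define z where "z = poincare_inv n"
  have z: "cmod z < 1" and nz: "n = poincare z"
    using n(1) by (simp_all add: z_def cmod_poincare_inv poincare_poincare_inv)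
  obtain \<alpha> where \<alpha>: "linear \<alpha>" "\<And>h. A h = poincare_deriv z (\<alpha> h)"
    by (rule tangent_plane_coordinates[OF z A n(2)[unfolded nz]]) (rule that; simp)
  have "inj \<alpha>"
    unfolding linear_injective_0[OF \<alpha>(1)]
  proof (intro allI impI)
    fix h assume "\<alpha> h = 0"
    then have "A h = 0" using \<alpha>(2)[of h] linear_0[OF linear_poincare_deriv[of z]] by simp
    then show "h = 0" using pos[of h] by (auto simp: lprod_bilinear)
  qed
  then have surj: "surj \<alpha>" by (rule linear_inj_imp_surj[OF \<alpha>(1)])
  show ?thesis
  proof (rule ex1I[of _ n])
    show "n \<in> H2 \<and> (\<forall>h. lprod (A h) n = 0)" using n by blast
    fix n' assume n': "n' \<in> H2 \<and> (\<forall>h. lprod (A h) n' = 0)"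
    have "n' = poincare z"
    proof (rule H2_normal_unique[OF z])
      show "n' \<in> H2" using n' by blast
      fix k
      obtain h where "k = \<alpha> h" using surj by (auto elim: surjE)
      then show "lprod (poincare_deriv z k) n' = 0" using n' \<alpha>(2)[of h] by metis
    qed
    then show "n' = n" using nz by simp
  qed
qed

text \<open>
  The trace of the inverse of a two by two matrix is its trace divided by its determinant.
\<close>

lemma inverse_trace_zero:
  fixes \<alpha> \<beta> :: "complex \<Rightarrow> complex"
  assumes \<beta>: "linear \<beta>" and inv: "\<And>h. \<beta> (\<alpha> h) = h" and tr: "Re (\<beta> 1) + Im (\<beta> \<i>) = 0"
  shows "Re (\<alpha> 1) + Im (\<alpha> \<i>) = 0"
proof -
  note split = linear_complex_expand[OF \<beta>]
  define p s r t where "p = Re (\<beta> 1)" "s = Im (\<beta> 1)" "r = Re (\<beta> \<i>)" "t = Im (\<beta> \<i>)"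
  define a1 a2 b1 b2 where "a1 = Re (\<alpha> 1)" "a2 = Im (\<alpha> 1)" "b1 = Re (\<alpha> \<i>)" "b2 = Im (\<alpha> \<i>)"
  note defs = p_s_r_t_def a1_a2_b1_b2_def
  have e: "a1 * p + a2 * r = 1" "a1 * s + a2 * t = 0" "b1 * p + b2 * r = 0" "b1 * s + b2 * t = 1"
    using inv[of 1] inv[of \<i>] split[of "\<alpha> 1"] split[of "\<alpha> \<i>"]
    by (simp_all add: defs complex_eq_iff)
  have tr: "p + t = 0" using tr by (simp add: defs)
  have "(p * t - r * s) * (a1 * b2 - a2 * b1) = 1" using e by algebra
  then have \<delta>: "p * t - r * s \<noteq> 0" by auto
  have "(p * t - r * s) * a1 = t" "(p * t - r * s) * b2 = p" using e by algebra+
  then have "(p * t - r * s) * (a1 + b2) = 0" using tr by (simp add: distrib_left)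
  then show ?thesis using \<delta> by (simp add: defs)
qed

text \<open>
  Orthogonality of \<open>dY\<close> to the normal \<open>p\<close> gives \<open>du = \<langle>Y, dp\<rangle>\<close>, hence the second derivative of \<open>u\<close> and
  \<open>Y = X\<^sub>u\<close>.  The mean curvature is evaluated in the frame of vectors whose images under \<open>dX\<close> are
  given by the disc chart; there the differential of the Gauss map is the inverse of \<open>dY\<close>.
\<close>

theorem gauss_parametrization:
  fixes M :: "'m::euclidean_space set"
  assumes X: "maximal_immersion M X" and loc: "local_gauss_inverse M X W g"
  shows "surf_Ck 2 W (support_fun X g)"
    and "p \<in> W \<Longrightarrow> X (g p) = X_of (support_fun X g) p"
    and "p \<in> W \<Longrightarrow> H2_laplacian (support_fun X g) p - 2 * support_fun X g p = 0"
proof -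
  let ?D = "disc_region W" and ?N = "gauss_map M X" and ?u = "support_fun X g"
  have W: "openin (top_of_set H2) W" and gW: "openin (top_of_set M) (g ` W)"
    and hom: "homeomorphism (g ` W) W ?N g" and CN: "surf_Ck 1 (g ` W) ?N" and Cg: "surf_Ck 1 W g"
    using loc by (auto simp: local_gauss_inverse_def C1_diffeo_def H2_domain_def)
  have M: "is_surface M" and CX: "surf_Ck 1 M X"
    and pos: "\<And>q v. q \<in> M \<Longrightarrow> v \<in> tangent_space M q \<Longrightarrow> v \<noteq> 0 \<Longrightarrow>
      lprod (surf_diff M X q v) (surf_diff M X q v) > 0"
    and H: "\<And>q. q \<in> M \<Longrightarrow> mean_curvature M X q = 0"
    using X surf_Ck_mono[of 2 M X 1] by (auto simp: maximal_immersion_def spacelike_immersion_def)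
  have WH: "W \<subseteq> H2" using W openin_imp_subset by blast
  have gM: "g ` W \<subseteq> M" using gW openin_imp_subset by blast
  have D: "open ?D" "?D \<subseteq> ball 0 1" using open_disc_region[OF W] by (auto simp: disc_region_def)
  have norm: "cmod z < 1" if "z \<in> ?D" for z using that D by auto
  have zW: "poincare z \<in> W" if "z \<in> ?D" for z using that by (simp add: disc_region_def)
  have pW: "\<exists>z\<in>?D. p = poincare z" if "p \<in> W" for p
    using that poincare_image_disc_region[OF WH] by blast
  have Ng: "?N (g p) = p" if "p \<in> W" for p using hom that by (simp add: homeomorphism_def)
  define G where "G = (\<lambda>z. g (poincare z))"
  define G' where "G' = (\<lambda>z. frechet_derivative G (at z))"
  have CG: "Ck_on (Suc 0) ?D G"
    using surf_Ck_imp_Ck_on_disc[OF W Cg] by (simp add: G_def del: Ck_on.simps)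
  have G': "(G has_derivative G' z) (at z)" if "z \<in> ?D" for z
    unfolding G'_def by (rule Ck_on_SucD[OF CG that])
  have GD: "G ` ?D = g ` W"
    unfolding G_def using poincare_image_disc_region[OF WH] image_image[of g poincare ?D] by simp
  have GM: "G z \<in> M" if "z \<in> ?D" for z using GD gM that by blast
  have sW: "is_surface (g ` W)" by (rule is_surface_openin[OF gW M])
  have par: "param_chart M ?D G G' (\<lambda>q. poincare_inv (?N q))"
  proof
    show "openin (top_of_set M) (G ` ?D)" unfolding GD by (rule gW)
    fix z assume z: "z \<in> ?D"
    show "(G has_derivative G' z) (at z)" by (rule G'[OF z])
    show "poincare_inv (?N (G z)) = z"
      using Ng[OF zW[OF z]] poincare_inv_poincare[OF norm[OF z]] by (simp add: G_def)
    have Gz: "G z \<in> g ` W" using GD z by blast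
    obtain O' N' where O': "open O'" "G z \<in> O'" "Ck_on 1 O' N'" "\<And>y. y \<in> g ` W \<inter> O' \<Longrightarrow> N' y = ?N y"
      by (rule surf_C1_extension[OF sW CN Gz]) (rule that; (assumption | simp))
    have "(N' has_derivative frechet_derivative N' (at (G z))) (at (G z))"
      using Ck_on_SucD[of 0 O' N' "G z"] O' by simp
    from has_derivative_at_withinI[OF this, of "g ` W \<inter> O'"]
    have N'd: "(N' has_derivative frechet_derivative N' (at (G z))) (at (G z) within g ` W \<inter> O')" .
    have "(poincare_inv has_derivative frechet_derivative poincare_inv (at (N' (G z)))) (at (N' (G z)))"
    proof (rule Ck_on_SucD[OF Ck_on_poincare_inv])
      have "N' (G z) = poincare z" using O'(4)[of "G z"] O'(2) Gz Ng[OF zW[OF z]] by (simp add: G_def)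
      then show "N' (G z) \<in> upper_region" using zW[OF z] WH H2_subset_upper by auto
    qed
    from has_derivative_compose[OF N'd this]
    have "((\<lambda>q. poincare_inv (N' q)) has_derivative
        (\<lambda>v. frechet_derivative poincare_inv (at (N' (G z))) (frechet_derivative N' (at (G z)) v)))
        (at (G z) within g ` W \<inter> O')" .
    then have "((\<lambda>q. poincare_inv (?N q)) has_derivative
        (\<lambda>v. frechet_derivative poincare_inv (at (N' (G z))) (frechet_derivative N' (at (G z)) v)))
        (at (G z) within g ` W \<inter> O')"
      by (rule has_derivative_transform[rotated 2]) (use O' Gz in auto)
    moreover have "at (G z) within g ` W \<inter> O' = at (G z) within M"
      by (rule at_within_openin) (use openin_Int_open[OF gW O'(1)] Gz O'(2) in auto)
    ultimately have "((\<lambda>q. poincare_inv (?N q)) has_derivative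
        (\<lambda>v. frechet_derivative poincare_inv (at (N' (G z))) (frechet_derivative N' (at (G z)) v)))
        (at (G z) within M)" by simp
    then show "(\<lambda>q. poincare_inv (?N q)) differentiable (at (G z) within M)"
      by (rule differentiableI)
  qed (rule D(1))
  interpret chart: param_chart M ?D G G' "\<lambda>q. poincare_inv (?N q)" by (rule par)
  define Y where "Y = (\<lambda>z. X (G z))"
  have CY: "Ck_on (Suc 0) ?D Y"
  proof (rule Ck_on_local[OF D(1)])
    fix z assume z: "z \<in> ?D"
    obtain O' X' where O': "open O'" "G z \<in> O'" "Ck_on 1 O' X'" "\<And>y. y \<in> M \<inter> O' \<Longrightarrow> X' y = X y"
      by (rule surf_C1_extension[OF M CX GM[OF z]]) (rule that; (assumption | simp))
    let ?V = "?D \<inter> G -` O'"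
    have oV: "open ?V"
      by (rule continuous_open_preimage[OF Ck_on_continuous[OF CG] D(1) O'(1)])
    have "Ck_on 1 ?V (\<lambda>z. X' (G z))"
      by (rule Ck_on_compose[OF oV _ O'(3) Ck_on_subset[OF CG[folded One_nat_def]]]) auto
    then have "Ck_on 1 ?V Y"
      by (rule Ck_on_cong[OF oV, rotated]) (use O'(4) GM in \<open>auto simp: Y_def\<close>)
    moreover have "?D \<inter> ?V = ?V" by blast
    ultimately have "Ck_on (Suc 0) (?D \<inter> ?V) Y" by simp
    then show "\<exists>V. open V \<and> z \<in> V \<and> Ck_on (Suc 0) (?D \<inter> V) Y"
      using oV z O'(2) by (intro exI[of _ ?V]) auto
  qed
  define Y' where "Y' = (\<lambda>z. frechet_derivative Y (at z))"
  have Y': "(Y has_derivative Y' z) (at z)" if "z \<in> ?D" for z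
    unfolding Y'_def by (rule Ck_on_SucD[OF CY that])
  have dX: "surf_diff M X (G z) (G' z h) = Y' z h" if "z \<in> ?D" for z h
    by (rule chart.surf_diff_eq[OF that Y'[OF that, unfolded Y_def]])
  have posY: "lprod (Y' z h) (Y' z h) > 0" if z: "z \<in> ?D" and "h \<noteq> 0" for z h
  proof -
    have "G' z h \<noteq> 0"
      using inj_eq[OF chart.deriv_inj[OF z], of h 0] linear_0[OF has_derivative_linear[OF G'[OF z]]]
        \<open>h \<noteq> 0\<close> by simp
    then show ?thesis
      using pos[OF GM[OF z], of "G' z h"] chart.tangent_space_eq[OF z] dX[OF z] by auto
  qed
  have normal: "lprod (Y' z h) (poincare z) = 0" if z: "z \<in> ?D" for z h
  proof -
    have "\<exists>!n. n \<in> H2 \<and> (\<forall>h. lprod (Y' z h) n = 0)"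
      by (rule spacelike_plane_unique_normal[OF has_derivative_linear[OF Y'[OF z]] posY[OF z]])
    moreover have "?N (G z) = (THE n. n \<in> H2 \<and> (\<forall>h. lprod (Y' z h) n = 0))"
      unfolding gauss_map_def chart.tangent_space_eq[OF z] by (simp add: dX[OF z])
    ultimately have "\<forall>h. lprod (Y' z h) (?N (G z)) = 0"
      using theI'[of "\<lambda>n. n \<in> H2 \<and> (\<forall>h. lprod (Y' z h) n = 0)"] by simp
    then show ?thesis using Ng[OF zW[OF z]] by (simp add: G_def)
  qed
  have trace: "lprod (Y' z 1) (poincare_deriv z 1) + lprod (Y' z \<i>) (poincare_deriv z \<i>) = 0"
    if z: "z \<in> ?D" for z
  proof -
    define c where "c = conf_factor z"
    have c: "c > 0" using conf_factor_pos[OF norm[OF z]] by (simp add: c_def)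
    have lY: "linear (Y' z)" by (rule has_derivative_linear[OF Y'[OF z]])
    obtain \<alpha> where \<alpha>: "linear \<alpha>" "\<And>h. Y' z h = poincare_deriv z (\<alpha> h)"
      by (rule tangent_plane_coordinates[OF norm[OF z] lY normal[OF z]]) (rule that; simp)
    have "inj \<alpha>"
      unfolding linear_injective_0[OF \<alpha>(1)]
    proof (intro allI impI)
      fix h assume "\<alpha> h = 0"
      then have "Y' z h = 0" using \<alpha>(2)[of h] linear_0[OF linear_poincare_deriv[of z]] by simp
      then show "h = 0" using posY[OF z, of h] by (auto simp: lprod_bilinear)
    qed
    then have "surj \<alpha>" by (rule linear_inj_imp_surj[OF \<alpha>(1)])
    obtain \<beta> where \<beta>: "linear \<beta>" "\<beta> \<circ> \<alpha> = id"
      using linear_injective_left_inverse[OF \<alpha>(1) \<open>inj \<alpha>\<close>] by blast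
    have \<beta>\<alpha>: "\<beta> (\<alpha> h) = h" for h using fun_cong[OF \<beta>(2), of h] by simp
    have \<alpha>\<beta>: "\<alpha> (\<beta> h) = h" for h
    proof -
      obtain k where "h = \<alpha> k" using \<open>surj \<alpha>\<close> by (rule surjE)
      then show ?thesis by (simp add: \<beta>\<alpha>)
    qed
    \<comment> \<open>tangent vectors of \<open>M\<close>, labelled by the disc coordinate \<open>h\<close> of their images under \<open>dX\<close>\<close>
    define L where "L h = G' z (\<beta> h)" for h
    have rL: "range L = range (G' z)"
    proof -
      have "G' z k = L (\<alpha> k)" for k by (simp add: L_def \<beta>\<alpha>)
      then show ?thesis by (auto simp: L_def)
    qed
    have dXL: "surf_diff M X (G z) (L h) = poincare_deriv z h" for h
      unfolding L_def dX[OF z] \<alpha>(2) \<alpha>\<beta> ..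
    have NG: "((\<lambda>y. ?N (G y)) has_derivative poincare_deriv z) (at z)"
    proof (rule has_derivative_transform_within_open[OF has_derivative_poincare[OF norm[OF z]] D(1) z])
      show "poincare y = ?N (G y)" if "y \<in> ?D" for y using Ng[OF zW[OF that]] by (simp add: G_def)
    qed
    have dNL: "surf_diff M ?N (G z) (L h) = poincare_deriv z (\<beta> h)" for h
      unfolding L_def by (rule chart.surf_diff_eq[OF z NG])
    note split = linear_complex_expand[OF \<beta>(1)]
    have "metric_trace (\<lambda>v w. lprod (surf_diff M X (G z) v) (surf_diff M X (G z) w)) (range L)
       (\<lambda>v w. - lprod (surf_diff M ?N (G z) v) (surf_diff M X (G z) w))
      = (- c * Re (\<beta> 1) + - c * Im (\<beta> \<i>)) / c"
    proof (rule metric_trace_conformal[where L = L and c = c and ?a11.0 = "- c * Re (\<beta> 1)"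
          and ?a12.0 = "- c * (Re (\<beta> \<i>) + Im (\<beta> 1))" and ?a22.0 = "- c * Im (\<beta> \<i>)"])
      show "lprod (surf_diff M X (G z) (L h)) (surf_diff M X (G z) (L k)) = c * Re (h * cnj k)" for h k
        unfolding dXL c_def by (rule lprod_poincare_deriv[OF norm[OF z]])
      show "- lprod (surf_diff M ?N (G z) (L h)) (surf_diff M X (G z) (L h)) =
         - c * Re (\<beta> 1) * (Re h)\<^sup>2 + - c * (Re (\<beta> \<i>) + Im (\<beta> 1)) * (Re h * Im h) + - c * Im (\<beta> \<i>) * (Im h)\<^sup>2" for h
        unfolding dXL dNL lprod_poincare_deriv[OF norm[OF z]] c_def[symmetric]
        by (subst split[of h]) (simp add: power2_eq_square algebra_simps)
    qed (rule c)
    also have "\<dots> = - (Re (\<beta> 1) + Im (\<beta> \<i>))" using c by (simp add: field_simps)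
    finally have "mean_curvature M X (G z) = - (Re (\<beta> 1) + Im (\<beta> \<i>)) / 2"
      unfolding mean_curvature_def chart.tangent_space_eq[OF z] rL by simp
    then have "Re (\<beta> 1) + Im (\<beta> \<i>) = 0" using H[OF GM[OF z]] by simp
    then have "Re (\<alpha> 1) + Im (\<alpha> \<i>) = 0" by (rule inverse_trace_zero[OF \<beta>(1) \<beta>\<alpha>])
    then have "c * (Re (\<alpha> 1) + Im (\<alpha> \<i>)) = 0" by simp
    then show ?thesis
      unfolding \<alpha>(2) lprod_poincare_deriv[OF norm[OF z]] c_def[symmetric] by (simp add: distrib_left)
  qed
  have uY: "?u (poincare z) = lprod (Y z) (poincare z)" for z
    by (simp add: support_fun_def Y_def G_def)
  have dU: "((\<lambda>y. ?u (poincare y)) has_derivative (\<lambda>h. lprod (Y z) (poincare_deriv z h))) (at z)"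
    if z: "z \<in> ?D" for z
    unfolding uY
    by (rule has_derivative_eq_rhs,
        rule bounded_bilinear.FDERIV[OF bounded_bilinear_lprod Y'[OF z] has_derivative_poincare[OF norm[OF z]]])
      (simp add: normal[OF z])
  have CU: "Ck_on (Suc (Suc 0)) ?D (\<lambda>z. ?u (poincare z))"
  proof (rule Ck_on_SucI[OF D(1) dU])
    fix v
    have "Ck_on (Suc 0) ?D (\<lambda>z. frechet_derivative poincare (at z) v)"
      by (rule Ck_on_SucD'[OF Ck_on_subset[OF Ck_on_poincare D(2)]])
    then have "Ck_on (Suc 0) ?D (\<lambda>z. poincare_deriv z v)"
    proof (rule Ck_on_cong[OF D(1), rotated])
      fix z assume "z \<in> ?D"
      from frechet_derivative_at[OF has_derivative_poincare[OF norm[OF this]]]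
      show "frechet_derivative poincare (at z) v = poincare_deriv z v" by simp
    qed
    then show "Ck_on (Suc 0) ?D (\<lambda>z. lprod (Y z) (poincare_deriv z v))"
      by (rule Ck_on_bilinear[OF bounded_bilinear_lprod D(1) CY])
  qed
  show "surf_Ck 2 W ?u"
    by (rule Ck_on_disc_imp_surf_Ck[OF W order_refl]) (use CU in \<open>simp only: numeral_2_eq_2\<close>)
  have XY: "X_of ?u (poincare z) = Y z" if z: "z \<in> ?D" for z
  proof -
    have pp: "lprod (poincare z) (poincare z) = -1" by (rule H2_self[OF poincare_in_H2[OF norm[OF z]]])
    have pd: "lprod (poincare z) (poincare_deriv z h) = 0" for h
      using lprod_poincare_deriv_poincare[OF norm[OF z], of h] by (simp add: lprod_commute)
    have "H2_grad ?u (poincare z) = Y z + ?u (poincare z) *\<^sub>R poincare z"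
      by (rule H2_grad_poincare[OF norm[OF z] dU[OF z]]) (simp_all add: lprod_bilinear pp pd uY)
    then show ?thesis by (simp add: X_of_def)
  qed
  show "X (g p) = X_of ?u p" if "p \<in> W"
    using pW[OF that] XY by (auto simp: Y_def G_def)
  have "H2_laplacian ?u (poincare z) = 2 * ?u (poincare z)" if z: "z \<in> ?D" for z
  proof -
    have hess: "H2_hess ?u (poincare z) (poincare_deriv z h) = Y' z h + ?u (poincare z) *\<^sub>R poincare_deriv z h" for h
      by (rule X_of_hessian(2)[OF D z dU XY uY[symmetric] refl Y'[OF z]])
    show ?thesis
      by (subst H2_laplacian_poincare[OF norm[OF z] hess has_derivative_linear[OF Y'[OF z]]])
        (simp add: trace[OF z])
  qed
  then show "H2_laplacian ?u p - 2 * ?u p = 0" if "p \<in> W" using pW[OF that] by auto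
qed

text \<open>
  A local diffeomorphism supplies an inverse on some open set of the hyperbolic plane; a disc in the
  chart around the image point makes its domain connected.
\<close>

lemma local_gauss_inverse_exists:
  fixes M :: "'m::euclidean_space set"
  assumes loc: "local_diffeo M H2 (gauss_map M X)" and q: "q \<in> M"
  shows "\<exists>W g. local_gauss_inverse M X W g \<and> q \<in> g ` W"
proof -
  let ?N = "gauss_map M X"
  obtain V W0 g where V: "openin (top_of_set M) V" "q \<in> V" and W0: "openin (top_of_set H2) W0"
    and "C1_diffeo V W0 ?N g"
    using loc q unfolding local_diffeo_def by blast
  then have hom: "homeomorphism V W0 ?N g" and CN: "surf_Ck 1 V ?N" and Cg: "surf_Ck 1 W0 g"
    by (auto simp: C1_diffeo_def)
  have W0H: "W0 \<subseteq> H2" using W0 openin_imp_subset by blast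
  have Nq: "?N q \<in> W0" "g (?N q) = q" using hom V(2) by (auto simp: homeomorphism_def)
  then obtain z where z: "z \<in> disc_region W0" "?N q = poincare z"
    using poincare_image_disc_region[OF W0H] by blast
  obtain r where r: "r > 0" "ball z r \<subseteq> disc_region W0"
    using open_disc_region[OF W0] z(1) open_contains_ball by blast
  define W where "W = poincare ` ball z r"
  have rD: "ball z r \<subseteq> ball 0 1" using r(2) by (auto simp: disc_region_def)
  have W: "openin (top_of_set H2) W" unfolding W_def by (rule openin_poincare_image[OF open_ball rD])
  have "connected W"
    unfolding W_def
    by (rule connected_continuous_image[OF continuous_on_subset[OF continuous_on_poincare rD] connected_ball])
  have WW0: "W \<subseteq> W0" unfolding W_def using r(2) by (auto simp: disc_region_def)
  have W0W: "openin (top_of_set W0) W" by (rule openin_subset_trans[OF W WW0 W0H])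
  have Vg: "openin (top_of_set V) (g ` W)"
    by (rule homeomorphism_imp_open_map[OF homeomorphism_symD[OF hom] W0W])
  have gWV: "g ` W \<subseteq> V" using Vg openin_imp_subset by blast
  have NgW: "?N ` g ` W = W"
  proof -
    have "?N (g p) = p" if "p \<in> W" for p using hom WW0 that by (auto simp: homeomorphism_def)
    then show ?thesis by (simp add: image_image)
  qed
  have "homeomorphism (g ` W) W ?N g"
    by (rule homeomorphism_of_subsets[OF hom gWV WW0 NgW])
  moreover have "surf_Ck 1 (g ` W) ?N" by (rule surf_Ck_openin[OF Vg CN])
  moreover have "surf_Ck 1 W g" by (rule surf_Ck_openin[OF W0W Cg])
  moreover have "openin (top_of_set M) (g ` W)" by (rule openin_trans[OF Vg V(1)])
  ultimately have "local_gauss_inverse M X W g"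
    unfolding local_gauss_inverse_def C1_diffeo_def H2_domain_def using W \<open>connected W\<close> by blast
  moreover have "q \<in> g ` W"
  proof -
    have "?N q \<in> W" unfolding W_def z(2) using r(1) by simp
    then show ?thesis using Nq(2) by (metis imageI)
  qed
  ultimately show ?thesis by blast
qed

theorem theoremA:
  shows
    "(\<forall>\<Omega> u. H2_domain \<Omega> \<and> surf_Ck 2 \<Omega> u \<and> (\<forall>p\<in>\<Omega>. H2_laplacian u p - 2 * u p = 0) \<longrightarrow>
        (X_of u constant_on \<Omega> \<or> branched_maximal_immersion \<Omega> (branch_points \<Omega> u) (X_of u)) \<and>
        (\<forall>p\<in>regular_set \<Omega> u. gauss_map (regular_set \<Omega> u) (X_of u) p = p))
     \<and>
     (\<forall>(M :: 'm::euclidean_space set) X.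
        maximal_immersion M X \<and> local_diffeo M H2 (gauss_map M X) \<longrightarrow>
        (\<forall>q\<in>M. \<exists>W g. local_gauss_inverse M X W g \<and> q \<in> g ` W) \<and>
        (\<forall>W g. local_gauss_inverse M X W g \<longrightarrow>
           surf_Ck 2 W (support_fun X g) \<and>
           (\<forall>p\<in>W. X (g p) = X_of (support_fun X g) p \<and>
                   H2_laplacian (support_fun X g) p - 2 * support_fun X g p = 0)))"
proof (intro conjI allI impI ballI)
  fix \<Omega> u assume *: "H2_domain \<Omega> \<and> surf_Ck 2 \<Omega> u \<and> (\<forall>p\<in>\<Omega>. H2_laplacian u p - 2 * u p = 0)"
  then have \<Omega>: "H2_domain \<Omega>" "surf_Ck 2 \<Omega> u" "\<And>p. p \<in> \<Omega> \<Longrightarrow> H2_laplacian u p - 2 * u p = 0" by auto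
  show "X_of u constant_on \<Omega> \<or> branched_maximal_immersion \<Omega> (branch_points \<Omega> u) (X_of u)"
    by (rule X_of_branched_maximal(1)[OF \<Omega>])
  show "gauss_map (regular_set \<Omega> u) (X_of u) p = p" if "p \<in> regular_set \<Omega> u" for p
    by (rule X_of_branched_maximal(2)[OF \<Omega> that])
next
  fix M :: "'m set" and X
  assume *: "maximal_immersion M X \<and> local_diffeo M H2 (gauss_map M X)"
  then have X: "maximal_immersion M X" and loc: "local_diffeo M H2 (gauss_map M X)" by auto
  show "\<exists>W g. local_gauss_inverse M X W g \<and> q \<in> g ` W" if "q \<in> M" for q
    by (rule local_gauss_inverse_exists[OF loc that])
  fix W g assume g: "local_gauss_inverse M X W g"
  show "surf_Ck 2 W (support_fun X g)" by (rule gauss_parametrization(1)[OF X g])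
  fix p assume p: "p \<in> W"
  show "X (g p) = X_of (support_fun X g) p" by (rule gauss_parametrization(2)[OF X g p])
  show "H2_laplacian (support_fun X g) p - 2 * support_fun X g p = 0"
    by (rule gauss_parametrization(3)[OF X g p])
qed

end
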